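(* Let $Z$ be a simplicial complex, $D\subset Z$ a definable set and $l:Z\to Z$ an open (continuous) map such that $l(D)\subset D$ and $l(Z\setminus D)\subset Z\setminus D$. Let $(X,A,f)$ and $(Y,B,g)$ be two triangulations of $(Z,D,l)$ given by the definable triangulation theorem, and let $f^{\mathrm{simp}}$ and $g^{\mathrm{simp}}$ be simplicial approximations of $f$ and $g$ used to compute $\varLambda_c(f,A)=\varLambda^c(f^{\mathrm{simp}},A)$ and $\varLambda_c(g,B)=\varLambda^c(g^{\mathrm{simp}},B)$. Then $$\varLambda_c(f,A)=\varLambda_c(g,B).$$ In other words, the combinatorial Lefschetz number $\varLambda(l,D)_Z:=\varLambda_c(f,A)$ is well defined, independently of the triangulation and of the simplicial approximation.
   Context: Fix an o-minimal structure on $\mathbb{R}$ containing all semilinear sets; "definable" refers to this structure. Simplicial complexes are finite (geometric, in some $\mathbb{R}^n$) and are identified with their underlying compact polyhedra. Triangulations. By the definable triangulation theorem, for $Z$ a simplicial complex and $D\subset Z$ definable there are a simplicial complex $X$ and a definable homeomorphism $\tau:X\to Z$ such that $A=\tau^{-1}(D)$ is a union of open simplices (interiors of simplices) of $X$. For a continuous map $l:Z\to Z$ put $f=\tau^{-1}\circ l\circ\tau:X\to X$. The triple $(X,A,f)$ is called a triangulation of $(Z,D,l)$. The number $\varLambda^c$. Let $f^{\mathrm{simp}}:X'\to X$ be a simplicial approximation of $f$, where $X'$ is a subdivision of $X$. Let $M_p(f^{\mathrm{simp}},X)$ be the matrix, in the basis of (oriented) $p$-simplices of $X$, of the composite $C_p(X;\mathbb{Q})\to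 C_p(X';\mathbb{Q})\to C_p(X;\mathbb{Q})$ of the subdivision operator with the chain map induced by $f^{\mathrm{simp}}$, and let $M_p(f^{\mathrm{simp}},X)_{|A}$ be the submatrix with rows and columns indexed by the $p$-simplices whose interior is contained in $A$. Define $$\varLambda^c(f^{\mathrm{simp}},A):=\sum_p(-1)^p\,\mathrm{tr}\bigl(M_p(f^{\mathrm{simp}},X)_{|A}\bigr),\qquad \varLambda_c(f,A):=\varLambda^c(f^{\mathrm{simp}},A).$$ *)

theory Defs
  imports "HOL-Analysis.Analysis" "Jordan_Normal_Form.Determinant"
begin

no_notation Matrix.scalar_prod (infix "\<bullet>" 70)

section \<open>O-minimal structures\<close>

text \<open>The space \<open>\<real>\<^sup>n\<close>, for \<open>n\<close> a variable natural number, is the set of real lists of length \<open>n\<close>.\<close>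

inductive semilinear :: "nat \<Rightarrow> real list set \<Rightarrow> bool" for n :: nat where
  halfspace: "length as = n \<Longrightarrow>
    semilinear n {xs. length xs = n \<and> 0 < c + (\<Sum>i<n. as ! i * xs ! i)}"
| union: "semilinear n A \<Longrightarrow> semilinear n B \<Longrightarrow> semilinear n (A \<union> B)"
| complement: "semilinear n A \<Longrightarrow> semilinear n ({xs. length xs = n} - A)"

text \<open>\<open>\<S> n\<close> is the collection of definable subsets of \<open>\<real>\<^sup>n\<close>.  Every set definable in one variable is
  a finite union of intervals; points are degenerate intervals.\<close>

locale o_minimal_structure =
  fixes \<S> :: "nat \<Rightarrow> real list set set"
  assumes carrier: "A \<in> \<S> n \<Longrightarrow> A \<subseteq> {xs. length xs = n}"
    and empty: "{} \<in> \<S> n"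
    and union: "A \<in> \<S> n \<Longrightarrow> B \<in> \<S> n \<Longrightarrow> A \<union> B \<in> \<S> n"
    and complement: "A \<in> \<S> n \<Longrightarrow> {xs. length xs = n} - A \<in> \<S> n"
    and cylinder_left: "A \<in> \<S> n \<Longrightarrow> {x # xs | x xs. xs \<in> A} \<in> \<S> (Suc n)"
    and cylinder_right: "A \<in> \<S> n \<Longrightarrow> {xs @ [x] | x xs. xs \<in> A} \<in> \<S> (Suc n)"
    and diagonal: "1 \<le> n \<Longrightarrow> {xs. length xs = n \<and> xs ! 0 = xs ! (n - 1)} \<in> \<S> n"
    and projection: "A \<in> \<S> (Suc n) \<Longrightarrow> butlast ` A \<in> \<S> n"
    and less: "{[x, y] | x y. x < y} \<in> \<S> 2"
    and o_minimal: "A \<in> \<S> 1 \<Longrightarrow>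
          \<exists>\<I>. finite \<I> \<and> (\<forall>I\<in>\<I>. is_interval I) \<and> {x. [x] \<in> A} = \<Union>\<I>"
    and semilinear: "semilinear n A \<Longrightarrow> A \<in> \<S> n"

text \<open>A Euclidean space is read in coordinates by enumerating its standard basis.  The choice of the
  enumeration is immaterial, as the axioms make every \<open>\<S> n\<close> invariant under permutations of the
  coordinates.\<close>

definition definable :: "(nat \<Rightarrow> real list set set) \<Rightarrow> 'a::euclidean_space set \<Rightarrow> bool" where
  "definable \<S> D \<longleftrightarrow>
     (\<exists>bs. distinct bs \<and> set bs = Basis \<and> (\<lambda>x. map (\<lambda>b. x \<bullet> b) bs) ` D \<in> \<S> DIM('a))"

definition definable_on ::
  "(nat \<Rightarrow> real list set set) \<Rightarrow> 'a::euclidean_space set \<Rightarrow> ('a \<Rightarrow> 'b::euclidean_space) \<Rightarrow> bool" where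
  "definable_on \<S> A f \<longleftrightarrow> definable \<S> ((\<lambda>x. (x, f x)) ` A)"

section \<open>Triangulations\<close>

text \<open>Simplicial complexes are those of \<open>HOL-Analysis\<close>: finite sets of closed simplices, closed under
  faces, possibly containing the empty face as a \<open>(-1)\<close>-simplex.  The polyhedron of \<open>X\<close> is \<open>\<Union>X\<close>.\<close>

definition definable_triangulation ::
  "(nat \<Rightarrow> real list set set) \<Rightarrow> 'c::euclidean_space set set \<Rightarrow> 'c set \<Rightarrow> ('c \<Rightarrow> 'c) \<Rightarrow>
   'a::euclidean_space set set \<Rightarrow> 'a set \<Rightarrow> ('a \<Rightarrow> 'a) \<Rightarrow> bool" where
  "definable_triangulation \<S> Z D l X A f \<longleftrightarrow>
     simplicial_complex X \<and>
     (\<exists>\<tau> \<tau>'. homeomorphism (\<Union>X) (\<Union>Z) \<tau> \<tau>' \<and> definable_on \<S> (\<Union>X) \<tau> \<and>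
        A = {x \<in> \<Union>X. \<tau> x \<in> D} \<and>
        (\<exists>F\<subseteq>X. A = (\<Union>S\<in>F. rel_interior S)) \<and>
        (\<forall>x\<in>\<Union>X. f x = \<tau>' (l (\<tau> x))))"

section \<open>Simplicial approximations\<close>

definition simplex_vertices :: "'a::euclidean_space set \<Rightarrow> 'a set" where
  "simplex_vertices S = {v. v extreme_point_of S}"

definition subdivision_of :: "'a::euclidean_space set set \<Rightarrow> 'a set set \<Rightarrow> bool" where
  "subdivision_of X' X \<longleftrightarrow>
     simplicial_complex X' \<and> \<Union>X' = \<Union>X \<and> (\<forall>S\<in>X'. \<exists>T\<in>X. S \<subseteq> T)"

text \<open>The first condition, applied to the \<open>0\<close>-simplices, says that vertices go to vertices.\<close>

definition simplicial_map ::
  "'a::euclidean_space set set \<Rightarrow> 'b::euclidean_space set set \<Rightarrow> ('a \<Rightarrow> 'b) \<Rightarrow> bool" where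
  "simplicial_map X Y g \<longleftrightarrow>
     (\<forall>S\<in>X. convex hull (g ` simplex_vertices S) \<in> Y \<and>
        (\<forall>u. (\<forall>v\<in>simplex_vertices S. 0 \<le> u v) \<and> sum u (simplex_vertices S) = 1 \<longrightarrow>
           g (\<Sum>v\<in>simplex_vertices S. u v *\<^sub>R v) = (\<Sum>v\<in>simplex_vertices S. u v *\<^sub>R g v)))"

text \<open>The point \<open>g x\<close> lies in the carrier of \<open>f x\<close>, the simplex whose open simplex contains \<open>f x\<close>.\<close>

definition simplicial_approximation ::
  "'a::euclidean_space set set \<Rightarrow> 'b::euclidean_space set set \<Rightarrow> ('a \<Rightarrow> 'b) \<Rightarrow> ('a \<Rightarrow> 'b) \<Rightarrow> bool"
  where
  "simplicial_approximation X' Y f g \<longleftrightarrow>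
     simplicial_map X' Y g \<and> (\<forall>x\<in>\<Union>X'. \<forall>S\<in>Y. f x \<in> rel_interior S \<longrightarrow> g x \<in> S)"

section \<open>Chains\<close>

definition p_simplices :: "nat \<Rightarrow> 'a::euclidean_space set set \<Rightarrow> 'a set set" where
  "p_simplices p X = {S \<in> X. int p simplex S}"

text \<open>An orientation of a simplex is given by an ordering of its vertices; one is fixed for every
  simplex.\<close>

definition vertex_order :: "'a::euclidean_space set \<Rightarrow> 'a list" where
  "vertex_order S = (SOME vs. distinct vs \<and> set vs = simplex_vertices S)"

text \<open>Let \<open>vs\<close> and \<open>ws\<close> list the vertices of two \<open>p\<close>-simplices that span the same affine subspace, and
  let \<open>V\<close>, \<open>W\<close> be the matrices with columns \<open>vs ! i - vs ! 0\<close> and \<open>ws ! i - ws ! 0\<close>, for \<open>1 \<le> i \<le> p\<close>.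
  Then \<open>W = V T\<close> with \<open>T\<close> invertible, and the transpose of \<open>W\<close> times \<open>V\<close> has determinant \<open>det T\<close> times the
  (positive) Gram determinant of \<open>V\<close>.  So the sign below is that of \<open>det T\<close>; when \<open>ws\<close> is a permutation
  of \<open>vs\<close>, it is the sign of the permutation.\<close>

definition relative_orientation :: "'a::euclidean_space list \<Rightarrow> 'a list \<Rightarrow> rat" where
  "relative_orientation vs ws =
     (let p = length vs - 1;
          d = Determinant.det (Matrix.mat p p
                (\<lambda>(i, j). (ws ! Suc i - ws ! 0) \<bullet> (vs ! Suc j - vs ! 0)))
      in if d > 0 then 1 else if d < 0 then - 1 else 0)"

text \<open>A \<open>p\<close>-chain is given by its coefficients on the \<open>p\<close>-simplices, oriented by \<^const>\<open>vertex_order\<close>.\<close>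

type_synonym 'a rat_chain = "'a set \<Rightarrow> rat"

definition basis_chain :: "'a set \<Rightarrow> 'a rat_chain" where
  "basis_chain S = (\<lambda>T. if T = S then 1 else 0)"

text \<open>The chain \<open>[v\<^sub>0, \<dots>, v\<^sub>p]\<close>, which is zero if two of the \<open>v\<^sub>i\<close> coincide.\<close>

definition oriented_simplex :: "'a::euclidean_space list \<Rightarrow> 'a rat_chain" where
  "oriented_simplex vs =
     (\<lambda>S. if distinct vs \<and> S = convex hull (set vs)
          then relative_orientation (vertex_order S) vs else 0)"

text \<open>\<open>C\<^sub>p(X; \<rat>) \<rightarrow> C\<^sub>p(X'; \<rat>)\<close>: an oriented \<open>p\<close>-simplex of \<open>X\<close> goes to the sum of the \<open>p\<close>-simplices of
  \<open>X'\<close> that it contains, with the orientation that it induces on them.\<close>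

definition subdivision_operator ::
  "nat \<Rightarrow> 'a::euclidean_space set set \<Rightarrow> 'a set set \<Rightarrow> 'a rat_chain \<Rightarrow> 'a rat_chain" where
  "subdivision_operator p X X' c =
     (\<lambda>T. \<Sum>S\<in>p_simplices p X. c S *
            (if T \<in> p_simplices p X' \<and> T \<subseteq> S
             then relative_orientation (vertex_order S) (vertex_order T) else 0))"

text \<open>\<open>C\<^sub>p(X'; \<rat>) \<rightarrow> C\<^sub>p(X; \<rat>)\<close>, \<open>[v\<^sub>0, \<dots>, v\<^sub>p] \<mapsto> [g v\<^sub>0, \<dots>, g v\<^sub>p]\<close>.\<close>

definition induced_chain_map ::
  "nat \<Rightarrow> 'a::euclidean_space set set \<Rightarrow> ('a \<Rightarrow> 'b::euclidean_space) \<Rightarrow> 'a rat_chain \<Rightarrow> 'b rat_chain"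
  where
  "induced_chain_map p X' g c =
     (\<lambda>S. \<Sum>T\<in>p_simplices p X'. c T * oriented_simplex (map g (vertex_order T)) S)"

section \<open>The combinatorial Lefschetz number\<close>

text \<open>The entry in row \<open>S\<close> and column \<open>T\<close> of \<open>M\<^sub>p(g, X)\<close>, where \<open>g\<close> is simplicial from \<open>X'\<close> to \<open>X\<close>.\<close>

definition chain_matrix ::
  "nat \<Rightarrow> 'a::euclidean_space set set \<Rightarrow> 'a set set \<Rightarrow> ('a \<Rightarrow> 'a) \<Rightarrow> 'a set \<Rightarrow> 'a set \<Rightarrow> rat" where
  "chain_matrix p X X' g S T =
     induced_chain_map p X' g (subdivision_operator p X X' (basis_chain T)) S"

text \<open>The simplices of a complex in \<open>'a\<close> have dimension at most \<open>DIM('a)\<close>.\<close>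

definition combinatorial_Lefschetz ::
  "'a::euclidean_space set set \<Rightarrow> 'a set set \<Rightarrow> ('a \<Rightarrow> 'a) \<Rightarrow> 'a set \<Rightarrow> rat" where
  "combinatorial_Lefschetz X X' g A =
     (\<Sum>p\<le>DIM('a). (- 1) ^ p *
        (\<Sum>S | S \<in> p_simplices p X \<and> rel_interior S \<subseteq> A. chain_matrix p X X' g S S))"

end

theory Submission
  imports Defs "HOL-Library.Poly_Mapping"
begin

text \<open>A simplicial approximation \<open>a\<close> of \<open>f\<close> on a subdivision \<open>K'\<close> of \<open>K\<close> induces the chain map
  \<open>push a \<circ> sd K'\<close> from the chains of \<open>K\<close> to those of the target, and for \<open>A = \<Union>X\<close> the number is, up to
  the augmentation, the supertrace of this chain map.  The supertrace is invariant under chain homotopy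
  and under exchanging the factors of a composite.  Up to homotopy the chain map depends only on \<open>f\<close> and
  is functorial, by acyclic carriers, because an arbitrary subdivision of a simplex is acyclic.  Hence if
  \<open>f = k \<circ> g \<circ> h\<close> for inverse homeomorphisms \<open>h\<close>, \<open>k\<close>, then the composite of \<open>k\<close> with \<open>g \<circ> h\<close> and that of
  \<open>g \<circ> h\<close> with \<open>k\<close> give the same supertrace, which is the one of \<open>f\<close> and of \<open>g\<close>.  No homology group is
  formed.

  For closed \<open>A\<close> this applies to the subcomplex \<open>A\<close>.  As \<open>l\<close> is open, the preimage of the closure of \<open>D\<close>
  is the closure of \<open>D\<close>, so the number of \<open>A\<close> is the one of \<open>closure A\<close> minus the one of
  \<open>closure A - A\<close>, which has fewer simplices in its closure.\<close>

text \<open>The subdivisions in the statement are arbitrary, so there is no cone structure from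
  which to read off that a subdivided simplex is acyclic, or that subdividing commutes with the
  boundary. The second is settled by counting, with signs, the top simplices on either side of a
  codimension one simplex. The first then follows from it: a straight-line contraction, cut into
  small steps, becomes a chain of contiguous vertex maps on a fine subdivision. Orientations are
  dealt with in an exterior algebra over all vertices. Its unit \<open>sx {}\<close> is the empty
  simplex, so complexes come augmented, acyclic means exact everywhere, and the degree of a simplex
  is its dimension plus one. This shift is the origin of the minus sign and of the extra 1 when
  supertraces are compared with Lefschetz numbers.\<close>

abbreviation lookup :: "('k \<Rightarrow>\<^sub>0 'b::zero) \<Rightarrow> 'k \<Rightarrow> 'b" where "lookup \<equiv> Poly_Mapping.lookup"
abbreviation keys :: "('k \<Rightarrow>\<^sub>0 'b::zero) \<Rightarrow> 'k set" where "keys \<equiv> Poly_Mapping.keys"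

section \<open>The chain algebra of finite sets\<close>

text \<open>One linear order on the whole type orients every finite set compatibly with its subsets,
  so the signs of faces are the usual alternating ones. The lists of \<open>vertex_order\<close>,
  chosen separately for each simplex, are compared with it in
  \<open>chain_matrix_diag\<close>.\<close>

definition vless :: "'v \<Rightarrow> 'v \<Rightarrow> bool" where
  "vless x y \<longleftrightarrow> x \<noteq> y \<and> (x, y) \<in> (SOME r. well_order_on UNIV r)"

lemma vless_irrefl [simp]: "\<not> vless x x"
  by (simp add: vless_def)

lemma vless_order:
  "\<exists>r :: 'v rel. linear_order r \<and> (\<forall>x y. vless x y \<longleftrightarrow> x \<noteq> y \<and> (x, y) \<in> r)"
proof (intro exI conjI allI)
  let ?r = "SOME r :: 'v rel. well_order_on UNIV r"
  have "well_order_on UNIV ?r"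
    using someI_ex[OF well_order_on, of "UNIV :: 'v set"] .
  then show "linear_order ?r" by (simp add: well_order_on_def)
qed (simp add: vless_def)

lemma vless_total:
  fixes x y :: 'v assumes "x \<noteq> y" shows "vless x y \<or> vless y x"
proof -
  obtain r :: "'v rel" where r: "linear_order r" "\<And>x y. vless x y \<longleftrightarrow> x \<noteq> y \<and> (x, y) \<in> r"
    using vless_order[where 'v='v] by auto
  from r(1) have "total r" by (simp add: linear_order_on_def)
  with assms show ?thesis unfolding r(2) total_on_def by auto
qed

lemma vless_antisym:
  fixes x y :: 'v assumes "vless x y" shows "\<not> vless y x"
proof -
  obtain r :: "'v rel" where r: "linear_order r" "\<And>x y. vless x y \<longleftrightarrow> x \<noteq> y \<and> (x, y) \<in> r"
    using vless_order[where 'v='v] by auto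
  from r(1) have "antisym r" by (simp add: linear_order_on_def partial_order_on_def)
  with assms show ?thesis unfolding r(2) by (auto dest: antisymD)
qed

lemma vless_trans:
  fixes x y z :: 'v assumes "vless x y" "vless y z" shows "vless x z"
proof -
  obtain r :: "'v rel" where r: "linear_order r" "\<And>x y. vless x y \<longleftrightarrow> x \<noteq> y \<and> (x, y) \<in> r"
    using vless_order[where 'v='v] by auto
  from r(1) have "trans r" by (simp add: linear_order_on_def partial_order_on_def preorder_on_def)
  moreover have "x \<noteq> z" using assms vless_antisym[of x y] by auto
  ultimately show ?thesis using assms unfolding r(2) by (meson transD)
qed

lemma vless_iff: "x \<noteq> y \<Longrightarrow> vless x y \<longleftrightarrow> \<not> vless y x"
  using vless_total[of x y] vless_antisym[of x y] by auto

lemma ex_vless_least: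
  assumes "finite S" "S \<noteq> {}"
  shows "\<exists>m\<in>S. \<forall>x\<in>S - {m}. vless m x"
  using assms
proof (induction S rule: finite_ne_induct)
  case (singleton x) then show ?case by simp
next
  case (insert x F)
  then obtain m where m: "m \<in> F" "\<forall>x\<in>F - {m}. vless m x" by blast
  show ?case
  proof (cases "vless m x")
    case True with m show ?thesis by auto
  next
    case False
    then have "vless x m" using vless_total m insert by metis
    with m show ?thesis by (intro bexI[of _ x]) (auto intro: vless_trans)
  qed
qed

section \<open>Chains on sets of vertices as a real vector space\<close>

type_synonym 'v chn = "'v set \<Rightarrow>\<^sub>0 real"

text \<open>This makes \<open>linear\<close> and \<open>span\<close> available on chains.
  Coefficients are real, like the determinants whose signs they will contain; \<open>of_rat\<close>
  leads back to the rational matrices of the statement.\<close>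

instantiation poly_mapping :: (type, real_vector) real_vector
begin

lift_definition scaleR_poly_mapping :: "real \<Rightarrow> ('a \<Rightarrow>\<^sub>0 'b) \<Rightarrow> 'a \<Rightarrow>\<^sub>0 'b"
  is "\<lambda>r f k. r *\<^sub>R f k"
  by (rule finite_subset[rotated]) auto

instance
  by standard (transfer, simp add: fun_eq_iff algebra_simps)+

end

lemma lookup_scaleR [simp]: "lookup (r *\<^sub>R c) k = r *\<^sub>R lookup c k"
  by transfer simp

definition sx :: "'v set \<Rightarrow> 'v chn" where "sx S = Poly_Mapping.single S 1"

lemma lookup_sx: "lookup (sx S) T = (if S = T then 1 else 0)"
  by (simp add: sx_def lookup_single when_def)

lemma linear_lookup: "linear (\<lambda>c :: 'k \<Rightarrow>\<^sub>0 real. lookup c k)"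
  by (rule linearI) (auto simp: lookup_add)

lemma chn_expand: "finite A \<Longrightarrow> keys c \<subseteq> A \<Longrightarrow> c = (\<Sum>S\<in>A. lookup c S *\<^sub>R sx S)"
proof (rule poly_mapping_eqI)
  fix k assume A: "finite A" "keys c \<subseteq> A"
  have "(\<Sum>S\<in>A. lookup c S * (if S = k then 1 else 0)) = (if k \<in> A then lookup c k else 0)"
    using A by (simp add: if_distrib sum.delta cong: if_cong)
  then show "lookup c k = lookup (\<Sum>S\<in>A. lookup c S *\<^sub>R sx S) k"
    using A by (auto simp: lookup_sum lookup_sx in_keys_iff)
qed

definition lext :: "('v set \<Rightarrow> 'b::real_vector) \<Rightarrow> 'v chn \<Rightarrow> 'b" where
  "lext \<phi> c = (\<Sum>S\<in>keys c. lookup c S *\<^sub>R \<phi> S)"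

lemma lext_superset:
  assumes "finite A" "keys c \<subseteq> A"
  shows "lext \<phi> c = (\<Sum>S\<in>A. lookup c S *\<^sub>R \<phi> S)"
  unfolding lext_def using assms by (intro sum.mono_neutral_left) (auto simp: in_keys_iff)

lemma linear_lext: "linear (lext \<phi>)"
proof (rule linearI)
  fix a b :: "'a chn" and r :: real
  let ?A = "keys a \<union> keys b"
  have "lext \<phi> (a + b) = (\<Sum>S\<in>?A. lookup (a + b) S *\<^sub>R \<phi> S)"
    using Poly_Mapping.keys_add[of a b] by (intro lext_superset) auto
  then show "lext \<phi> (a + b) = lext \<phi> a + lext \<phi> b"
    by (simp add: lookup_add scaleR_add_left sum.distrib lext_superset[of ?A])
  have "lext \<phi> (r *\<^sub>R a) = (\<Sum>S\<in>keys a. lookup (r *\<^sub>R a) S *\<^sub>R \<phi> S)"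
    by (rule lext_superset) (auto simp: in_keys_iff)
  then show "lext \<phi> (r *\<^sub>R a) = r *\<^sub>R lext \<phi> a"
    by (simp add: lext_def scaleR_sum_right)
qed

lemma lext_sx [simp]: "lext \<phi> (sx S) = \<phi> S"
  by (simp add: lext_def sx_def)

text \<open>A complex enters only through this subspace: all complexes on one vertex type share one
  vector space, and maps on chains are total functions whose compatibility with the boundary is
  required on \<open>CS K\<close>.\<close>

definition CS :: "'v set set \<Rightarrow> 'v chn set" where "CS K = span (sx ` K)"

lemma subspace_CS [simp]: "subspace (CS K)" by (simp add: CS_def)
lemma sx_in_CS: "S \<in> K \<Longrightarrow> sx S \<in> CS K" by (simp add: CS_def span_base)
lemma CS_mono: "K \<subseteq> L \<Longrightarrow> CS K \<subseteq> CS L" unfolding CS_def by (rule span_mono) blast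
lemma CS_0 [simp]: "0 \<in> CS K" by (simp add: CS_def span_zero)
lemma CS_add: "a \<in> CS K \<Longrightarrow> b \<in> CS K \<Longrightarrow> a + b \<in> CS K" by (simp add: CS_def span_add)
lemma CS_diff: "a \<in> CS K \<Longrightarrow> b \<in> CS K \<Longrightarrow> a - b \<in> CS K" by (simp add: CS_def span_diff)
lemma CS_neg: "a \<in> CS K \<Longrightarrow> - a \<in> CS K" by (simp add: CS_def span_neg)
lemma CS_scale: "a \<in> CS K \<Longrightarrow> r *\<^sub>R a \<in> CS K" by (simp add: CS_def span_scale)
lemma CS_sum: "(\<And>i. i \<in> I \<Longrightarrow> f i \<in> CS K) \<Longrightarrow> sum f I \<in> CS K" by (simp add: CS_def span_sum)
lemmas CS_intros = sx_in_CS CS_0 CS_add CS_diff CS_neg CS_scale CS_sum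

lemma CS_iff: "c \<in> CS K \<longleftrightarrow> keys c \<subseteq> K"
proof
  let ?V = "{c :: 'a chn. \<forall>S. S \<notin> K \<longrightarrow> lookup c S = 0}"
  assume "c \<in> CS K"
  moreover have "subspace ?V" by (auto simp: subspace_def lookup_add)
  then have "span (sx ` K) \<subseteq> ?V" by (intro span_minimal) (auto simp: lookup_sx)
  ultimately have "c \<in> ?V" unfolding CS_def by (rule rev_subsetD)
  then show "keys c \<subseteq> K" by (auto simp: in_keys_iff)
next
  assume "keys c \<subseteq> K"
  then have "(\<Sum>S\<in>keys c. lookup c S *\<^sub>R sx S) \<in> CS K" by (intro CS_sum CS_scale sx_in_CS) auto
  then show "c \<in> CS K" using chn_expand[of "keys c" c] by simp
qed

lemma CS_lookup: "c \<in> CS K \<Longrightarrow> S \<notin> K \<Longrightarrow> lookup c S = 0"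
  unfolding CS_iff by (auto simp: in_keys_iff)

lemma CS_image:
  assumes "linear f" "\<And>S. S \<in> K \<Longrightarrow> f (sx S) \<in> V" "subspace V" "c \<in> CS K"
  shows "f c \<in> V"
proof -
  have "f ` span (sx ` K) = span (f ` sx ` K)"
    using assms(1) by (simp add: linear_span_image)
  also have "\<dots> \<subseteq> V" using assms by (intro span_minimal) auto
  finally show ?thesis using assms unfolding CS_def by auto
qed

lemma CS_eq:
  assumes "linear f" "linear g" "\<And>S. S \<in> K \<Longrightarrow> f (sx S) = g (sx S)" "c \<in> CS K"
  shows "f c = g c"
  by (rule linear_eq_on_span[OF assms(1,2), of "sx ` K"]) (use assms in \<open>auto simp: CS_def\<close>)

lemma CS_UNIV [simp]: "CS UNIV = UNIV"
  using CS_iff by auto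

text \<open>For an infinite set the sum defining \<open>bd\<close> is 0 by default, while
  \<open>wdg\<close> can still be nonzero. Hence \<open>bd_wdg\<close> fails there, and the exterior
  algebra is the span of the finite sets.\<close>

abbreviation FC :: "'v chn set" where "FC \<equiv> CS {S. finite S}"

section \<open>Signs, exterior multiplication and contraction\<close>

definition sg :: "'v \<Rightarrow> 'v set \<Rightarrow> real" where
  "sg v S = (- 1) ^ card {u \<in> S. vless u v}"

lemma sg_cases: "sg v S = 1 \<or> sg v S = - 1"
  unfolding sg_def by (metis neg_one_even_power neg_one_odd_power)

lemma sg_sq [simp]: "sg v S * sg v S = 1"
  using sg_cases[of v S] by auto

text \<open>The vertex \<open>v\<close> need not lie in the set: \<open>sg\<close> is the sign of
  moving \<open>v\<close> past the smaller elements, both for inserting and for deleting it.\<close>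

lemma sg_insert: "finite S \<Longrightarrow> w \<notin> S \<Longrightarrow> sg v (insert w S) = (if vless w v then - sg v S else sg v S)"
proof -
  assume *: "finite S" "w \<notin> S"
  have "{u \<in> insert w S. vless u v} = (if vless w v then insert w {u \<in> S. vless u v} else {u \<in> S. vless u v})"
    by auto
  then show ?thesis using * by (simp add: sg_def)
qed

lemma sg_remove_self: "sg v (S - {v}) = sg v S"
  unfolding sg_def by (rule arg_cong[of _ _ "\<lambda>A. (-1) ^ card A"]) auto

lemma sg_remove: "finite S \<Longrightarrow> w \<in> S \<Longrightarrow> sg v (S - {w}) = (if vless w v then - sg v S else sg v S)"
  using sg_insert[of "S - {w}" w v] by (auto simp: insert_absorb)

lemma sg_empty [simp]: "sg v {} = 1" by (simp add: sg_def)

text \<open>The chains on finite sets form the exterior algebra on the vertices, augmented by the empty set in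
  degree \<open>0\<close>: \<open>wdg v\<close> is left multiplication by \<open>v\<close>, and \<open>bd\<close> is contraction with the functional that
  is \<open>1\<close> on every vertex.  All signs are thus governed by \<open>wdg_anticommute\<close> and \<open>bd_wdg\<close>.\<close>

definition wdg :: "'v \<Rightarrow> 'v chn \<Rightarrow> 'v chn" where
  "wdg v = lext (\<lambda>S. if v \<in> S then 0 else sg v S *\<^sub>R sx (insert v S))"

definition bd :: "'v chn \<Rightarrow> 'v chn" where
  "bd = lext (\<lambda>S. \<Sum>v\<in>S. sg v S *\<^sub>R sx (S - {v}))"

lemma linear_wdg [simp]: "linear (wdg v)" by (simp add: wdg_def linear_lext)
lemma linear_bd [simp]: "linear bd" by (simp add: bd_def linear_lext)

lemmas wdg_lin [simp] = linear_add[OF linear_wdg] linear_scale[OF linear_wdg] linear_sum[OF linear_wdg]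
  linear_0[OF linear_wdg] linear_diff[OF linear_wdg] linear_neg[OF linear_wdg]
lemmas bd_lin [simp] = linear_add[OF linear_bd] linear_scale[OF linear_bd] linear_sum[OF linear_bd]
  linear_0[OF linear_bd] linear_diff[OF linear_bd] linear_neg[OF linear_bd]

lemma linear_comp: "linear f \<Longrightarrow> linear g \<Longrightarrow> linear (\<lambda>x. f (g x))"
  using linear_compose[of g f] by (simp add: o_def)

lemmas lin_intros = linear_compose_add linear_compose_sub linear_compose_neg linear_compose_scale_right
  linear_ident linear_zero linear_lext linear_wdg linear_comp[OF linear_wdg] linear_bd linear_comp[OF linear_bd]

lemma wdg_sx: "wdg v (sx S) = (if v \<in> S then 0 else sg v S *\<^sub>R sx (insert v S))"
  by (simp add: wdg_def)

lemma bd_sx: "bd (sx S) = (\<Sum>v\<in>S. sg v S *\<^sub>R sx (S - {v}))"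
  by (simp add: bd_def)

lemma bd_sx_empty [simp]: "bd (sx {}) = 0" by (simp add: bd_sx)

lemma wdg_FC: "c \<in> FC \<Longrightarrow> wdg v c \<in> FC"
  by (rule CS_image[of "wdg v"]) (auto simp: wdg_sx intro!: CS_intros)

lemma bd_FC: "c \<in> FC \<Longrightarrow> bd c \<in> FC"
  by (rule CS_image[of bd]) (auto simp: bd_sx intro!: CS_intros)

lemma wdg_wdg [simp]: "wdg v (wdg v c) = 0"
proof (rule CS_eq[of "\<lambda>c. wdg v (wdg v c)" "\<lambda>c. 0" UNIV])
  show "linear (\<lambda>c. wdg v (wdg v c))" by (intro lin_intros)
qed (auto simp: wdg_sx linear_zero)

lemma lookup_wdg:
  "lookup (wdg s c) U = (if s \<in> U then sg s U * lookup c (U - {s}) else 0)"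
proof (rule CS_eq[of "\<lambda>c. lookup (wdg s c) U" _ UNIV])
  show "linear (\<lambda>c. lookup (wdg s c) U)" by (rule linear_comp[OF linear_lookup linear_wdg])
  show "linear (\<lambda>c. if s \<in> U then sg s U * lookup c (U - {s}) else 0)"
    using linear_compose_scale_right[OF linear_lookup[of "U - {s}"], of "sg s U"]
    by (cases "s \<in> U") (simp_all add: linear_zero)
  fix T :: "'a set"
  show "lookup (wdg s (sx T)) U = (if s \<in> U then sg s U * lookup (sx T) (U - {s}) else 0)"
  proof (cases "s \<in> T")
    case True then show ?thesis by (auto simp: wdg_sx lookup_sx)
  next
    case False
    then have "insert s T = U \<longleftrightarrow> s \<in> U \<and> T = U - {s}" by auto
    moreover have "sg s T = sg s U" if "s \<in> U" "T = U - {s}" using that by (simp add: sg_remove_self)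
    ultimately show ?thesis using False by (auto simp: wdg_sx lookup_sx)
  qed
qed simp

lemma wdg_anticommute:
  assumes "c \<in> FC"
  shows "wdg v (wdg w c) = - wdg w (wdg v c)"
proof (cases "v = w")
  case False
  show ?thesis
  proof (rule CS_eq[OF _ _ _ assms])
    show "linear (\<lambda>c. wdg v (wdg w c))" "linear (\<lambda>c. - wdg w (wdg v c))" by (intro lin_intros)+
    fix S :: "'a set" assume "S \<in> {S. finite S}"
    then show "wdg v (wdg w (sx S)) = - wdg w (wdg v (sx S))"
      using False vless_iff[OF False] by (auto simp: wdg_sx sg_insert insert_commute)
  qed
qed simp

lemma bd_wdg:
  assumes "c \<in> FC"
  shows "bd (wdg v c) = c - wdg v (bd c)"
proof (rule CS_eq[OF _ _ _ assms])
  show "linear (\<lambda>c. bd (wdg v c))" "linear (\<lambda>c. c - wdg v (bd c))" by (intro lin_intros)+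
  fix S :: "'a set" assume "S \<in> {S. finite S}"
  then have S: "finite S" by simp
  show "bd (wdg v (sx S)) = sx S - wdg v (bd (sx S))"
  proof (cases "v \<in> S")
    case True
    \<comment> \<open>After deleting \<open>u\<close>, the vertex \<open>v\<close> can be multiplied
      back only if \<open>u = v\<close>.\<close>
    have "wdg v (bd (sx S)) = (\<Sum>u\<in>S. if u = v then sx S else 0)"
      unfolding bd_sx wdg_lin
    proof (rule sum.cong)
      fix u assume "u \<in> S"
      show "sg u S *\<^sub>R wdg v (sx (S - {u})) = (if u = v then sx S else 0)"
        using True by (auto simp: wdg_sx sg_remove_self insert_absorb)
    qed simp
    also have "\<dots> = sx S" using True S by simp
    finally show ?thesis using True by (simp add: wdg_sx)
  next
    case False
    \<comment> \<open>Inserting \<open>v\<close> and deleting \<open>u\<close> commute as operations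
      on sets; the signs differ by the transposition of \<open>u\<close> and
      \<open>v\<close>.\<close>
    have "(\<Sum>u\<in>S. (sg v S * sg u (insert v S)) *\<^sub>R sx (insert v S - {u}))
        = - (\<Sum>u\<in>S. sg u S *\<^sub>R wdg v (sx (S - {u})))"
      unfolding sum_negf[symmetric]
    proof (rule sum.cong)
      fix u assume u: "u \<in> S"
      then have uv: "u \<noteq> v" using False by auto
      have "insert v S - {u} = insert v (S - {u})" using uv by auto
      then show "(sg v S * sg u (insert v S)) *\<^sub>R sx (insert v S - {u}) = - (sg u S *\<^sub>R wdg v (sx (S - {u})))"
        using u uv False S vless_iff[OF uv] by (simp add: wdg_sx sg_insert sg_remove)
    qed simp
    moreover have "sg v (insert v S) = sg v S" using S False by (simp add: sg_insert)
    ultimately show ?thesis using False S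
      by (simp add: wdg_sx bd_sx scaleR_sum_right scaleR_add_right)
  qed
qed

text \<open>The oriented simplex on a list of vertices, as the exterior product of the list: it
  changes sign under transpositions and vanishes on repetitions.\<close>

primrec wl :: "'v list \<Rightarrow> 'v chn" where
  "wl [] = sx {}"
| "wl (v # vs) = wdg v (wl vs)"

lemma wl_FC [simp]: "wl vs \<in> FC"
  by (induction vs) (auto intro: wdg_FC sx_in_CS)

lemma wl_mem: "wl vs \<in> CS {set vs}"
proof (induction vs)
  case Nil show ?case by (simp add: sx_in_CS)
next
  case (Cons v vs)
  then show ?case unfolding wl.simps
    by (rule CS_image[rotated 3]) (auto simp: wdg_sx intro!: CS_intros)
qed

lemma wl_not_distinct: "\<not> distinct vs \<Longrightarrow> wl vs = 0"
proof (induction vs)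
  case (Cons v vs)
  have "wdg v (wl vs) \<in> {0}" if "v \<in> set vs"
    by (rule CS_image[OF _ _ _ wl_mem[of vs]]) (use that in \<open>auto simp: wdg_sx\<close>)
  with Cons show ?case by auto
qed simp

lemma wl_distinct: "distinct vs \<Longrightarrow> \<exists>r. (r = 1 \<or> r = - 1) \<and> wl vs = r *\<^sub>R sx (set vs)"
proof (induction vs)
  case Nil show ?case by (auto intro: exI[of _ 1])
next
  case (Cons v vs)
  then obtain r where "r = 1 \<or> r = - 1" "wl vs = r *\<^sub>R sx (set vs)" by (metis distinct.simps(2))
  then have "wl (v # vs) = (r * sg v (set vs)) *\<^sub>R sx (set (v # vs))"
    using Cons.prems by (simp add: wdg_sx)
  moreover have "r * sg v (set vs) = 1 \<or> r * sg v (set vs) = - 1"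
    using \<open>r = 1 \<or> r = - 1\<close> sg_cases[of v "set vs"] by (elim disjE) simp_all
  ultimately show ?case by metis
qed

definition srt :: "'v set \<Rightarrow> 'v list" where
  "srt S = (SOME vs. sorted_wrt vless vs \<and> set vs = S)"

lemma sorted_vless_distinct: "sorted_wrt vless vs \<Longrightarrow> distinct vs"
  by (induction vs) auto

lemma sorted_vless_unique:
  "sorted_wrt vless vs \<Longrightarrow> sorted_wrt vless ws \<Longrightarrow> set vs = set ws \<Longrightarrow> vs = ws"
proof (induction vs arbitrary: ws)
  case (Cons v vs)
  then obtain w ws' where ws: "ws = w # ws'" by (cases ws) auto
  have "v = w"
  proof (rule ccontr)
    assume "v \<noteq> w"
    then have "v \<in> set ws'" "w \<in> set vs" using Cons.prems ws by auto
    then have "vless v w" "vless w v" using Cons.prems ws by auto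
    then show False using vless_antisym[of v w] by simp
  qed
  moreover have "v \<notin> set vs" "w \<notin> set ws'" using Cons.prems ws by auto
  ultimately show ?case using Cons ws by (metis insert_ident list.simps(15) sorted_wrt.simps(2))
qed simp

lemma ex_srt: "finite S \<Longrightarrow> \<exists>vs. sorted_wrt vless vs \<and> set vs = S"
proof (induction "card S" arbitrary: S)
  case 0 then show ?case by simp
next
  case (Suc n)
  then obtain m where m: "m \<in> S" "\<forall>x\<in>S - {m}. vless m x"
    using ex_vless_least[of S] by force
  then obtain vs where "sorted_wrt vless vs" "set vs = S - {m}"
    using Suc.hyps(1)[of "S - {m}"] Suc.hyps(2) Suc.prems by fastforce
  with m show ?case by (intro exI[of _ "m # vs"]) auto
qed

lemma srt: assumes "finite S"
  shows sorted_srt: "sorted_wrt vless (srt S)" and set_srt [simp]: "set (srt S) = S"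
    and distinct_srt: "distinct (srt S)" and length_srt: "length (srt S) = card S"
proof -
  show 1: "sorted_wrt vless (srt S)" and 2: "set (srt S) = S"
    using someI_ex[OF ex_srt[OF assms]] unfolding srt_def by auto
  show 3: "distinct (srt S)" using sorted_vless_distinct[OF 1] .
  show "length (srt S) = card S" using distinct_card[OF 3] 2 by simp
qed

lemma srt_eqI: "sorted_wrt vless vs \<Longrightarrow> set vs = S \<Longrightarrow> srt S = vs"
  using srt[of S] sorted_vless_unique[of "srt S" vs] by auto

lemma srt_empty [simp]: "srt {} = []" by (rule srt_eqI) auto

lemma srt_least: "finite S \<Longrightarrow> m \<in> S \<Longrightarrow> \<forall>x\<in>S - {m}. vless m x \<Longrightarrow> srt S = m # srt (S - {m})"
  by (rule srt_eqI) (auto simp: srt)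

lemma sg_least:
  assumes "\<forall>x\<in>S. vless m x" shows "sg m S = 1"
proof -
  have "{u \<in> S. vless u m} = {}" using assms vless_antisym[of m] by auto
  then have "card {u \<in> S. vless u m} = 0" by (simp only: card.empty)
  then show ?thesis unfolding sg_def by (simp only: power_0)
qed

text \<open>A new least element stands in front of \<open>srt\<close> and has sign 1, so the
  induction step involves no signs.\<close>

lemma finite_least_induct [consumes 1, case_names empty insert]:
  assumes "finite S" "P {}"
    and step: "\<And>m S. finite S \<Longrightarrow> m \<notin> S \<Longrightarrow> \<forall>x\<in>S. vless m x \<Longrightarrow> P S \<Longrightarrow> P (insert m S)"
  shows "P S"
  using assms(1)
proof (induction "card S" arbitrary: S)
  case 0 then show ?case using assms by simp
next
  case (Suc n)
  then obtain m where m: "m \<in> S" "\<forall>x\<in>S - {m}. vless m x"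
    using ex_vless_least[of S] by force
  then have "P (S - {m})" using Suc by auto
  from step[OF _ _ m(2) this] m(1) Suc show ?case by (simp add: insert_absorb)
qed

lemma wl_srt: "finite S \<Longrightarrow> wl (srt S) = sx S"
proof (induction rule: finite_least_induct)
  case (insert m S)
  then have "srt (insert m S) = m # srt S" by (subst srt_least[of _ m]) auto
  with insert show ?case by (simp add: wdg_sx sg_least)
qed simp

lemma sx_eq_wl: "finite S \<Longrightarrow> \<exists>vs. sx S = wl vs \<and> set vs = S"
  using wl_srt srt by metis

text \<open>The exterior algebra is generated from its unit by left multiplications, so linear maps
  can be compared on the unit and along \<open>wdg\<close>.\<close>

lemma FC_induct [consumes 1, case_names lin empty wdg]:
  assumes "c \<in> FC" "linear f" "linear g" "f (sx {}) = g (sx {})"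
    and "\<And>v c. c \<in> FC \<Longrightarrow> f c = g c \<Longrightarrow> f (wdg v c) = g (wdg v c)"
  shows "f c = g c"
proof (rule CS_eq[OF assms(2,3) _ assms(1)])
  fix S :: "'a set" assume "S \<in> {S. finite S}"
  then obtain vs where vs: "sx S = wl vs" using sx_eq_wl by auto
  have "f (wl vs) = g (wl vs)" by (induction vs) (auto intro: assms)
  then show "f (sx S) = g (sx S)" using vs by simp
qed

lemma bd_bd: "c \<in> FC \<Longrightarrow> bd (bd c) = 0"
  by (rule FC_induct[of c "\<lambda>c. bd (bd c)" "\<lambda>c. 0"])
     (auto intro!: lin_intros simp: bd_wdg bd_FC)

text \<open>The universal property of the exterior algebra: anticommuting operators
  \<open>W v\<close> extend to an action, and a chain is sent to the result of its action on
  \<open>b\<close>. Both \<open>push\<close> and \<open>lam\<close> are of this form.\<close>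

definition aext :: "('v \<Rightarrow> 'b \<Rightarrow> 'b) \<Rightarrow> 'b \<Rightarrow> 'v chn \<Rightarrow> 'b::real_vector" where
  "aext W b = lext (\<lambda>S. foldr W (srt S) b)"

lemma linear_aext: "linear (aext W b)" by (simp add: aext_def linear_lext)

lemma aext_sx: "aext W b (sx S) = foldr W (srt S) b" by (simp add: aext_def)

lemma aext_least: "finite S \<Longrightarrow> \<forall>x\<in>S. vless m x \<Longrightarrow> aext W b (sx (insert m S)) = W m (aext W b (sx S))"
proof -
  assume *: "finite S" "\<forall>x\<in>S. vless m x"
  then have "m \<notin> S" by auto
  with * have "srt (insert m S) = m # srt S" by (subst srt_least[of _ m]) auto
  then show ?thesis by (simp add: aext_sx)
qed

lemma eq_neg_self: "(a :: 'b::real_vector) = - a \<Longrightarrow> a = 0"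
proof -
  assume "a = - a"
  then have "a + a = 0" by (metis add.left_inverse)
  then have "2 *\<^sub>R a = 0" by (simp add: scaleR_2)
  then show ?thesis by simp
qed

text \<open>The operators in question anticommute only on chains of finite sets; hence the invariant
  set \<open>U\<close>, to which every \<open>aext W b (sx S)\<close> belongs. The induction moves
  \<open>W v\<close> inwards past the operator of the least element, which is the outermost
  one.\<close>

lemma aext_wdg_sx:
  fixes W :: "'v \<Rightarrow> 'b \<Rightarrow> 'b::real_vector"
  assumes lin: "\<And>v. linear (W v)" and b: "b \<in> U" and U: "\<And>v c. c \<in> U \<Longrightarrow> W v c \<in> U"
    and anti: "\<And>v w c. c \<in> U \<Longrightarrow> W v (W w c) = - W w (W v c)"
  shows "finite S \<Longrightarrow> aext W b (wdg v (sx S)) = W v (aext W b (sx S))"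
proof (induction rule: finite_least_induct)
  case empty
  have "aext W b (sx {v}) = W v (aext W b (sx {}))" by (rule aext_least) auto
  then show ?case by (simp add: wdg_sx)
next
  case (insert m S)
  have "foldr W vs b \<in> U" for vs by (induction vs) (auto simp: b U)
  then have pU: "aext W b (sx S) \<in> U" by (simp add: aext_sx)
  note al = linear_scale[OF linear_aext] linear_0[OF linear_aext] linear_neg[OF linear_aext] linear_scale[OF lin] linear_0[OF lin]
  have 1: "W v (aext W b (sx (insert m S))) = - W m (aext W b (wdg v (sx S)))"
    unfolding aext_least[OF insert.hyps(1,3)] insert.IH by (rule anti[OF pU])
  show ?case
  proof (cases "v \<in> insert m S")
    case True
    show ?thesis
    proof (cases "v = m")
      case True
      have "W m (W m (aext W b (sx S))) = 0" by (rule eq_neg_self, rule anti[OF pU])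
      with True insert.hyps show ?thesis by (simp add: wdg_sx aext_least al)
    next
      case False then have "v \<in> S" using True by auto
      then show ?thesis unfolding 1 by (simp add: wdg_sx al)
    qed
  next
    case False
    show ?thesis
    proof (cases "vless m v")
      case True
      have "aext W b (sx (insert m (insert v S))) = W m (aext W b (sx (insert v S)))"
        using insert.hyps True by (intro aext_least) auto
      then show ?thesis unfolding 1
        using insert.hyps False True by (simp add: wdg_sx sg_insert insert_commute al)
    next
      case vm: False
      then have "vless v m" using False vless_total[of v m] by auto
      then have lv: "\<forall>x\<in>insert m S. vless v x" using insert vless_trans[of v m] by auto
      show ?thesis using False insert.hyps by (simp add: wdg_sx sg_least[OF lv] aext_least lv)
    qed
  qed
qed

lemma aext_wdg:
  fixes W :: "'v \<Rightarrow> 'b \<Rightarrow> 'b::real_vector"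
  assumes "\<And>v. linear (W v)" "b \<in> U" "\<And>v c. c \<in> U \<Longrightarrow> W v c \<in> U"
    and "\<And>v w c. c \<in> U \<Longrightarrow> W v (W w c) = - W w (W v c)" "c \<in> FC"
  shows "aext W b (wdg v c) = W v (aext W b c)"
  by (rule CS_eq[OF linear_comp[OF linear_aext linear_wdg] linear_comp[OF assms(1) linear_aext] _ assms(5)])
     (use aext_wdg_sx[OF assms(1-4)] in auto)

text \<open>As a homomorphism of exterior algebras it kills the simplices on which \<open>f\<close>
  is not injective, because squares of vertices vanish.\<close>

definition push :: "('v \<Rightarrow> 'w) \<Rightarrow> 'v chn \<Rightarrow> 'w chn" where
  "push f = aext (\<lambda>v. wdg (f v)) (sx {})"

lemma linear_push [simp]: "linear (push f)" by (simp add: push_def linear_aext)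

lemmas push_lin [simp] = linear_add[OF linear_push] linear_scale[OF linear_push] linear_sum[OF linear_push]
  linear_0[OF linear_push] linear_diff[OF linear_push] linear_neg[OF linear_push]

lemmas push_intros = lin_intros linear_push linear_comp[OF linear_push]

lemma push_sx: "push f (sx S) = wl (map f (srt S))"
proof -
  have "foldr (\<lambda>v. wdg (f v)) vs (sx {}) = wl (map f vs)" for vs by (induction vs) auto
  then show ?thesis by (simp add: push_def aext_sx)
qed

lemma push_sx_empty [simp]: "push f (sx {}) = sx {}" by (simp add: push_sx)

lemma push_sx_mem: "finite S \<Longrightarrow> push f (sx S) \<in> CS {f ` S}"
  using wl_mem[of "map f (srt S)"] by (simp add: push_sx)

lemma push_FC: "c \<in> FC \<Longrightarrow> push f c \<in> FC"
  by (rule CS_image[of "push f"]) (auto simp: push_sx)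

lemma push_wdg: "c \<in> FC \<Longrightarrow> push f (wdg v c) = wdg (f v) (push f c)"
  unfolding push_def
  by (rule aext_wdg[where U = FC]) (auto intro: wdg_FC wdg_anticommute sx_in_CS)

lemma push_wl: "push f (wl vs) = wl (map f vs)"
  by (induction vs) (auto simp: push_wdg)

lemma push_bd: "c \<in> FC \<Longrightarrow> bd (push f c) = push f (bd c)"
  by (rule FC_induct[of c "\<lambda>c. bd (push f c)" "\<lambda>c. push f (bd c)"])
     (auto intro!: push_intros simp: push_wdg bd_wdg push_FC bd_FC)

lemma push_push: "c \<in> FC \<Longrightarrow> push g (push f c) = push (\<lambda>x. g (f x)) c"
  by (rule FC_induct[of c "\<lambda>c. push g (push f c)" "\<lambda>c. push (\<lambda>x. g (f x)) c"])
     (auto intro!: push_intros simp: push_wdg push_FC)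

section \<open>Chain maps, chain homotopies and supertraces\<close>

definition set_complex :: "'v set set \<Rightarrow> bool" where
  "set_complex K \<longleftrightarrow> finite K \<and> {} \<in> K \<and> (\<forall>S\<in>K. finite S) \<and> (\<forall>S\<in>K. \<forall>T\<subseteq>S. T \<in> K)"

lemma set_complexD:
  assumes "set_complex K"
  shows "finite K" "{} \<in> K" "S \<in> K \<Longrightarrow> finite S" "S \<in> K \<Longrightarrow> T \<subseteq> S \<Longrightarrow> T \<in> K"
  using assms unfolding set_complex_def by auto

lemma set_complex_FC: "set_complex K \<Longrightarrow> c \<in> CS K \<Longrightarrow> c \<in> FC"
  using CS_mono[of K "{S. finite S}"] by (auto simp: set_complex_def)

lemma set_complex_bd: assumes "set_complex K" "c \<in> CS K" shows "bd c \<in> CS K"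
proof (rule CS_image[OF linear_bd _ subspace_CS assms(2)])
  fix S assume "S \<in> K"
  then have "S - {v} \<in> K" for v using set_complexD(4)[OF assms(1), of S "S - {v}"] by auto
  then show "bd (sx S) \<in> CS K" unfolding bd_sx by (intro CS_sum CS_scale sx_in_CS)
qed

lemma set_complex_Pow: "finite V \<Longrightarrow> set_complex (Pow V)"
  by (auto simp: set_complex_def intro: finite_subset)

text \<open>Degrees are not recorded here: homotopies only use that the map commutes with
  \<open>bd\<close>, and \<open>graded\<close> supplies the degree where a sign depends on
  it.\<close>

definition chain_map :: "'v set set \<Rightarrow> 'w set set \<Rightarrow> ('v chn \<Rightarrow> 'w chn) \<Rightarrow> bool" where
  "chain_map K L \<phi> \<longleftrightarrow> linear \<phi> \<and> (\<forall>c\<in>CS K. \<phi> c \<in> CS L \<and> bd (\<phi> c) = \<phi> (bd c))"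

lemma chain_mapD: assumes "chain_map K L \<phi>"
  shows "linear \<phi>" "c \<in> CS K \<Longrightarrow> \<phi> c \<in> CS L" "c \<in> CS K \<Longrightarrow> bd (\<phi> c) = \<phi> (bd c)"
  using assms unfolding chain_map_def by auto

lemma chain_mapI:
  assumes "linear \<phi>" "\<And>S. S \<in> K \<Longrightarrow> \<phi> (sx S) \<in> CS L" "\<And>S. S \<in> K \<Longrightarrow> bd (\<phi> (sx S)) = \<phi> (bd (sx S))"
  shows "chain_map K L \<phi>"
  unfolding chain_map_def
proof (intro conjI ballI)
  fix c assume c: "c \<in> CS K"
  show "\<phi> c \<in> CS L" by (rule CS_image[OF _ _ _ c]) (use assms in auto)
  show "bd (\<phi> c) = \<phi> (bd c)"
    by (rule CS_eq[OF _ _ _ c]) (use assms in \<open>auto intro!: lin_intros linear_comp[OF assms(1)]\<close>)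
qed (rule assms(1))

lemma chain_map_comp:
  assumes "chain_map K L \<phi>" "chain_map L M \<psi>" shows "chain_map K M (\<lambda>c. \<psi> (\<phi> c))"
  using assms linear_comp[of \<psi> \<phi>] unfolding chain_map_def by auto

lemma chain_map_push:
  assumes "set_complex K" "\<And>S. S \<in> K \<Longrightarrow> f ` S \<in> L"
  shows "chain_map K L (push f)"
proof (rule chain_mapI)
  fix S assume S: "S \<in> K"
  then have "finite S" using assms set_complexD by auto
  then show "push f (sx S) \<in> CS L"
    using push_sx_mem[of S f] CS_mono[of "{f ` S}" L] assms(2)[OF S] by auto
  show "bd (push f (sx S)) = push f (bd (sx S))"
    by (rule push_bd) (use \<open>finite S\<close> in \<open>simp add: sx_in_CS\<close>)
qed simp

definition chain_homotopic :: "'v set set \<Rightarrow> 'w set set \<Rightarrow> ('v chn \<Rightarrow> 'w chn) \<Rightarrow> ('v chn \<Rightarrow> 'w chn) \<Rightarrow> bool" where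
  "chain_homotopic K L \<phi> \<psi> \<longleftrightarrow>
     (\<exists>H. linear H \<and> (\<forall>c\<in>CS K. H c \<in> CS L \<and> bd (H c) + H (bd c) = \<phi> c - \<psi> c))"

lemma homotopic_eq: "(\<And>c. c \<in> CS K \<Longrightarrow> \<phi> c = \<psi> c) \<Longrightarrow> chain_homotopic K L \<phi> \<psi>"
  unfolding chain_homotopic_def by (intro exI[of _ "\<lambda>_. 0"]) (auto simp: linear_zero)

lemma homotopic_sym: "chain_homotopic K L \<phi> \<psi> \<Longrightarrow> chain_homotopic K L \<psi> \<phi>"
proof -
  assume "chain_homotopic K L \<phi> \<psi>"
  then obtain H where H: "linear H" "\<And>c. c \<in> CS K \<Longrightarrow> H c \<in> CS L \<and> bd (H c) + H (bd c) = \<phi> c - \<psi> c"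
    unfolding chain_homotopic_def by metis
  show ?thesis unfolding chain_homotopic_def
  proof (intro exI[of _ "\<lambda>c. - H c"] conjI ballI)
    fix c assume "c \<in> CS K"
    from H(2)[OF this] show "- H c \<in> CS L" and "bd (- H c) + - H (bd c) = \<psi> c - \<phi> c"
      by (auto intro: CS_neg simp: algebra_simps)
  qed (intro linear_compose_neg H(1))
qed

lemma homotopic_trans: "chain_homotopic K L \<phi> \<psi> \<Longrightarrow> chain_homotopic K L \<psi> \<theta> \<Longrightarrow> chain_homotopic K L \<phi> \<theta>"
proof -
  assume "chain_homotopic K L \<phi> \<psi>" "chain_homotopic K L \<psi> \<theta>"
  then obtain H G where H: "linear H" "\<And>c. c \<in> CS K \<Longrightarrow> H c \<in> CS L \<and> bd (H c) + H (bd c) = \<phi> c - \<psi> c"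
    and G: "linear G" "\<And>c. c \<in> CS K \<Longrightarrow> G c \<in> CS L \<and> bd (G c) + G (bd c) = \<psi> c - \<theta> c"
    unfolding chain_homotopic_def by metis
  show ?thesis unfolding chain_homotopic_def
  proof (intro exI[of _ "\<lambda>c. H c + G c"] conjI ballI)
    fix c assume c: "c \<in> CS K"
    from H(2)[OF c] G(2)[OF c] show "H c + G c \<in> CS L" by (auto intro: CS_add)
    have "bd (H c + G c) + (H (bd c) + G (bd c)) = (bd (H c) + H (bd c)) + (bd (G c) + G (bd c))"
      by simp
    also have "\<dots> = \<phi> c - \<theta> c" using H(2)[OF c] G(2)[OF c] by simp
    finally show "bd (H c + G c) + (H (bd c) + G (bd c)) = \<phi> c - \<theta> c" .
  qed (intro linear_compose_add H(1) G(1))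
qed

lemma homotopic_post:
  assumes "chain_homotopic K L \<phi> \<psi>" "chain_map L M \<theta>"
  shows "chain_homotopic K M (\<lambda>c. \<theta> (\<phi> c)) (\<lambda>c. \<theta> (\<psi> c))"
proof -
  obtain H where H: "linear H" "\<And>c. c \<in> CS K \<Longrightarrow> H c \<in> CS L \<and> bd (H c) + H (bd c) = \<phi> c - \<psi> c"
    using assms(1) unfolding chain_homotopic_def by metis
  note \<theta> = chain_mapD[OF assms(2)]
  show ?thesis unfolding chain_homotopic_def
  proof (intro exI[of _ "\<lambda>c. \<theta> (H c)"] conjI ballI)
    fix c assume c: "c \<in> CS K"
    show "\<theta> (H c) \<in> CS M" using H(2)[OF c] \<theta>(2) by auto
    have "\<theta> (bd (H c)) + \<theta> (H (bd c)) = \<theta> (\<phi> c - \<psi> c)"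
      using H(2)[OF c] linear_add[OF \<theta>(1), of "bd (H c)" "H (bd c)"] by simp
    then have "bd (\<theta> (H c)) + \<theta> (H (bd c)) = \<theta> (\<phi> c - \<psi> c)"
      using H(2)[OF c] \<theta>(3) by simp
    then show "bd (\<theta> (H c)) + \<theta> (H (bd c)) = \<theta> (\<phi> c) - \<theta> (\<psi> c)"
      by (simp only: linear_diff[OF \<theta>(1)])
  qed (rule linear_comp[OF \<theta>(1) H(1)])
qed

lemma homotopic_pre:
  assumes "chain_map K L \<theta>" "chain_homotopic L M \<phi> \<psi>"
  shows "chain_homotopic K M (\<lambda>c. \<phi> (\<theta> c)) (\<lambda>c. \<psi> (\<theta> c))"
proof -
  obtain H where H: "linear H" "\<And>c. c \<in> CS L \<Longrightarrow> H c \<in> CS M \<and> bd (H c) + H (bd c) = \<phi> c - \<psi> c"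
    using assms(2) unfolding chain_homotopic_def by metis
  note \<theta> = chain_mapD[OF assms(1)]
  show ?thesis unfolding chain_homotopic_def
  proof (intro exI[of _ "\<lambda>c. H (\<theta> c)"] conjI ballI)
    fix c assume c: "c \<in> CS K"
    show "H (\<theta> c) \<in> CS M" using H(2)[OF \<theta>(2)[OF c]] by auto
    show "bd (H (\<theta> c)) + H (\<theta> (bd c)) = \<phi> (\<theta> c) - \<psi> (\<theta> c)"
      using H(2)[OF \<theta>(2)[OF c]] \<theta>(3)[OF c] by simp
  qed (rule linear_comp[OF H(1) \<theta>(1)])
qed

text \<open>Exactness of the augmented complex. In particular \<open>{{}}\<close> is not acyclic:
  the cycle \<open>sx {}\<close> bounds nothing in it.\<close>

definition acyclic_complex :: "'v set set \<Rightarrow> bool" where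
  "acyclic_complex K \<longleftrightarrow> (\<forall>z\<in>CS K. bd z = 0 \<longrightarrow> (\<exists>y\<in>CS K. bd y = z))"

text \<open>The full simplex is a cone: by \<open>bd_wdg\<close>, multiplication by one of its
  vertices is a contracting homotopy and fills every cycle.\<close>

lemma acyclic_Pow:
  assumes "finite V" "V \<noteq> {}" shows "acyclic_complex (Pow V)"
  unfolding acyclic_complex_def
proof (intro ballI impI)
  fix z assume z: "z \<in> CS (Pow V)" "bd z = 0"
  obtain v where v: "v \<in> V" using assms by auto
  have "z \<in> FC" using set_complex_FC[OF set_complex_Pow[OF assms(1)] z(1)] .
  then have "bd (wdg v z) = z" using z(2) by (simp add: bd_wdg)
  moreover have "wdg v z \<in> CS (Pow V)"
    by (rule CS_image[OF _ _ _ z(1)]) (use v in \<open>auto simp: wdg_sx intro!: CS_intros\<close>)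
  ultimately show "\<exists>y\<in>CS (Pow V). bd y = z" by blast
qed

text \<open>The homotopy is built one cardinality at a time: what it still has to bound on
  \<open>S\<close> is a cycle in \<open>\<Phi> S\<close>, hence a boundary there. It starts with 0
  on the empty simplex, where the two maps agree; acyclicity is used from the vertices on.\<close>

theorem acyclic_carrier:
  assumes K: "set_complex K" and L: "\<And>S. S \<in> K \<Longrightarrow> \<Phi> S \<subseteq> L"
    and set_complex: "\<And>S. S \<in> K \<Longrightarrow> S \<noteq> {} \<Longrightarrow> set_complex (\<Phi> S)"
    and acyclic: "\<And>S. S \<in> K \<Longrightarrow> S \<noteq> {} \<Longrightarrow> acyclic_complex (\<Phi> S)"
    and mono: "\<And>S T. S \<in> K \<Longrightarrow> T \<subseteq> S \<Longrightarrow> \<Phi> T \<subseteq> \<Phi> S"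
    and \<phi>: "linear \<phi>" "\<And>c. c \<in> CS K \<Longrightarrow> bd (\<phi> c) = \<phi> (bd c)" "\<And>S. S \<in> K \<Longrightarrow> \<phi> (sx S) \<in> CS (\<Phi> S)"
    and \<psi>: "linear \<psi>" "\<And>c. c \<in> CS K \<Longrightarrow> bd (\<psi> c) = \<psi> (bd c)" "\<And>S. S \<in> K \<Longrightarrow> \<psi> (sx S) \<in> CS (\<Phi> S)"
    and augment: "\<phi> (sx {}) = \<psi> (sx {})"
  shows "chain_homotopic K L \<phi> \<psi>"
proof -
  define \<delta> where "\<delta> c = \<phi> c - \<psi> c" for c
  have \<delta>: "linear \<delta>" "\<And>c. c \<in> CS K \<Longrightarrow> bd (\<delta> c) = \<delta> (bd c)" "\<And>S. S \<in> K \<Longrightarrow> \<delta> (sx S) \<in> CS (\<Phi> S)"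
    "\<delta> (sx {}) = 0"
    using \<phi> \<psi> augment unfolding \<delta>_def by (auto intro: linear_compose_sub CS_diff)
  have step: "\<exists>H. linear H \<and> (\<forall>S\<in>K. card S \<le> n \<longrightarrow>
     H (sx S) \<in> CS (\<Phi> S) \<and> bd (H (sx S)) + H (bd (sx S)) = \<delta> (sx S))" for n
  proof (induction n)
    case 0
    have "S = {}" if "S \<in> K" "card S \<le> 0" for S using that set_complexD(3)[OF K] by auto
    then show ?case using \<delta>(4) by (intro exI[of _ "\<lambda>_. 0"]) (auto simp: linear_zero)
  next
    case (Suc n)
    then obtain H where H: "linear H"
      "\<And>S. S \<in> K \<Longrightarrow> card S \<le> n \<Longrightarrow> H (sx S) \<in> CS (\<Phi> S)"
      "\<And>S. S \<in> K \<Longrightarrow> card S \<le> n \<Longrightarrow> bd (H (sx S)) + H (bd (sx S)) = \<delta> (sx S)"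
      by metis
    have bdS: "bd (sx S) \<in> CS {T \<in> K. T \<subseteq> S \<and> card T \<le> n}" if "S \<in> K" "card S \<le> Suc n" for S
      unfolding bd_sx using that set_complexD(3,4)[OF K]
      by (intro CS_sum CS_scale sx_in_CS) (auto simp: card_Diff_singleton)
    have "\<exists>y\<in>CS (\<Phi> S). bd y + H (bd (sx S)) = \<delta> (sx S)" if S: "S \<in> K" "card S = Suc n" for S
    proof -
      have ne: "S \<noteq> {}" using S by auto
      have FC: "sx S \<in> FC" using set_complexD(3)[OF K] S by (auto intro: sx_in_CS)
      have HK: "bd (H c) + H (bd c) = \<delta> c" if "c \<in> CS {T \<in> K. T \<subseteq> S \<and> card T \<le> n}" for c
        by (rule CS_eq[OF _ _ _ that])
           (use H \<delta>(1) in \<open>auto intro!: lin_intros linear_comp[OF H(1)]\<close>)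
      let ?z = "\<delta> (sx S) - H (bd (sx S))"
      have "H (bd (sx S)) \<in> CS (\<Phi> S)"
      proof (rule CS_image[OF H(1) _ _ bdS])
        fix T assume "T \<in> {T \<in> K. T \<subseteq> S \<and> card T \<le> n}"
        then show "H (sx T) \<in> CS (\<Phi> S)" using H(2)[of T] CS_mono[OF mono[OF S(1), of T]] by auto
      qed (use S in auto)
      then have z: "?z \<in> CS (\<Phi> S)" using \<delta>(3)[OF S(1)] by (auto intro: CS_diff)
      have "bd (H (bd (sx S))) + H (bd (bd (sx S))) = \<delta> (bd (sx S))"
        by (rule HK) (use bdS S in auto)
      then have "bd ?z = 0" using \<delta>(2)[OF sx_in_CS[OF S(1)]]
        by (simp add: bd_bd[OF FC] linear_0[OF H(1)])
      with z acyclic[OF S(1) ne] obtain y where "y \<in> CS (\<Phi> S)" "bd y = ?z"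
        unfolding acyclic_complex_def by metis
      then show ?thesis by (intro bexI[of _ y]) auto
    qed
    then obtain y where y: "\<And>S. S \<in> K \<Longrightarrow> card S = Suc n \<Longrightarrow>
        y S \<in> CS (\<Phi> S) \<and> bd (y S) + H (bd (sx S)) = \<delta> (sx S)"
      by metis
    \<comment> \<open>Sets with more than \<open>Suc n\<close> elements get an arbitrary value,
      which the claim at this stage does not see.\<close>
    define H' where "H' = lext (\<lambda>S. if card S \<le> n then H (sx S) else y S)"
    have linH': "linear H'" unfolding H'_def by (rule linear_lext)
    have H'H: "H' (bd (sx S)) = H (bd (sx S))" if "S \<in> K" "card S \<le> Suc n" for S
      by (rule CS_eq[OF linH' H(1) _ bdS[OF that]]) (simp add: H'_def)
    show ?case
    proof (intro exI[of _ H'] conjI ballI impI linH')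
      fix S assume S: "S \<in> K" "card S \<le> Suc n"
      show "H' (sx S) \<in> CS (\<Phi> S)" and "bd (H' (sx S)) + H' (bd (sx S)) = \<delta> (sx S)"
        unfolding H'H[OF S] using S H(2,3)[OF S(1)] y[OF S(1)]
        by (auto simp: H'_def le_Suc_eq)
    qed
  qed
  have "finite (card ` K)" using set_complexD(1)[OF K] by simp
  then obtain n where n: "\<And>S. S \<in> K \<Longrightarrow> card S \<le> n"
    unfolding finite_nat_set_iff_bounded_le by auto
  from step[of n] obtain H where H: "linear H" "\<And>S. S \<in> K \<Longrightarrow> H (sx S) \<in> CS (\<Phi> S)"
    "\<And>S. S \<in> K \<Longrightarrow> bd (H (sx S)) + H (bd (sx S)) = \<delta> (sx S)"
    using n by metis
  show ?thesis unfolding chain_homotopic_def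
  proof (intro exI[of _ H] conjI ballI H(1))
    fix c assume c: "c \<in> CS K"
    show "H c \<in> CS L"
      by (rule CS_image[OF H(1) _ _ c]) (use H(2) CS_mono[OF L] in auto)
    show "bd (H c) + H (bd c) = \<phi> c - \<psi> c"
      unfolding \<delta>_def[symmetric]
      by (rule CS_eq[OF _ _ _ c]) (use H \<delta>(1) in \<open>auto intro!: lin_intros linear_comp[OF H(1)]\<close>)
  qed
qed

text \<open>The sign counts vertices, so this is minus the alternating sum by dimension, and the
  empty simplex contributes with sign +1.\<close>

definition supertrace :: "'v set set \<Rightarrow> ('v chn \<Rightarrow> 'v chn) \<Rightarrow> real" where
  "supertrace K \<phi> = (\<Sum>S\<in>K. (- 1) ^ card S * lookup (\<phi> (sx S)) S)"

lemma lookup_linear: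
  assumes "linear f" "finite K" "c \<in> CS K"
  shows "lookup (f c) S = (\<Sum>T\<in>K. lookup c T * lookup (f (sx T)) S)"
proof -
  have "f c = f (\<Sum>T\<in>K. lookup c T *\<^sub>R sx T)"
    using chn_expand[of K c] assms by (simp add: CS_iff)
  also have "\<dots> = (\<Sum>T\<in>K. lookup c T *\<^sub>R f (sx T))"
    by (simp add: linear_sum[OF assms(1)] linear_scale[OF assms(1)])
  finally show ?thesis by (simp add: lookup_sum)
qed

lemma lookup_bd_cases:
  assumes "lookup (bd (sx T)) R \<noteq> 0" shows "\<exists>u. u \<notin> R \<and> T = insert u R"
proof -
  have "(\<Sum>v\<in>T. sg v T * lookup (sx (T - {v})) R) \<noteq> 0"
    using assms by (simp add: bd_sx lookup_sum)
  then obtain v where "v \<in> T" "lookup (sx (T - {v})) R \<noteq> 0"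
    by (metis (no_types, lifting) mult_zero_right sum.neutral)
  then have "v \<in> T" "R = T - {v}" by (auto simp: lookup_sx split: if_splits)
  then show ?thesis by (intro exI[of _ v]) auto
qed

lemma lookup_bd_sx:
  assumes "finite T" "lookup (bd (sx T)) S \<noteq> 0" shows "card T = Suc (card S)"
  using lookup_bd_cases[OF assms(2)] assms(1) by auto

text \<open>The homotopy \<open>H\<close> need not be graded: the boundary operator is, and that is enough for the
  signed traces of \<open>bd \<circ> H\<close> and \<open>H \<circ> bd\<close> to cancel.\<close>

lemma supertrace_hom:
  assumes K: "set_complex K" and "chain_homotopic K K \<phi> \<psi>"
  shows "supertrace K \<phi> = supertrace K \<psi>"
proof -
  obtain H where H: "linear H" "\<And>c. c \<in> CS K \<Longrightarrow> H c \<in> CS K" 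
    "\<And>c. c \<in> CS K \<Longrightarrow> bd (H c) + H (bd c) = \<phi> c - \<psi> c"
    using assms(2) unfolding chain_homotopic_def by metis
  let ?b = "\<lambda>T S. lookup (bd (sx T)) S" and ?h = "\<lambda>S T. lookup (H (sx S)) T"
  have 1: "lookup (\<phi> (sx S)) S - lookup (\<psi> (sx S)) S = (\<Sum>T\<in>K. ?h S T * ?b T S) + (\<Sum>T\<in>K. ?b S T * ?h T S)"
    if S: "S \<in> K" for S
  proof -
    have "lookup (\<phi> (sx S)) S - lookup (\<psi> (sx S)) S = lookup (bd (H (sx S))) S + lookup (H (bd (sx S))) S"
      using H(3)[OF sx_in_CS[OF S]] by (metis lookup_add lookup_minus)
    then show ?thesis
      using lookup_linear[OF linear_bd set_complexD(1)[OF K] H(2)[OF sx_in_CS[OF S]]]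
        lookup_linear[OF H(1) set_complexD(1)[OF K] set_complex_bd[OF K sx_in_CS[OF S]]] by simp
  qed
  have "supertrace K \<phi> - supertrace K \<psi> = (\<Sum>S\<in>K. (- 1) ^ card S * (lookup (\<phi> (sx S)) S - lookup (\<psi> (sx S)) S))"
    unfolding supertrace_def by (simp add: sum_subtractf right_diff_distrib)
  also have "\<dots> = (\<Sum>S\<in>K. \<Sum>T\<in>K. (- 1) ^ card S * (?h S T * ?b T S)) + (\<Sum>S\<in>K. \<Sum>T\<in>K. (- 1) ^ card S * (?b S T * ?h T S))"
    by (simp add: 1 distrib_left sum.distrib sum_distrib_left)
  also have "(\<Sum>S\<in>K. \<Sum>T\<in>K. (- 1) ^ card S * (?b S T * ?h T S)) = (\<Sum>S\<in>K. \<Sum>T\<in>K. (- 1) ^ card T * (?b T S * ?h S T))"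
    by (rule sum.swap)
  also have "\<dots> = - (\<Sum>S\<in>K. \<Sum>T\<in>K. (- 1) ^ card S * (?h S T * ?b T S))"
    unfolding sum_negf[symmetric]
  proof (intro sum.cong refl)
    fix S T assume "S \<in> K" "T \<in> K"
    then have "?b T S \<noteq> 0 \<Longrightarrow> card T = Suc (card S)" using lookup_bd_sx[of T S] set_complexD(3)[OF K] by auto
    then show "(- 1) ^ card T * (?b T S * ?h S T) = - ((- 1) ^ card S * (?h S T * ?b T S))"
      by (cases "?b T S = 0") auto
  qed
  finally show ?thesis by simp
qed

definition graded :: "'v set set \<Rightarrow> ('v chn \<Rightarrow> 'w chn) \<Rightarrow> bool" where
  "graded K \<phi> \<longleftrightarrow> (\<forall>S\<in>K. \<phi> (sx S) \<in> CS {T. card T = card S})"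

text \<open>Cyclicity of the trace. A nonzero entry of \<open>\<phi>\<close> joins sets of equal
  cardinality, so the grading of this one factor makes the signs on both sides agree.\<close>

lemma supertrace_comm:
  assumes K: "finite K" and L: "finite L" and \<phi>: "chain_map K L \<phi>" and \<psi>: "chain_map L K \<psi>" and gr: "graded K \<phi>"
  shows "supertrace K (\<lambda>c. \<psi> (\<phi> c)) = supertrace L (\<lambda>c. \<phi> (\<psi> c))"
proof -
  let ?f = "\<lambda>S T. lookup (\<phi> (sx S)) T" and ?g = "\<lambda>T S. lookup (\<psi> (sx T)) S"
  have "supertrace K (\<lambda>c. \<psi> (\<phi> c)) = (\<Sum>S\<in>K. \<Sum>T\<in>L. (- 1) ^ card S * (?f S T * ?g T S))"
    unfolding supertrace_def using lookup_linear[OF chain_mapD(1)[OF \<psi>] L chain_mapD(2)[OF \<phi> sx_in_CS]]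
    by (simp add: sum_distrib_left)
  also have "\<dots> = (\<Sum>S\<in>K. \<Sum>T\<in>L. (- 1) ^ card T * (?g T S * ?f S T))"
  proof (intro sum.cong refl)
    fix S T assume S: "S \<in> K"
    have "?f S T = 0 \<or> card T = card S"
      using gr S CS_lookup[of "\<phi> (sx S)" "{T. card T = card S}" T] unfolding graded_def by auto
    then show "(- 1) ^ card S * (?f S T * ?g T S) = (- 1) ^ card T * (?g T S * ?f S T)"
      by auto
  qed
  also have "\<dots> = (\<Sum>T\<in>L. \<Sum>S\<in>K. (- 1) ^ card T * (?g T S * ?f S T))" by (rule sum.swap)
  also have "\<dots> = supertrace L (\<lambda>c. \<phi> (\<psi> c))"
    unfolding supertrace_def using lookup_linear[OF chain_mapD(1)[OF \<phi>] K chain_mapD(2)[OF \<psi> sx_in_CS]]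
    by (simp add: sum_distrib_left)
  finally show ?thesis .
qed

lemma graded_comp:
  assumes "graded K \<phi>" "graded L \<psi>" "chain_map K L \<phi>" "linear \<psi>"
  shows "graded K (\<lambda>c. \<psi> (\<phi> c))"
  unfolding graded_def
proof
  fix S assume S: "S \<in> K"
  have "\<phi> (sx S) \<in> CS (L \<inter> {T. card T = card S})"
    using assms(1,3) S chain_mapD(2)[OF assms(3) sx_in_CS[OF S]] unfolding graded_def CS_iff by auto
  then show "\<psi> (\<phi> (sx S)) \<in> CS {T. card T = card S}"
    by (rule CS_image[rotated 3]) (use assms in \<open>auto simp: graded_def\<close>)
qed

lemma graded_push: 
  assumes "\<And>S. S \<in> K \<Longrightarrow> finite S" shows "graded K (push f)"
  unfolding graded_def
proof
  fix S assume "S \<in> K"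
  then have S: "finite S" using assms by auto
  show "push f (sx S) \<in> CS {T. card T = card S}"
  proof (cases "distinct (map f (srt S))")
    case True
    then have "card (f ` S) = card S"
      using distinct_card[OF True] S by (simp add: srt)
    then show ?thesis using push_sx_mem[OF S, of f] CS_mono[of "{f ` S}" "{T. card T = card S}"] by auto
  next
    case False then show ?thesis using wl_not_distinct[OF False] by (simp add: push_sx)
  qed
qed

section \<open>Barycentric coordinates and geometric complexes\<close>

text \<open>The coordinates are taken on the whole affine hull, where they may be negative; this
  allows points on different sides of a simplex to be compared. Affine independence makes them
  unique.\<close>

definition bary :: "'a::euclidean_space set \<Rightarrow> 'a \<Rightarrow> 'a \<Rightarrow> real" where
  "bary V x = (SOME u. sum u V = 1 \<and> (\<Sum>v\<in>V. u v *\<^sub>R v) = x)"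

lemma bary:
  assumes "finite V" "x \<in> affine hull V"
  shows sum_bary: "sum (bary V x) V = 1" and bary_combination: "(\<Sum>v\<in>V. bary V x v *\<^sub>R v) = x"
proof -
  have "\<exists>u. sum u V = 1 \<and> (\<Sum>v\<in>V. u v *\<^sub>R v) = x"
    using assms by (auto simp: affine_hull_finite)
  from someI_ex[OF this] show "sum (bary V x) V = 1" "(\<Sum>v\<in>V. bary V x v *\<^sub>R v) = x"
    unfolding bary_def by auto
qed

lemma affine_hull_combination:
  assumes "finite V" "sum u V = 1" shows "(\<Sum>v\<in>V. u v *\<^sub>R v) \<in> affine hull V"
  using assms by (auto simp: affine_hull_finite)

lemma bary_unique:
  assumes V: "\<not> affine_dependent V" and u: "sum u V = 1" "(\<Sum>v\<in>V. u v *\<^sub>R v) = x" and v: "v \<in> V"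
  shows "bary V x v = u v"
proof (rule ccontr)
  assume neq: "bary V x v \<noteq> u v"
  have fin: "finite V" using V by (rule aff_independent_finite)
  have x: "x \<in> affine hull V" using affine_hull_combination[OF fin u(1)] u(2) by simp
  let ?U = "\<lambda>v. bary V x v - u v"
  have "sum ?U V = 0" using sum_bary[OF fin x] u by (simp add: sum_subtractf)
  moreover have "(\<Sum>v\<in>V. ?U v *\<^sub>R v) = 0"
    using bary_combination[OF fin x] u by (simp add: scaleR_left_diff_distrib sum_subtractf)
  moreover have "\<exists>v\<in>V. ?U v \<noteq> 0" using neq v by auto
  ultimately have "affine_dependent V" unfolding affine_dependent_explicit_finite[OF fin] by blast
  with V show False ..
qed

lemma bary_affine:
  assumes V: "\<not> affine_dependent V" and I: "finite I" "sum a I = 1"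
    and x: "\<And>i. i \<in> I \<Longrightarrow> x i \<in> affine hull V" and v: "v \<in> V"
  shows "bary V (\<Sum>i\<in>I. a i *\<^sub>R x i) v = (\<Sum>i\<in>I. a i * bary V (x i) v)"
proof (rule bary_unique[OF V _ _ v])
  have fin: "finite V" using V by (rule aff_independent_finite)
  have "(\<Sum>v\<in>V. \<Sum>i\<in>I. a i * bary V (x i) v) = (\<Sum>i\<in>I. a i * sum (bary V (x i)) V)"
    by (subst sum.swap) (simp add: sum_distrib_left)
  also have "\<dots> = sum a I" using sum_bary[OF fin x] by simp
  finally show "(\<Sum>v\<in>V. \<Sum>i\<in>I. a i * bary V (x i) v) = 1" using I by simp
  have "(\<Sum>v\<in>V. (\<Sum>i\<in>I. a i * bary V (x i) v) *\<^sub>R v) = (\<Sum>i\<in>I. a i *\<^sub>R (\<Sum>v\<in>V. bary V (x i) v *\<^sub>R v))"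
    by (simp add: scaleR_sum_left scaleR_sum_right sum.swap[of _ I V])
  also have "\<dots> = (\<Sum>i\<in>I. a i *\<^sub>R x i)" using bary_combination[OF fin x] by simp
  finally show "(\<Sum>v\<in>V. (\<Sum>i\<in>I. a i * bary V (x i) v) *\<^sub>R v) = (\<Sum>i\<in>I. a i *\<^sub>R x i)" .
qed

lemma bary_vertex:
  assumes V: "\<not> affine_dependent V" and "v \<in> V" "w \<in> V"
  shows "bary V w v = (if v = w then 1 else 0)"
proof (rule bary_unique[OF V _ _ \<open>v \<in> V\<close>])
  have fin: "finite V" using V by (rule aff_independent_finite)
  show "(\<Sum>v\<in>V. if v = w then 1 else (0::real)) = 1" using fin assms by simp
  have "(\<Sum>v\<in>V. (if v = w then 1 else 0) *\<^sub>R v) = (\<Sum>v\<in>V. if v = w then w else 0)"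
    by (rule sum.cong) auto
  then show "(\<Sum>v\<in>V. (if v = w then 1 else 0) *\<^sub>R v) = w" using fin assms by simp
qed

lemma in_hull_iff_bary:
  assumes V: "\<not> affine_dependent V"
  shows "x \<in> convex hull V \<longleftrightarrow> x \<in> affine hull V \<and> (\<forall>v\<in>V. 0 \<le> bary V x v)"
proof -
  have fin: "finite V" using V by (rule aff_independent_finite)
  show ?thesis
  proof
    assume "x \<in> convex hull V"
    then obtain u where u: "\<forall>v\<in>V. 0 \<le> u v" "sum u V = 1" "(\<Sum>v\<in>V. u v *\<^sub>R v) = x"
      unfolding convex_hull_finite[OF fin] by auto
    then have "bary V x v = u v" if "v \<in> V" for v using bary_unique[OF V _ _ that, of u x] by simp
    moreover have "x \<in> affine hull V" using affine_hull_combination[OF fin u(2)] u(3) by simp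
    ultimately show "x \<in> affine hull V \<and> (\<forall>v\<in>V. 0 \<le> bary V x v)" using u(1) by simp
  next
    assume x: "x \<in> affine hull V \<and> (\<forall>v\<in>V. 0 \<le> bary V x v)"
    then show "x \<in> convex hull V"
      unfolding convex_hull_finite[OF fin] using bary[OF fin, of x] by blast
  qed
qed

lemma bary_subset:
  assumes V: "\<not> affine_dependent V" and W: "W \<subseteq> V"
  shows aff_subset_iff: "x \<in> affine hull W \<longleftrightarrow> x \<in> affine hull V \<and> (\<forall>v\<in>V - W. bary V x v = 0)"
    and bary_subset_eq: "x \<in> affine hull W \<Longrightarrow> w \<in> W \<Longrightarrow> bary V x w = bary W x w"
proof -
  have fin: "finite V" using V by (rule aff_independent_finite)
  have finW: "finite W" using fin W finite_subset by auto
  have *: "bary V x v = (if v \<in> W then bary W x v else 0)" if x: "x \<in> affine hull W" and v: "v \<in> V" for v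
  proof (rule bary_unique[OF V _ _ v])
    have VW: "V \<inter> W = W" using W by auto
    show "(\<Sum>v\<in>V. if v \<in> W then bary W x v else 0) = 1"
      using sum_bary[OF finW x] by (simp add: sum.inter_restrict[OF fin, symmetric] VW)
    have "(\<Sum>v\<in>V. (if v \<in> W then bary W x v else 0) *\<^sub>R v) = (\<Sum>v\<in>V. if v \<in> W then bary W x v *\<^sub>R v else 0)"
      by (rule sum.cong) auto
    then show "(\<Sum>v\<in>V. (if v \<in> W then bary W x v else 0) *\<^sub>R v) = x"
      using bary_combination[OF finW x] by (simp add: sum.inter_restrict[OF fin, symmetric] VW)
  qed
  show "bary V x w = bary W x w" if "x \<in> affine hull W" "w \<in> W"
    using *[OF that(1), of w] that W by auto
  show "x \<in> affine hull W \<longleftrightarrow> x \<in> affine hull V \<and> (\<forall>v\<in>V - W. bary V x v = 0)"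
  proof
    assume x: "x \<in> affine hull W"
    then have "x \<in> affine hull V" using hull_mono[OF W] by auto
    then show "x \<in> affine hull V \<and> (\<forall>v\<in>V - W. bary V x v = 0)" using *[OF x] by auto
  next
    assume x: "x \<in> affine hull V \<and> (\<forall>v\<in>V - W. bary V x v = 0)"
    have "sum (bary V x) W = sum (bary V x) V" by (rule sum.mono_neutral_left[OF fin W]) (use x in auto)
    then have s: "sum (bary V x) W = 1" using sum_bary[OF fin] x by simp
    have "(\<Sum>v\<in>W. bary V x v *\<^sub>R v) = (\<Sum>v\<in>V. bary V x v *\<^sub>R v)"
      by (rule sum.mono_neutral_left[OF fin W]) (use x in auto)
    then have "(\<Sum>v\<in>W. bary V x v *\<^sub>R v) = x" using bary_combination[OF fin] x by simp
    then show "x \<in> affine hull W" using affine_hull_combination[OF finW s] by simp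
  qed
qed

lemma hull_subset_iff:
  assumes V: "\<not> affine_dependent V" and W: "W \<subseteq> V"
  shows "x \<in> convex hull W \<longleftrightarrow> x \<in> convex hull V \<and> (\<forall>v\<in>V - W. bary V x v = 0)"
proof -
  have Wi: "\<not> affine_dependent W" using affine_independent_subset[OF V W] .
  have "x \<in> convex hull W \<longleftrightarrow> x \<in> affine hull W \<and> (\<forall>w\<in>W. 0 \<le> bary V x w)"
    unfolding in_hull_iff_bary[OF Wi] using bary_subset_eq[OF V W, of x] by auto
  then show ?thesis
    unfolding in_hull_iff_bary[OF V] aff_subset_iff[OF V W]
    using W by (metis DiffI order_refl subsetD)
qed

text \<open>Simplices are recorded by their vertex sets, which are basis elements of the chain
  algebra. The inclusion opposite to the one in the last clause is monotonicity of hulls.\<close>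

definition geo_complex :: "'a::euclidean_space set set \<Rightarrow> bool" where
  "geo_complex K \<longleftrightarrow> finite K \<and> {} \<in> K \<and> (\<forall>V\<in>K. \<not> affine_dependent V) \<and> (\<forall>V\<in>K. \<forall>W\<subseteq>V. W \<in> K) \<and>
     (\<forall>V\<in>K. \<forall>W\<in>K. convex hull V \<inter> convex hull W \<subseteq> convex hull (V \<inter> W))"

lemma geo_complexD:
  assumes "geo_complex K"
  shows "finite K" "{} \<in> K" "V \<in> K \<Longrightarrow> \<not> affine_dependent V" "V \<in> K \<Longrightarrow> W \<subseteq> V \<Longrightarrow> W \<in> K"
    "V \<in> K \<Longrightarrow> W \<in> K \<Longrightarrow> x \<in> convex hull V \<Longrightarrow> x \<in> convex hull W \<Longrightarrow> x \<in> convex hull (V \<inter> W)"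
    "V \<in> K \<Longrightarrow> finite V"
proof -
  show "finite K" "{} \<in> K" "V \<in> K \<Longrightarrow> \<not> affine_dependent V" "V \<in> K \<Longrightarrow> W \<subseteq> V \<Longrightarrow> W \<in> K"
    using assms unfolding geo_complex_def by simp_all
  then show "V \<in> K \<Longrightarrow> finite V" using aff_independent_finite by auto
  have "\<forall>V\<in>K. \<forall>W\<in>K. convex hull V \<inter> convex hull W \<subseteq> convex hull (V \<inter> W)"
    using assms unfolding geo_complex_def by simp
  then show "V \<in> K \<Longrightarrow> W \<in> K \<Longrightarrow> x \<in> convex hull V \<Longrightarrow> x \<in> convex hull W \<Longrightarrow> x \<in> convex hull (V \<inter> W)"
    by blast
qed

lemma geo_set_complex: "geo_complex K \<Longrightarrow> set_complex K"
  unfolding set_complex_def using geo_complexD(1,2,4,6)[of K] by blast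

definition polyh :: "'a::euclidean_space set set \<Rightarrow> 'a set" where
  "polyh K = (\<Union>V\<in>K. convex hull V)"

lemma polyhI: "V \<in> K \<Longrightarrow> x \<in> convex hull V \<Longrightarrow> x \<in> polyh K"
  by (auto simp: polyh_def)

lemma compact_polyh: "geo_complex K \<Longrightarrow> compact (polyh K)"
  unfolding polyh_def using geo_complexD(1,6)[of K] by (intro compact_UN finite_imp_compact_convex_hull) auto

text \<open>An intersection involves no choice; that it is itself a simplex around \<open>x\<close>
  is a property of complexes. Off the polyhedron it is \<open>UNIV\<close>, the intersection of the
  empty family.\<close>

definition car :: "'a::euclidean_space set set \<Rightarrow> 'a \<Rightarrow> 'a set" where
  "car K x = \<Inter>{V \<in> K. x \<in> convex hull V}"

lemma car:
  assumes K: "geo_complex K" and x: "x \<in> polyh K"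
  shows car_in: "car K x \<in> K" and in_hull_car: "x \<in> convex hull (car K x)"
    and car_subset: "W \<in> K \<Longrightarrow> x \<in> convex hull W \<Longrightarrow> car K x \<subseteq> W"
proof -
  let ?A = "{V \<in> K. x \<in> convex hull V}"
  have "\<exists>V. V \<in> ?A" using x by (auto simp: polyh_def)
  \<comment> \<open>A simplex around \<open>x\<close> with fewest vertices: intersecting it with
    another simplex around \<open>x\<close> cannot make it smaller, so it is contained in all of
    them.\<close>
  then obtain V where V: "V \<in> ?A" "\<And>W. W \<in> ?A \<Longrightarrow> card V \<le> card W"
    using ex_has_least_nat[of "\<lambda>V. V \<in> ?A" _ card] by auto
  have "V \<subseteq> W" if W: "W \<in> ?A" for W
  proof -
    have "V \<inter> W \<in> ?A" using V(1) W geo_complexD(4,5)[OF K] by auto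
    then have "card V \<le> card (V \<inter> W)" by (rule V(2))
    moreover have "finite V" using V(1) geo_complexD(6)[OF K] by auto
    ultimately have "V \<inter> W = V" using card_seteq[of V "V \<inter> W"] by auto
    then show ?thesis by auto
  qed
  then have "car K x = V" unfolding car_def using V(1) by blast
  then show "car K x \<in> K" "x \<in> convex hull (car K x)" using V(1) by auto
  show "car K x \<subseteq> W" if "W \<in> K" "x \<in> convex hull W" using that by (auto simp: car_def)
qed

lemma car_nonempty: "geo_complex K \<Longrightarrow> x \<in> polyh K \<Longrightarrow> car K x \<noteq> {}"
  using in_hull_car[of K x] by (metis convex_hull_empty empty_iff)

lemma car_mono:
  assumes "geo_complex K" "x \<in> polyh K" "y \<in> convex hull (car K x)" shows "car K y \<subseteq> car K x"
  using car_subset[OF assms(1) polyhI[OF car_in[OF assms(1,2)] assms(3)] car_in[OF assms(1,2)] assms(3)] .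

lemma bary_car_pos:
  assumes K: "geo_complex K" and x: "x \<in> polyh K" and v: "v \<in> car K x"
  shows "bary (car K x) x v > 0"
proof -
  let ?V = "car K x"
  have V: "\<not> affine_dependent ?V" using geo_complexD(3)[OF K car_in[OF K x]] .
  have "bary ?V x v \<noteq> 0"
  proof
    assume "bary ?V x v = 0"
    then have "x \<in> convex hull (?V - {v})"
      using hull_subset_iff[OF V, of "?V - {v}" x] in_hull_car[OF K x] by auto
    moreover have "?V - {v} \<in> K" using geo_complexD(4)[OF K car_in[OF K x]] by auto
    ultimately have "?V \<subseteq> ?V - {v}" using car_subset[OF K x] by auto
    then show False using v by auto
  qed
  moreover have "bary ?V x v \<ge> 0" using in_hull_car[OF K x] in_hull_iff_bary[OF V] v by auto
  ultimately show ?thesis by simp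
qed

lemma car_eqI:
  assumes K: "geo_complex K" and V: "V \<in> K" and x: "x \<in> convex hull V" and pos: "\<And>v. v \<in> V \<Longrightarrow> bary V x v \<noteq> 0"
  shows "car K x = V"
proof -
  have xK: "x \<in> polyh K" using polyhI[OF V x] .
  have sub: "car K x \<subseteq> V" using car_subset[OF K xK V x] .
  have "bary V x v = 0" if "v \<in> V - car K x" for v
    using hull_subset_iff[OF geo_complexD(3)[OF K V] sub, of x] in_hull_car[OF K xK] that by auto
  with pos sub show ?thesis by auto
qed

text \<open>The barycenter serves as a sample point of the open simplex: its carrier is
  \<open>V\<close>, so a condition on the carriers of points becomes one on simplices.\<close>

definition bc :: "'a::euclidean_space set \<Rightarrow> 'a" where
  "bc V = (\<Sum>v\<in>V. (1 / card V) *\<^sub>R v)"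

lemma bc:
  assumes V: "\<not> affine_dependent V" "V \<noteq> {}"
  shows bc_in_hull: "bc V \<in> convex hull V" and bary_bc: "v \<in> V \<Longrightarrow> bary V (bc V) v = 1 / card V"
proof -
  have fin: "finite V" using V(1) by (rule aff_independent_finite)
  have s: "(\<Sum>v\<in>V. 1 / real (card V)) = 1" using fin V(2) by simp
  show *: "bary V (bc V) v = 1 / card V" if "v \<in> V" for v
    by (rule bary_unique[OF V(1) s _ that]) (simp add: bc_def)
  have "bc V \<in> affine hull V" unfolding bc_def by (rule affine_hull_combination[OF fin s])
  then show "bc V \<in> convex hull V" unfolding in_hull_iff_bary[OF V(1)] using * by simp
qed

lemma bc_polyh:
  assumes "geo_complex K" "V \<in> K" "V \<noteq> {}" shows "bc V \<in> polyh K"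
  by (rule polyhI[OF assms(2) bc_in_hull[OF geo_complexD(3)[OF assms(1,2)] assms(3)]])

lemma car_bc:
  assumes "geo_complex K" "V \<in> K" "V \<noteq> {}" shows "car K (bc V) = V"
proof (rule car_eqI[OF assms(1,2) bc_in_hull[OF geo_complexD(3)[OF assms(1,2)] assms(3)]])
  fix v assume "v \<in> V"
  then show "bary V (bc V) v \<noteq> 0"
    using bary_bc[OF geo_complexD(3)[OF assms(1,2)] assms(3)] geo_complexD(6)[OF assms(1,2)] assms(3) by simp
qed

text \<open>The simplices that miss \<open>x\<close> have a closed union, so points of the
  polyhedron near \<open>x\<close> lie only in simplices that contain \<open>x\<close>.\<close>

lemma star_nbhd:
  assumes K: "geo_complex K" and x: "x \<in> polyh K"
  shows "\<exists>d>0. \<forall>y\<in>polyh K. dist x y < d \<longrightarrow> car K x \<subseteq> car K y"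
proof -
  define C where "C = (\<Union>V\<in>{V \<in> K. x \<notin> convex hull V}. convex hull V)"
  have "closed C" unfolding C_def
    using geo_complexD(1,6)[OF K] by (intro closed_UN ballI compact_imp_closed finite_imp_compact_convex_hull) auto
  then have op: "open (- C)" by (rule open_Compl)
  have xC: "x \<in> - C" by (auto simp: C_def)
  obtain d where d: "d > 0" "ball x d \<subseteq> - C" by (rule openE[OF op xC])
  show ?thesis
  proof (intro exI[of _ d] conjI ballI impI d(1))
    fix y assume y: "y \<in> polyh K" "dist x y < d"
    then have "y \<notin> C" using d(2) by auto
    then have "x \<in> convex hull (car K y)"
      unfolding C_def using car_in[OF K y(1)] in_hull_car[OF K y(1)] by auto
    then show "car K x \<subseteq> car K y" using car_subset[OF K x car_in[OF K y(1)]] by auto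
  qed
qed

text \<open>\<open>v \<in> car K y\<close> says that \<open>y\<close> is in the open star of
  \<open>v\<close>, so \<open>\<epsilon>\<close> is a Lebesgue number of the cover by open
  stars.\<close>

lemma star_Lebesgue:
  assumes K: "geo_complex K"
  shows "\<exists>\<epsilon>>0. \<forall>x\<in>polyh K. \<exists>v. \<forall>y\<in>polyh K. dist x y < \<epsilon> \<longrightarrow> v \<in> car K y"
proof -
  obtain d where d: "\<And>x. x \<in> polyh K \<Longrightarrow> d x > 0 \<and> (\<forall>y\<in>polyh K. dist x y < d x \<longrightarrow> car K x \<subseteq> car K y)"
    using star_nbhd[OF K] by metis
  let ?G = "(\<lambda>x. ball x (d x)) ` polyh K"
  have sub: "polyh K \<subseteq> \<Union>?G"
  proof
    fix x assume "x \<in> polyh K"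
    moreover from d[OF this] have "x \<in> ball x (d x)" by simp
    ultimately show "x \<in> \<Union>?G" by blast
  qed
  have op: "\<And>G. G \<in> ?G \<Longrightarrow> open G" by auto
  have "\<exists>\<epsilon>>0. \<forall>x\<in>polyh K. \<exists>B\<in>?G. ball x \<epsilon> \<subseteq> B"
  proof (rule Heine_Borel_lemma[OF compact_polyh[OF K] sub op])
    fix \<epsilon> :: real assume \<epsilon>: "0 < \<epsilon>" "\<And>x. x \<in> polyh K \<Longrightarrow> \<exists>B\<in>?G. ball x \<epsilon> \<subseteq> B"
    show ?thesis by (intro exI[of _ \<epsilon>] conjI ballI \<epsilon>)
  qed
  then obtain \<epsilon> where \<epsilon>: "\<epsilon> > 0" "\<forall>x\<in>polyh K. \<exists>B\<in>?G. ball x \<epsilon> \<subseteq> B"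
    by blast
  show ?thesis
  proof (intro exI[of _ \<epsilon>] conjI ballI \<epsilon>(1))
    fix x assume "x \<in> polyh K"
    then obtain z where z: "z \<in> polyh K" "ball x \<epsilon> \<subseteq> ball z (d z)" using \<epsilon>(2) by blast
    obtain v where v: "v \<in> car K z" using car_nonempty[OF K z(1)] by auto
    have "v \<in> car K y" if "y \<in> polyh K" "dist x y < \<epsilon>" for y
    proof -
      have "y \<in> ball z (d z)" using that z(2) by auto
      then show ?thesis using d[OF z(1)] that(1) v by auto
    qed
    then show "\<exists>v. \<forall>y\<in>polyh K. dist x y < \<epsilon> \<longrightarrow> v \<in> car K y" by blast
  qed
qed

section \<open>Subdivisions and approximations\<close>

definition subdv :: "'a::euclidean_space set set \<Rightarrow> 'a set set \<Rightarrow> bool" where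
  "subdv K' K \<longleftrightarrow> geo_complex K' \<and> geo_complex K \<and> polyh K' = polyh K \<and> (\<forall>T\<in>K'. \<exists>S\<in>K. T \<subseteq> convex hull S)"

text \<open>An open simplex of a subdivision lies in a single open simplex: a vanishing coordinate
  of \<open>x\<close> is a combination, with positive weights, of nonnegative coordinates of the
  vertices of \<open>car K' x\<close>, which therefore vanish as well.\<close>

lemma subdv_car:
  assumes s: "subdv K' K" and x: "x \<in> polyh K"
  shows "car K' x \<subseteq> convex hull (car K x)"
proof
  have K': "geo_complex K'" and K: "geo_complex K" and x': "x \<in> polyh K'" using s x by (auto simp: subdv_def)
  let ?T = "car K' x"
  have T: "\<not> affine_dependent ?T" "finite ?T" using geo_complexD(3,6)[OF K' car_in[OF K' x']] by auto
  fix t assume t: "t \<in> ?T"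
  obtain S where S: "S \<in> K" "?T \<subseteq> convex hull S" using s car_in[OF K' x'] by (auto simp: subdv_def)
  have Si: "\<not> affine_dependent S" using geo_complexD(3)[OF K S(1)] .
  have "convex hull ?T \<subseteq> convex hull S" using S(2) by (simp add: subset_hull)
  then have "x \<in> convex hull S" using in_hull_car[OF K' x'] by auto
  then have carS: "car K x \<subseteq> S" using car_subset[OF K x S(1)] by auto
  have aff: "\<And>u. u \<in> ?T \<Longrightarrow> u \<in> affine hull S" using S(2) convex_hull_subset_affine_hull[of S] by auto
  have xT: "x \<in> affine hull ?T" using in_hull_car[OF K' x'] convex_hull_subset_affine_hull[of ?T] by auto
  have "bary S t s = 0" if sS: "s \<in> S - car K x" for s
  proof -
    have "bary S (\<Sum>u\<in>?T. bary ?T x u *\<^sub>R u) s = (\<Sum>u\<in>?T. bary ?T x u * bary S u s)"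
      by (rule bary_affine[OF Si T(2) sum_bary[OF T(2) xT] aff]) (use sS in auto)
    then have "bary S x s = (\<Sum>u\<in>?T. bary ?T x u * bary S u s)"
      using bary_combination[OF T(2) xT] by simp
    moreover have "bary S x s = 0"
      using hull_subset_iff[OF Si carS, of x] in_hull_car[OF K x] sS by auto
    moreover have "bary ?T x u * bary S u s \<ge> 0" if "u \<in> ?T" for u
      using bary_car_pos[OF K' x' that] S(2) that in_hull_iff_bary[OF Si, of u] sS by auto
    ultimately have "bary ?T x t * bary S t s = 0"
      using sum_nonneg_eq_0_iff[OF T(2), of "\<lambda>u. bary ?T x u * bary S u s"] t by simp
    then show ?thesis using bary_car_pos[OF K' x' t] by simp
  qed
  then show "t \<in> convex hull (car K x)" using hull_subset_iff[OF Si carS, of t] S(2) t by auto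
qed

lemma subdv_cover:
  assumes s: "subdv K' K" and S: "S \<in> K" "x \<in> convex hull S"
  shows "\<exists>T\<in>K'. T \<subseteq> convex hull S \<and> x \<in> convex hull T"
proof
  have x: "x \<in> polyh K" "x \<in> polyh K'" and K: "geo_complex K" "geo_complex K'" using s S by (auto simp: subdv_def polyh_def)
  have "car K' x \<subseteq> convex hull (car K x)" using subdv_car[OF s x(1)] .
  also have "\<dots> \<subseteq> convex hull S" using hull_mono[OF car_subset[OF K(1) x(1) S]] .
  finally show "car K' x \<subseteq> convex hull S \<and> x \<in> convex hull (car K' x)" using in_hull_car[OF K(2) x(2)] by auto
  show "car K' x \<in> K'" using car_in[OF K(2) x(2)] .
qed

text \<open>For the piecewise linear extension of the vertex map \<open>a\<close>, this says that it maps \<open>x\<close> into the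
  carrier of \<open>f x\<close>, since it maps the open simplex of \<open>x\<close> onto the open simplex spanned by
  \<open>a ` car K x\<close>.\<close>

definition appr :: "'a::euclidean_space set set \<Rightarrow> 'b::euclidean_space set set \<Rightarrow> ('a \<Rightarrow> 'b) \<Rightarrow> ('a \<Rightarrow> 'b) \<Rightarrow> bool" where
  "appr K L f a \<longleftrightarrow> (\<forall>x\<in>polyh K. f x \<in> polyh L \<and> a ` car K x \<subseteq> car L (f x))"

text \<open>Evaluate \<open>appr\<close> at the barycenter of \<open>S\<close>, whose carrier is all
  of \<open>S\<close>.\<close>

lemma appr_simplicial:
  assumes "appr K L f a" "geo_complex K" "geo_complex L" "S \<in> K" shows "a ` S \<in> L"
proof (cases "S = {}")
  case False
  have *: "bc S \<in> polyh K" using bc_polyh[OF assms(2,4) False] .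
  have "f (bc S) \<in> polyh L" "a ` S \<subseteq> car L (f (bc S))"
    using bspec[OF assms(1)[unfolded appr_def] *] car_bc[OF assms(2,4) False] by simp_all
  then show ?thesis using geo_complexD(4)[OF assms(3) car_in[OF assms(3)]] by auto
qed (use geo_complexD(2)[OF assms(3)] in simp)

lemma appr_contiguous:
  assumes "appr K L f a" "appr K L f b" "geo_complex K" "geo_complex L" "S \<in> K" shows "a ` S \<union> b ` S \<in> L"
proof (cases "S = {}")
  case False
  have *: "bc S \<in> polyh K" using bc_polyh[OF assms(3,5) False] .
  have "f (bc S) \<in> polyh L" "a ` S \<union> b ` S \<subseteq> car L (f (bc S))"
    using bspec[OF assms(1)[unfolded appr_def] *] bspec[OF assms(2)[unfolded appr_def] *]
      car_bc[OF assms(3,5) False] by simp_all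
  then show ?thesis using geo_complexD(4)[OF assms(4) car_in[OF assms(4)]] by auto
qed (use geo_complexD(2)[OF assms(4)] in simp)

lemma appr_comp:
  assumes "appr K L f a" "appr L M g b" shows "appr K M (\<lambda>x. g (f x)) (\<lambda>x. b (a x))"
  using assms unfolding appr_def by fastforce

definition mesh :: "'a::euclidean_space set set \<Rightarrow> real \<Rightarrow> bool" where
  "mesh K \<delta> \<longleftrightarrow> (\<forall>T\<in>K. \<forall>x\<in>convex hull T. \<forall>y\<in>convex hull T. dist x y < \<delta>)"

text \<open>The bound applies to every fine complex on the polyhedron and not to one chosen
  subdivision, so that two maps can be approximated on the same one. The vertex map sends
  \<open>w\<close> to a vertex whose open star contains the points of the target within
  \<open>\<epsilon>\<close> of \<open>f w\<close>.\<close>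

lemma ex_approximation:
  assumes K: "geo_complex K" and L: "geo_complex L" and f: "continuous_on (polyh K) f" "f ` polyh K \<subseteq> polyh L"
  shows "\<exists>\<delta>>0. \<forall>K'. geo_complex K' \<longrightarrow> polyh K' = polyh K \<longrightarrow> mesh K' \<delta> \<longrightarrow> (\<exists>a. appr K' L f a)"
proof -
  obtain \<epsilon> where \<epsilon>: "\<epsilon> > 0" "\<forall>x\<in>polyh L. \<exists>v. \<forall>y\<in>polyh L. dist x y < \<epsilon> \<longrightarrow> v \<in> car L y"
    using star_Lebesgue[OF L] by blast
  then obtain v where v: "\<And>x y. x \<in> polyh L \<Longrightarrow> y \<in> polyh L \<Longrightarrow> dist x y < \<epsilon> \<Longrightarrow> v x \<in> car L y"
    by metis
  obtain \<delta> where \<delta>: "\<delta> > 0" "\<And>x y. x \<in> polyh K \<Longrightarrow> y \<in> polyh K \<Longrightarrow> dist y x < \<delta> \<Longrightarrow> dist (f y) (f x) < \<epsilon>"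
    using compact_uniformly_continuous[OF f(1) compact_polyh[OF K]] \<epsilon>(1)
    unfolding uniformly_continuous_on_def by metis
  show ?thesis
  proof (intro exI[of _ \<delta>] conjI allI impI \<delta>(1))
    fix K' assume K': "geo_complex K'" "polyh K' = polyh K" "mesh K' \<delta>"
    show "\<exists>a. appr K' L f a"
    proof (intro exI[of _ "\<lambda>x. v (f x)"], unfold appr_def, intro ballI conjI)
      fix x assume x: "x \<in> polyh K'"
      show "f x \<in> polyh L" using x K'(2) f(2) by auto
      show "(\<lambda>x. v (f x)) ` car K' x \<subseteq> car L (f x)"
      proof clarify
        fix w assume w: "w \<in> car K' x"
        then have wh: "w \<in> convex hull (car K' x)" by (rule hull_inc)
        then have "w \<in> polyh K" using polyhI[OF car_in[OF K'(1) x]] K'(2) by auto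
        moreover have "dist w x < \<delta>"
          using K'(3) car_in[OF K'(1) x] wh in_hull_car[OF K'(1) x] unfolding mesh_def by auto
        ultimately have "dist (f w) (f x) < \<epsilon>" using \<delta>(2)[of x w] x K'(2) by auto
        then show "v (f w) \<in> car L (f x)" using v \<open>w \<in> polyh K\<close> x K'(2) f(2) by blast
      qed
    qed
  qed
qed

text \<open>The vertex sets of the simplices of a complex, together with the empty set, which is adjoined so
  that the chain complexes below are augmented.\<close>

definition vsets :: "'a::euclidean_space set set \<Rightarrow> 'a set set" where
  "vsets X = insert {} (simplex_vertices ` X)"

section \<open>Complexes of closed simplices in terms of their vertex sets\<close>

lemma simplex_vertices_hull: "\<not> affine_dependent C \<Longrightarrow> simplex_vertices (convex hull C) = C"
  by (auto simp: simplex_vertices_def extreme_point_of_convex_hull_affine_independent)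

lemma complex_vertices:
  assumes X: "simplicial_complex X" and S: "S \<in> X"
  shows "\<not> affine_dependent (simplex_vertices S)" "convex hull (simplex_vertices S) = S"
proof -
  obtain n where "n simplex S" using assms unfolding simplicial_complex_def by blast
  then obtain C where "\<not> affine_dependent C" "S = convex hull C" unfolding simplex_def by auto
  then show "\<not> affine_dependent (simplex_vertices S)" "convex hull (simplex_vertices S) = S"
    using simplex_vertices_hull[of C] by auto
qed

lemma polyh_vsets: "simplicial_complex X \<Longrightarrow> polyh (vsets X) = \<Union>X"
  unfolding polyh_def vsets_def using complex_vertices(2)[of X] by simp

lemma vsets_face:
  assumes X: "simplicial_complex X" and S: "S \<in> X" and W: "W \<subseteq> simplex_vertices S"
  shows "convex hull W \<in> X" "simplex_vertices (convex hull W) = W"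
proof -
  note V = complex_vertices[OF X S]
  have "convex hull W face_of S"
    using face_of_convex_hull_affine_independent[OF V(1), of "convex hull W"] W V(2) by auto
  then show "convex hull W \<in> X" using X S unfolding simplicial_complex_def by blast
  show "simplex_vertices (convex hull W) = W"
    using simplex_vertices_hull[OF affine_independent_subset[OF V(1) W]] .
qed

lemma geo_vsets: assumes X: "simplicial_complex X" shows "geo_complex (vsets X)"
  unfolding geo_complex_def
proof (intro conjI ballI allI impI)
  show "finite (vsets X)" using X by (simp add: vsets_def simplicial_complex_def)
  show "{} \<in> vsets X" by (simp add: vsets_def)
next
  fix V assume "V \<in> vsets X" then show "\<not> affine_dependent V"
    using complex_vertices(1)[OF X] by (auto simp: vsets_def)
next
  fix V W assume "V \<in> vsets X" "W \<subseteq> V" then show "W \<in> vsets X"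
    unfolding vsets_def using vsets_face[OF X, of _ W] by (smt (verit, ccfv_SIG) image_eqI image_iff insert_iff subset_empty)
next
  fix V W assume VW: "V \<in> vsets X" "W \<in> vsets X"
  show "convex hull V \<inter> convex hull W \<subseteq> convex hull (V \<inter> W)"
  proof (cases "V = {} \<or> W = {}")
    case False
    then obtain S T where S: "S \<in> X" "V = simplex_vertices S" and T: "T \<in> X" "W = simplex_vertices T"
      using VW by (auto simp: vsets_def)
    have ST: "(S \<inter> T) face_of S" "(T \<inter> S) face_of T" using X S(1) T(1) unfolding simplicial_complex_def by blast+
    obtain C where C: "C \<subseteq> V" "S \<inter> T = convex hull C"
      using ST(1) face_of_convex_hull_affine_independent[OF complex_vertices(1)[OF X S(1)]]
      unfolding complex_vertices(2)[OF X S(1)] S(2) by auto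
    obtain D where D: "D \<subseteq> W" "T \<inter> S = convex hull D"
      using ST(2) face_of_convex_hull_affine_independent[OF complex_vertices(1)[OF X T(1)]]
      unfolding complex_vertices(2)[OF X T(1)] T(2) by auto
    \<comment> \<open>The common face has only one set of extreme points, so its descriptions inside
      \<open>V\<close> and inside \<open>W\<close> use the same vertices.\<close>
    have "C = simplex_vertices (convex hull C)" "D = simplex_vertices (convex hull D)"
      using vsets_face(2)[OF X S(1)] vsets_face(2)[OF X T(1)] C(1) D(1) S(2) T(2) by metis+
    then have "C = D" using C(2) D(2) by (simp add: Int_commute)
    then have "C \<subseteq> V \<inter> W" using C(1) D(1) by auto
    then show ?thesis using C(2) S T complex_vertices(2)[OF X S(1)] complex_vertices(2)[OF X T(1)]
      by (metis hull_mono)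
  qed auto
qed

lemma ex_fine_subdivision:
  assumes K: "geo_complex K" and "\<delta> > 0"
  shows "\<exists>K'. subdv K' K \<and> mesh K' \<delta>"
proof -
  have fin: "finite ((\<lambda>V. convex hull V) ` K)" using geo_complexD(1)[OF K] by simp
  have poly: "polytope C" if "C \<in> (\<lambda>V. convex hull V) ` K" for C
    using that geo_complexD(6)[OF K] by (auto simp: polytope_def)
  have face: "C1 \<inter> C2 face_of C1" if CC: "C1 \<in> (\<lambda>V. convex hull V) ` K" "C2 \<in> (\<lambda>V. convex hull V) ` K" for C1 C2
  proof -
    obtain V W where V: "V \<in> K" "C1 = convex hull V" and W: "W \<in> K" "C2 = convex hull W" using CC by auto
    have "C1 \<inter> C2 \<subseteq> convex hull (V \<inter> W)" using geo_complexD(5)[OF K V(1) W(1)] V W by auto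
    moreover have "convex hull (V \<inter> W) \<subseteq> C1 \<inter> C2" using V W by (simp add: hull_mono)
    ultimately have "C1 \<inter> C2 = convex hull (V \<inter> W)" by auto
    then show ?thesis using face_of_convex_hull_affine_independent[OF geo_complexD(3)[OF K V(1)]] V(2) by auto
  qed
  obtain X where X: "simplicial_complex X" "\<And>C. C \<in> X \<Longrightarrow> diameter C < \<delta>"
    "\<Union>X = \<Union>((\<lambda>V. convex hull V) ` K)" "\<And>C. C \<in> X \<Longrightarrow> \<exists>D. D \<in> (\<lambda>V. convex hull V) ` K \<and> C \<subseteq> D"
    using fine_simplicial_subdivision_of_cell_complex[OF assms(2) fin poly face] by metis
  show ?thesis
  proof (intro exI[of _ "vsets X"] conjI)
    show "subdv (vsets X) K"
      unfolding subdv_def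
    proof (intro conjI ballI)
      show "geo_complex (vsets X)" using geo_vsets[OF X(1)] .
      show "geo_complex K" by (rule K)
      show "polyh (vsets X) = polyh K" using polyh_vsets[OF X(1)] X(3) by (simp add: polyh_def)
      fix T assume "T \<in> vsets X"
      then consider "T = {}" | C where "C \<in> X" "T = simplex_vertices C" by (auto simp: vsets_def)
      then show "\<exists>S\<in>K. T \<subseteq> convex hull S"
      proof cases
        case 1 then show ?thesis using geo_complexD(2)[OF K] by auto
      next
        case 2
        have "T \<subseteq> C" using 2 complex_vertices(2)[OF X(1) 2(1)] hull_subset[of T convex] by simp
        then show ?thesis using X(4)[OF 2(1)] by auto
      qed
    qed
    show "mesh (vsets X) \<delta>"
      unfolding mesh_def
    proof (intro ballI)
      fix T x y assume T: "T \<in> vsets X" and xy: "x \<in> convex hull T" "y \<in> convex hull T"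
      then obtain C where C: "C \<in> X" "convex hull T = C"
        using complex_vertices(2)[OF X(1)] by (auto simp: vsets_def)
      have "bounded C" using C(2) geo_complexD(6)[OF geo_vsets[OF X(1)] T] finite_imp_bounded_convex_hull by auto
      then have "dist x y \<le> diameter C" using diameter_bounded_bound[of C x y] xy C(2) by auto
      then show "dist x y < \<delta>" using X(2)[OF C(1)] by linarith
    qed
  qed
qed

section \<open>Orientations and the subdivision operator\<close>

lemma affine_hull_eq_card:
  fixes S U :: "'a::euclidean_space set"
  assumes S: "\<not> affine_dependent S" and U: "\<not> affine_dependent U" "U \<subseteq> affine hull S" and "card U = card S"
  shows "affine hull U = affine hull S"
proof -
  have "aff_dim U = aff_dim (affine hull S)"
    using aff_dim_affine_independent[OF S] aff_dim_affine_independent[OF U(1)] assms(4) by simp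
  then show ?thesis using aff_dim_eq_full_gen[OF U(2)] by (simp add: hull_hull)
qed

lemma independent_card_le:
  fixes U W :: "'a::euclidean_space set"
  assumes "\<not> affine_dependent U" "U \<subseteq> affine hull W" "finite W" shows "card U \<le> card W"
proof -
  have "aff_dim U \<le> aff_dim W" using aff_dim_subset[OF assms(2)] by simp
  then show ?thesis using aff_dim_affine_independent[OF assms(1)] aff_dim_le_card[OF assms(3)] by linarith
qed

lemma bary_affine2:
  assumes V: "\<not> affine_dependent V" and x: "x \<in> affine hull V" "y \<in> affine hull V" and v: "v \<in> V"
  shows "bary V ((1 - t) *\<^sub>R x + t *\<^sub>R y) v = (1 - t) * bary V x v + t * bary V y v"
  using bary_affine[OF V, of "{False, True}" "\<lambda>b. if b then t else 1 - t" "\<lambda>b. if b then y else x" v] x v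
  by auto

text \<open>A point of the affine hull of \<open>S\<close> is the combination of the vertices of \<open>S\<close> given by its barycentric
  coordinates.  Wedging the points of \<open>T\<close> yields \<open>lam S (sx T)\<close>; its coefficient at \<open>S\<close> is the
  determinant of the barycentric coordinates and its sign compares the orientations of \<open>T\<close> and \<open>S\<close>.\<close>

definition pw :: "'a::euclidean_space set \<Rightarrow> 'a \<Rightarrow> 'a chn \<Rightarrow> 'a chn" where
  "pw S x c = (\<Sum>s\<in>S. bary S x s *\<^sub>R wdg s c)"

lemma linear_pw [simp]: "linear (pw S x)"
  unfolding pw_def by (intro linear_compose_sum ballI lin_intros)

lemma pw_FC: "c \<in> FC \<Longrightarrow> pw S x c \<in> FC"
  unfolding pw_def by (intro CS_sum CS_scale wdg_FC)

lemma pw_anticommute: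
  assumes "c \<in> FC" shows "pw S x (pw S y c) = - pw S y (pw S x c)"
proof -
  have "pw S x (pw S y c) = (\<Sum>s\<in>S. \<Sum>t\<in>S. (bary S x s * bary S y t) *\<^sub>R wdg s (wdg t c))"
    unfolding pw_def by (simp add: scaleR_sum_right)
  also have "\<dots> = (\<Sum>t\<in>S. \<Sum>s\<in>S. (bary S x s * bary S y t) *\<^sub>R wdg s (wdg t c))"
    by (rule sum.swap)
  also have "\<dots> = (\<Sum>t\<in>S. \<Sum>s\<in>S. - ((bary S y t * bary S x s) *\<^sub>R wdg t (wdg s c)))"
    by (intro sum.cong refl) (subst wdg_anticommute[OF assms], simp add: mult.commute)
  also have "\<dots> = - pw S y (pw S x c)"
    unfolding pw_def by (simp add: scaleR_sum_right sum_negf)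
  finally show ?thesis .
qed

lemma pw_vertex:
  assumes S: "\<not> affine_dependent S" and s: "s \<in> S" shows "pw S s c = wdg s c"
proof -
  have "pw S s c = (\<Sum>t\<in>S. if t = s then wdg s c else 0)"
    unfolding pw_def by (intro sum.cong refl) (auto simp: bary_vertex[OF S _ s])
  then show ?thesis using s aff_independent_finite[OF S] by simp
qed

definition lam :: "'a::euclidean_space set \<Rightarrow> 'a chn \<Rightarrow> 'a chn" where
  "lam S = aext (pw S) (sx {})"

lemma linear_lam [simp]: "linear (lam S)" by (simp add: lam_def linear_aext)

lemmas lam_lin [simp] = linear_add[OF linear_lam] linear_scale[OF linear_lam] linear_sum[OF linear_lam]
  linear_0[OF linear_lam] linear_diff[OF linear_lam] linear_neg[OF linear_lam]

lemma lam_empty [simp]: "lam S (sx {}) = sx {}" by (simp add: lam_def aext_sx)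

lemma lam_wdg: "c \<in> FC \<Longrightarrow> lam S (wdg x c) = pw S x (lam S c)"
  unfolding lam_def
  by (rule aext_wdg[where U = FC]) (auto intro: pw_FC pw_anticommute sx_in_CS)

lemma lam_wl: "lam S (wl (x # xs)) = pw S x (lam S (wl xs))"
  by (simp add: lam_wdg)

lemma lam_wl_foldr: "lam S (wl xs) = foldr (pw S) xs (sx {})"
  by (induction xs) (auto simp: lam_wdg)

lemma lam_wl_mem:
  assumes "finite S" shows "lam S (wl xs) \<in> CS {T. T \<subseteq> S \<and> card T = length xs}"
proof (induction xs)
  case Nil show ?case by (simp add: sx_in_CS)
next
  case (Cons x xs)
  have "wdg s (lam S (wl xs)) \<in> CS {T. T \<subseteq> S \<and> card T = length (x # xs)}" if "s \<in> S" for s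
    by (rule CS_image[OF linear_wdg _ subspace_CS Cons])
       (use that assms finite_subset in \<open>auto simp: wdg_sx intro!: CS_scale sx_in_CS\<close>)
  then show ?case unfolding lam_wl pw_def by (intro CS_sum CS_scale)
qed

lemma lam_sx_mem:
  assumes "finite S" "finite T" shows "lam S (sx T) \<in> CS {U. U \<subseteq> S \<and> card U = card T}"
  using lam_wl_mem[OF assms(1), of "srt T"] assms by (simp add: wl_srt length_srt)

lemma lam_FC: "finite S \<Longrightarrow> c \<in> FC \<Longrightarrow> lam S c \<in> FC"
proof (rule CS_image[of "lam S" "{S. finite S}"])
  fix T :: "'a set" assume "finite S" "T \<in> {S. finite S}"
  then show "lam S (sx T) \<in> FC"
    using lam_sx_mem[of S T] CS_mono[of "{U. U \<subseteq> S \<and> card U = card T}" "{S. finite S}"] finite_subset by auto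
qed auto

text \<open>Expanding points in \<open>S\<close> and then the vertices of \<open>S\<close> in
  \<open>T\<close> is expanding them in \<open>T\<close>; on coefficients this is multiplicativity
  of determinants.\<close>

lemma lam_lam_wl:
  assumes S: "\<not> affine_dependent S" and T: "\<not> affine_dependent T" "S \<subseteq> affine hull T" and xs: "set xs \<subseteq> affine hull S"
  shows "lam T (lam S (wl xs)) = lam T (wl xs)"
  using xs
proof (induction xs)
  case (Cons x xs)
  have finS: "finite S" using S by (rule aff_independent_finite)
  have x: "x \<in> affine hull S" using Cons by simp
  let ?c = "lam S (wl xs)"
  have c: "?c \<in> FC" by (rule lam_FC[OF finS]) simp
  have ba: "bary T x t = (\<Sum>s\<in>S. bary S x s * bary T s t)" if "t \<in> T" for t
    using bary_affine[OF T(1) finS sum_bary[OF finS x] _ that, of "\<lambda>s. s"] T(2) bary_combination[OF finS x] by auto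
  have "lam T (lam S (wl (x # xs))) = (\<Sum>s\<in>S. bary S x s *\<^sub>R pw T s (lam T ?c))"
    unfolding lam_wl[of S] pw_def[of S] by (simp add: lam_wdg[OF c])
  also have "\<dots> = (\<Sum>s\<in>S. \<Sum>t\<in>T. (bary S x s * bary T s t) *\<^sub>R wdg t (lam T ?c))"
    unfolding pw_def by (simp add: scaleR_sum_right)
  also have "\<dots> = (\<Sum>t\<in>T. \<Sum>s\<in>S. (bary S x s * bary T s t) *\<^sub>R wdg t (lam T ?c))"
    by (rule sum.swap)
  also have "\<dots> = pw T x (lam T ?c)"
    unfolding pw_def by (intro sum.cong refl) (simp add: ba scaleR_sum_left)
  also have "\<dots> = lam T (wl (x # xs))" using Cons by (simp add: lam_wdg)
  finally show ?case .
qed simp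

lemma lam_vertices:
  assumes S: "\<not> affine_dependent S" and xs: "set xs \<subseteq> S" shows "lam S (wl xs) = wl xs"
  using xs by (induction xs) (auto simp: lam_wdg pw_vertex[OF S])

text \<open>If the coefficient vanished, \<open>lam S (sx U)\<close> would be 0; but changing
  coordinates back to \<open>U\<close> returns \<open>sx U\<close>.\<close>

lemma lam_nonzero:
  assumes S: "\<not> affine_dependent S" and U: "\<not> affine_dependent U" "U \<subseteq> affine hull S" "card U = card S"
  shows "lookup (lam S (sx U)) S \<noteq> 0"
proof
  assume 0: "lookup (lam S (sx U)) S = 0"
  have fin: "finite S" "finite U" using S U aff_independent_finite by auto
  have "{T. T \<subseteq> S \<and> card T = card U} \<subseteq> {S}" using card_subset_eq[OF fin(1)] U(3) by auto
  then have "lam S (sx U) \<in> CS {S}" using lam_sx_mem[OF fin] CS_mono by blast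
  then have "lookup (lam S (sx U)) T = 0" for T using 0 CS_lookup[of "lam S (sx U)" "{S}" T] by (cases "T = S") auto
  then have "lam S (sx U) = 0" by (intro poly_mapping_eqI) simp
  moreover obtain xs where xs: "sx U = wl xs" "set xs = U" using sx_eq_wl[OF fin(2)] by auto
  have "lam U (lam S (wl xs)) = lam U (wl xs)"
    using affine_hull_eq_card[OF S U] hull_subset[of S affine] xs(2) U(2) by (intro lam_lam_wl[OF S U(1)]) auto
  ultimately have "wl xs = 0" using lam_vertices[OF U(1), of xs] xs by simp
  then have "lookup (sx U) U = 0" using xs by simp
  then show False by (simp add: lookup_sx)
qed

definition sdset :: "'a::euclidean_space set set \<Rightarrow> 'a set \<Rightarrow> 'a set set" where
  "sdset K' S = {T \<in> K'. T \<subseteq> convex hull S \<and> card T = card S}"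

text \<open>Of the determinant only the sign is kept: each \<open>T\<close> counts once, with the
  orientation induced from \<open>S\<close>.\<close>

definition sd :: "'a::euclidean_space set set \<Rightarrow> 'a chn \<Rightarrow> 'a chn" where
  "sd K' = lext (\<lambda>S. \<Sum>T\<in>sdset K' S. sgn (lookup (lam S (sx T)) S) *\<^sub>R sx T)"

lemma linear_sd [simp]: "linear (sd K')" by (simp add: sd_def linear_lext)

lemma sd_sx: "sd K' (sx S) = (\<Sum>T\<in>sdset K' S. sgn (lookup (lam S (sx T)) S) *\<^sub>R sx T)"
  by (simp add: sd_def)

lemma sd_sx_mem: "sd K' (sx S) \<in> CS (sdset K' S)"
  unfolding sd_sx by (intro CS_sum CS_scale sx_in_CS)

lemma sd_sx_empty: "geo_complex K' \<Longrightarrow> sd K' (sx {}) = sx {}"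
proof -
  assume K': "geo_complex K'"
  have "sdset K' {} = {{}}" using geo_complexD(2)[OF K'] by (auto simp: sdset_def)
  then show ?thesis by (simp add: sd_sx lookup_sx)
qed

text \<open>For a codimension one simplex \<open>R\<close> of the subdivided simplex \<open>S\<close>, the sign of the affine function
  \<open>side S R\<close> separates the two sides of \<open>R\<close>.\<close>

definition side :: "'a::euclidean_space set \<Rightarrow> 'a set \<Rightarrow> 'a \<Rightarrow> real" where
  "side S R u = lookup (pw S u (lam S (sx R))) S"

definition link :: "'a::euclidean_space set set \<Rightarrow> 'a set \<Rightarrow> 'a set \<Rightarrow> 'a set" where
  "link K' S R = {u. u \<notin> R \<and> insert u R \<in> K' \<and> insert u R \<subseteq> convex hull S}"

lemma side_wdg: "finite R \<Longrightarrow> side S R u = lookup (lam S (wdg u (sx R))) S"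
  by (simp add: side_def lam_wdg sx_in_CS)

lemma side_vertices:
  assumes S: "\<not> affine_dependent S"
  shows "side S R u = (\<Sum>s\<in>S. bary S u s * side S R s)"
  unfolding side_def using pw_vertex[OF S] by (simp add: pw_def lookup_sum cong: sum.cong)

lemma side_affine:
  assumes S: "\<not> affine_dependent S" and I: "finite I" "sum a I = 1" and x: "\<And>i. i \<in> I \<Longrightarrow> x i \<in> affine hull S"
  shows "side S R (\<Sum>i\<in>I. a i *\<^sub>R x i) = (\<Sum>i\<in>I. a i * side S R (x i))"
proof -
  have "side S R (\<Sum>i\<in>I. a i *\<^sub>R x i) = (\<Sum>s\<in>S. (\<Sum>i\<in>I. a i * bary S (x i) s) * side S R s)"
    unfolding side_vertices[OF S, of R "\<Sum>i\<in>I. a i *\<^sub>R x i"]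
    by (intro sum.cong refl) (simp add: bary_affine[OF S I x])
  also have "\<dots> = (\<Sum>i\<in>I. a i * (\<Sum>s\<in>S. bary S (x i) s * side S R s))"
    by (simp add: sum_distrib_left sum_distrib_right sum.swap[of _ I S] mult.assoc)
  also have "\<dots> = (\<Sum>i\<in>I. a i * side S R (x i))" by (simp only: side_vertices[OF S, symmetric])
  finally show ?thesis .
qed

lemma side_affine2:
  assumes S: "\<not> affine_dependent S" and x: "x \<in> affine hull S" "y \<in> affine hull S"
  shows "side S R ((1 - t) *\<^sub>R x + t *\<^sub>R y) = (1 - t) * side S R x + t * side S R y"
  using side_affine[OF S, of "{False, True}" "\<lambda>b. if b then t else 1 - t" "\<lambda>b. if b then y else x" R] x
  by auto

lemma side_hull:
  assumes S: "\<not> affine_dependent S" and W: "finite W" "W \<subseteq> affine hull S" and y: "y \<in> affine hull W"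
  shows "side S R y = (\<Sum>w\<in>W. bary W y w * side S R w)"
  using side_affine[OF S W(1) sum_bary[OF W(1) y], of "\<lambda>w. w" R] W(2) bary_combination[OF W(1) y] by auto

lemma side_0: "finite R \<Longrightarrow> r \<in> R \<Longrightarrow> side S R r = 0"
  by (simp add: side_wdg wdg_sx)

lemma side_hull_0:
  assumes S: "\<not> affine_dependent S" and R: "finite R" "R \<subseteq> affine hull S" "y \<in> affine hull R"
  shows "side S R y = 0"
  using side_hull[OF S R, of R] side_0[OF R(1)] by simp

lemma side_nonzero:
  assumes S: "\<not> affine_dependent S" and R: "\<not> affine_dependent (insert u R)" "insert u R \<subseteq> affine hull S"
    "u \<notin> R" "card S = Suc (card R)"
  shows "side S R u \<noteq> 0"
proof -
  have fin: "finite R" using aff_independent_finite[OF R(1)] by simp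
  have "lookup (lam S (sx (insert u R))) S \<noteq> 0"
    by (rule lam_nonzero[OF S R(1,2)]) (use fin R in simp)
  then show ?thesis using sg_cases[of u R] R(3) by (auto simp: side_wdg[OF fin] wdg_sx)
qed

section \<open>Top simplices around a codimension one simplex of a subdivided simplex\<close>

context
  fixes K' K :: "'a::euclidean_space set set" and S R :: "'a set"
  assumes sub: "subdv K' K" and SK: "S \<in> K"
    and RK: "R \<in> K'" and RS: "R \<subseteq> convex hull S" and card: "card S = Suc (card R)"
begin

lemma geo': "geo_complex K'" "geo_complex K" "polyh K' = polyh K"
  using sub by (auto simp: subdv_def)

lemma S_indep: "\<not> affine_dependent S" and S_fin: "finite S"
  using geo_complexD(3,6)[OF geo'(2) SK] by auto

lemma R_indep: "\<not> affine_dependent R" and R_fin: "finite R"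
  using geo_complexD(3,6)[OF geo'(1) RK] by auto

lemma hull_aff: "x \<in> convex hull S \<Longrightarrow> x \<in> affine hull S"
  using convex_hull_subset_affine_hull by auto

lemma link_nonzero: "u \<in> link K' S R \<Longrightarrow> side S R u \<noteq> 0"
  using side_nonzero[OF S_indep, of u R] geo_complexD(3)[OF geo'(1)] card hull_aff by (auto simp: link_def)

text \<open>Points of \<open>S\<close> near the barycenter of \<open>R\<close> lie in simplices that contain \<open>R\<close>; two such simplices on
  the same side of \<open>R\<close> would overlap.\<close>

lemma link_exists:
  assumes z: "z \<in> convex hull S" "side S R z \<noteq> 0"
  shows "\<exists>u\<in>link K' S R. side S R u * side S R z > 0"
proof -
  have "\<exists>W y t. W \<in> K' \<and> R \<subseteq> W \<and> W \<subseteq> convex hull S \<and> y \<in> convex hull W \<and> t > 0 \<and> side S R y = t * side S R z"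
  proof (cases "R = {}")
    \<comment> \<open>Here \<open>S\<close> is a single vertex and \<open>R\<close> has no
      barycenter to start from; any simplex of the subdivision around \<open>z\<close> will do, with
      \<open>t = 1\<close>.\<close>
    case True
    obtain T where "T \<in> K'" "T \<subseteq> convex hull S" "z \<in> convex hull T"
      using subdv_cover[OF sub SK z(1)] by auto
    then show ?thesis using True by (intro exI[of _ T] exI[of _ z] exI[of _ 1]) auto
  next
    case False
    let ?q = "bc R"
    have q: "?q \<in> polyh K'" "car K' ?q = R" using bc_polyh[OF geo'(1) RK False] car_bc[OF geo'(1) RK False] by auto
    have qR: "?q \<in> convex hull R" using bc_in_hull[OF R_indep False] .
    have qS: "?q \<in> convex hull S" using qR RS hull_minimal[of R "convex hull S" convex] by auto
    obtain d where d: "d > 0" "\<And>y. y \<in> polyh K' \<Longrightarrow> dist ?q y < d \<Longrightarrow> R \<subseteq> car K' y"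
      using star_nbhd[OF geo'(1) q(1)] q(2) by metis
    \<comment> \<open>Small enough for the point at parameter \<open>t\<close> to be closer than
      \<open>d\<close> to the barycenter; the summand 1 keeps the denominator positive if
      \<open>z\<close> is the barycenter itself.\<close>
    define t where "t = min 1 (d / (2 * (1 + norm (z - ?q))))"
    have t: "0 < t" "t \<le> 1" using d(1) by (auto simp: t_def add_pos_nonneg)
    define y where "y = (1 - t) *\<^sub>R ?q + t *\<^sub>R z"
    have yS: "y \<in> convex hull S" unfolding y_def
      using t by (intro convexD[OF convex_convex_hull qS z(1)]) auto
    have yK: "y \<in> polyh K" "y \<in> polyh K'" using polyhI[OF SK yS] geo'(3) by auto
    have "y - ?q = t *\<^sub>R (z - ?q)" by (simp add: y_def algebra_simps)
    then have "dist ?q y = t * norm (z - ?q)" using t by (simp add: dist_commute dist_norm)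
    also have "\<dots> \<le> d / (2 * (1 + norm (z - ?q))) * norm (z - ?q)"
      by (intro mult_right_mono) (auto simp: t_def)
    also have "\<dots> < d" using d(1) by (simp add: field_simps add_pos_nonneg)
    finally have RW: "R \<subseteq> car K' y" using d(2) yK by auto
    have "car K' y \<subseteq> convex hull (car K y)" using subdv_car[OF sub yK(1)] .
    also have "\<dots> \<subseteq> convex hull S" using hull_mono[OF car_subset[OF geo'(2) yK(1) SK yS]] .
    finally have WS: "car K' y \<subseteq> convex hull S" .
    have "side S R y = (1 - t) * side S R ?q + t * side S R z"
      unfolding y_def by (rule side_affine2[OF S_indep hull_aff[OF qS] hull_aff[OF z(1)]])
    moreover have "side S R ?q = 0"
      using side_hull_0[OF S_indep R_fin] RS hull_aff qR convex_hull_subset_affine_hull[of R] by blast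
    ultimately show ?thesis using RW WS t car_in[OF geo'(1) yK(2)] in_hull_car[OF geo'(1) yK(2)]
      by (intro exI[of _ "car K' y"] exI[of _ y] exI[of _ t]) auto
  qed
  then obtain W y t where W: "W \<in> K'" "R \<subseteq> W" "W \<subseteq> convex hull S" and y: "y \<in> convex hull W"
    and t: "t > 0" "side S R y = t * side S R z" by blast
  have Wi: "\<not> affine_dependent W" "finite W" using geo_complexD(3,6)[OF geo'(1) W(1)] by auto
  have yW: "y \<in> affine hull W" using y convex_hull_subset_affine_hull by auto
  have "side S R y = (\<Sum>w\<in>W. bary W y w * side S R w)"
    by (rule side_hull[OF S_indep Wi(2) _ yW]) (use W(3) hull_aff in auto)
  \<comment> \<open>\<open>side S R y\<close> has the sign of \<open>side S R z\<close> and is a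
    nonnegative combination of the values at the vertices of \<open>W\<close>, so one of these
    vertices lies on the side of \<open>z\<close>.\<close>
  then have "(\<Sum>w\<in>W. bary W y w * (side S R w * side S R z)) = t * (side S R z * side S R z)"
    unfolding t(2) by (simp add: sum_distrib_right[symmetric] mult.assoc[symmetric])
  also have "\<dots> > 0" using t(1) z(2) not_real_square_gt_zero by (metis mult_pos_pos)
  finally have "\<exists>w\<in>W. bary W y w * (side S R w * side S R z) > 0"
    by (meson not_le sum_nonpos)
  then obtain w where w: "w \<in> W" "bary W y w * (side S R w * side S R z) > 0" by blast
  have "bary W y w \<ge> 0" using y w(1) in_hull_iff_bary[OF Wi(1)] by auto
  then have pos: "side S R w * side S R z > 0" using w(2) by (simp add: zero_less_mult_iff)
  then have "w \<notin> R" using side_0[OF R_fin, of w S] by auto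
  moreover have "insert w R \<in> K'" using geo_complexD(4)[OF geo'(1) W(1), of "insert w R"] W(2) w(1) by auto
  ultimately have "w \<in> link K' S R" using w(1) W(3) RS by (auto simp: link_def)
  with pos show ?thesis by blast
qed

lemma link_unique:
  assumes u: "u \<in> link K' S R" and u': "u' \<in> link K' S R" and same: "side S R u * side S R u' > 0"
  shows "u = u'"
proof (cases "R = {}")
  case True
  then obtain s where "S = {s}" using card card_1_singletonE[of S] by auto
  then show ?thesis using u u' by (auto simp: link_def)
next
  case R: False
  show ?thesis
  proof (rule ccontr)
    assume neq: "u \<noteq> u'"
    let ?V = "insert u R" and ?V' = "insert u' R" and ?q = "bc R"
    have V: "?V \<in> K'" "?V' \<in> K'" "u \<notin> R" "u' \<notin> R" "?V \<subseteq> convex hull S" "?V' \<subseteq> convex hull S"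
      using u u' by (auto simp: link_def)
    have Vi: "\<not> affine_dependent ?V" using geo_complexD(3)[OF geo'(1) V(1)] .
    have affV: "affine hull ?V = affine hull S"
      by (rule affine_hull_eq_card[OF S_indep Vi]) (use V hull_aff card R_fin in auto)
    have u'V: "u' \<in> affine hull ?V" using V(6) hull_aff affV by auto
    have qR: "?q \<in> convex hull R" using bc_in_hull[OF R_indep R] .
    have qV: "?q \<in> affine hull ?V"
      using qR convex_hull_subset_affine_hull[of R] hull_mono[of R ?V affine] by auto
    \<comment> \<open>Coordinates of \<open>u'\<close> in the simplex of \<open>u\<close>. The one
      at \<open>u\<close> is positive because the two points are on the same side of
      \<open>R\<close>; those at \<open>R\<close> may have any sign.\<close>
    define b where "b v = bary ?V u' v" for v
    have RaS: "R \<subseteq> affine hull S" using RS hull_aff by auto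
    have "side S R u' = (\<Sum>v\<in>?V. b v * side S R v)"
      unfolding b_def by (rule side_hull[OF S_indep _ _ u'V]) (use V hull_aff R_fin in auto)
    also have "\<dots> = b u * side S R u" using V(3) R_fin side_0[OF R_fin] by simp
    finally have su': "side S R u' = b u * side S R u" .
    have "b u * (side S R u)\<^sup>2 > 0" using same unfolding su' by (simp add: power2_eq_square mult_ac)
    then have bu: "b u > 0" by (simp add: zero_less_mult_iff)
    define m where "m = real (card R)"
    have m: "m > 0" using R R_fin by (simp add: m_def card_gt_0_iff)
    define B where "B = (\<Sum>v\<in>R. \<bar>b v\<bar>)"
    have B: "B \<ge> 0" "\<And>v. v \<in> R \<Longrightarrow> \<bar>b v\<bar> \<le> B"
      unfolding B_def using R_fin by (auto intro: sum_nonneg member_le_sum)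
    \<comment> \<open>Then \<open>1 - t = t * (m * B)\<close>. The coordinates of the barycenter on
      \<open>R\<close> are \<open>1 / m\<close>, so they stay nonnegative when it is moved towards
      \<open>u'\<close> by the fraction \<open>t\<close>: the point enters the simplex of
      \<open>u\<close>.\<close>
    define t where "t = 1 / (1 + m * B)"
    have mB: "m * B \<ge> 0" using m B(1) by simp
    then have t: "0 < t" "t \<le> 1" "t * (1 + m * B) = 1"
      by (auto simp: t_def)
    define y where "y = (1 - t) *\<^sub>R ?q + t *\<^sub>R u'"
    have by': "bary ?V y v = (1 - t) * bary ?V ?q v + t * b v" if "v \<in> ?V" for v
      unfolding y_def b_def by (rule bary_affine2[OF Vi qV u'V that])
    have bq: "bary ?V ?q v = 1 / m" if "v \<in> R" for v
    proof -
      have "?q \<in> affine hull R" using qR convex_hull_subset_affine_hull[of R] by auto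
      then have "bary ?V ?q v = bary R ?q v" using bary_subset_eq[OF Vi, of R ?q v] that by auto
      then show ?thesis using bary_bc[OF R_indep R that] by (simp add: m_def)
    qed
    have bqu: "bary ?V ?q u = 0"
      using aff_subset_iff[OF Vi, of R ?q] qR convex_hull_subset_affine_hull[of R] V(3) by auto
    have nonneg: "bary ?V y v \<ge> 0" if v: "v \<in> ?V" for v
    proof (cases "v = u")
      case True
      then show ?thesis using by'[of u] bqu bu t by simp
    next
      case False
      then have vR: "v \<in> R" using v by auto
      have "m * \<bar>b v\<bar> \<le> m * B" using B(2)[OF vR] m by simp
      then have "t * (1 + m * \<bar>b v\<bar>) \<le> t * (1 + m * B)" using t(1) by (intro mult_left_mono) auto
      then have "t * (m * \<bar>b v\<bar>) \<le> 1 - t" using t(3) by (simp add: algebra_simps)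
      moreover have "- (t * (m * b v)) \<le> t * (m * \<bar>b v\<bar>)"
        using t(1) m by (simp add: abs_if mult_nonneg_nonpos)
      ultimately have "0 \<le> (1 - t) + t * (m * b v)" by linarith
      then have "0 \<le> ((1 - t) + t * (m * b v)) / m" using m by simp
      also have "\<dots> = (1 - t) * (1 / m) + t * b v" using m by (simp add: field_simps)
      finally show ?thesis using by'[OF v] bq[OF vR] by simp
    qed
    have "y \<in> affine hull S" unfolding y_def
      using qV u'V affV by (intro mem_affine[OF affine_affine_hull]) auto
    then have yV: "y \<in> convex hull ?V" unfolding in_hull_iff_bary[OF Vi] affV using nonneg by auto
    have "?q \<in> convex hull ?V'" using qR hull_mono[of R ?V' convex] by auto
    moreover have "u' \<in> convex hull ?V'" by (simp add: hull_inc)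
    ultimately have yV': "y \<in> convex hull ?V'" unfolding y_def
      using t by (intro convexD[OF convex_convex_hull]) auto
    \<comment> \<open>The point \<open>y\<close> lies in both simplices, hence in \<open>R\<close>,
      where \<open>side\<close> vanishes; but along the segment \<open>side\<close> is
      \<open>t\<close> times its nonzero value at \<open>u'\<close>.\<close>
    have "?V \<inter> ?V' = R" using neq V by auto
    then have "y \<in> convex hull R" using geo_complexD(5)[OF geo'(1) V(1,2) yV yV'] by simp
    then have y0: "side S R y = 0"
      using side_hull_0[OF S_indep R_fin RaS] convex_hull_subset_affine_hull[of R] by blast
    have "side S R y = (1 - t) * side S R ?q + t * side S R u'"
      unfolding y_def by (rule side_affine2[OF S_indep]) (use qV u'V affV in auto)
    moreover have "side S R ?q = 0"
      using side_hull_0[OF S_indep R_fin RaS] qR convex_hull_subset_affine_hull[of R] by blast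
    ultimately show False using y0 t(1) same by auto
  qed
qed

text \<open>If no facet of \<open>S\<close> contains \<open>R\<close>, the barycenter of
  \<open>R\<close> has only positive coordinates in \<open>S\<close>. There \<open>side\<close>
  vanishes, while it is not 0 at all vertices of \<open>S\<close> since \<open>R\<close> is too
  small to span. So it takes both signs on them, and the link consists of one vertex on each side,
  with opposite signs.\<close>

lemma sum_link_interior:
  assumes nf: "\<And>s. s \<in> S \<Longrightarrow> \<not> R \<subseteq> convex hull (S - {s})"
  shows "(\<Sum>u\<in>link K' S R. sgn (side S R u)) = 0"
proof -
  have "S \<noteq> {}" using card by auto
  then have R: "R \<noteq> {}" using nf by auto
  let ?q = "bc R"
  have qR: "?q \<in> convex hull R" using bc_in_hull[OF R_indep R] .
  have qR': "?q \<in> affine hull R" using qR convex_hull_subset_affine_hull[of R] by auto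
  have RaS: "R \<subseteq> affine hull S" using RS hull_aff by auto
  have qS: "?q \<in> affine hull S" using qR' RaS hull_minimal[of R "affine hull S" affine] by auto
  have m: "real (card R) > 0" using R R_fin by (simp add: card_gt_0_iff)
  have qpos: "bary S ?q s > 0" if s: "s \<in> S" for s
  proof -
    have R0: "\<And>r. r \<in> R \<Longrightarrow> bary S r s \<ge> 0" using RS in_hull_iff_bary[OF S_indep] s by auto
    obtain r where r: "r \<in> R" "r \<notin> convex hull (S - {s})" using nf[OF s] by auto
    then have "bary S r s \<noteq> 0" using hull_subset_iff[OF S_indep, of "S - {s}" r] RS s by auto
    then have "bary S r s > 0" using R0[OF r(1)] by auto
    then have "(\<Sum>r\<in>R. bary S r s) > 0" using R0 r(1) R_fin by (intro sum_pos2[of _ r]) auto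
    moreover have "bary S ?q s = (\<Sum>r\<in>R. bary R ?q r * bary S r s)"
      using bary_affine[OF S_indep R_fin sum_bary[OF R_fin qR'] _ s, of "\<lambda>r. r"] RaS bary_combination[OF R_fin qR'] by auto
    then have "bary S ?q s = (1 / card R) * (\<Sum>r\<in>R. bary S r s)"
      using bary_bc[OF R_indep R] by (simp add: sum_distrib_left)
    ultimately show ?thesis using m by (simp add: zero_less_mult_iff)
  qed
  have "\<not> S \<subseteq> affine hull R" using independent_card_le[OF S_indep _ R_fin] card by auto
  then obtain s0 where s0: "s0 \<in> S" "s0 \<notin> affine hull R" by auto
  have s00: "side S R s0 \<noteq> 0"
    by (rule side_nonzero[OF S_indep affine_independent_insert[OF R_indep s0(2)]])
       (use s0 RaS card hull_inc[of _ R] hull_inc[of _ S] in auto)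
  have sum0: "(\<Sum>s\<in>S. bary S ?q s * side S R s) = 0"
    using side_vertices[OF S_indep, of R ?q] side_hull_0[OF S_indep R_fin RaS qR'] by simp
  have ex: "\<exists>s\<in>S. side S R s * \<sigma> > 0" if \<sigma>: "\<sigma> = 1 \<or> \<sigma> = - 1" for \<sigma> :: real
  proof (rule ccontr)
    assume "\<not> ?thesis"
    then have le: "\<And>s. s \<in> S \<Longrightarrow> side S R s * \<sigma> \<le> 0" by force
    have "(\<Sum>s\<in>S. - (bary S ?q s * (side S R s * \<sigma>))) = - ((\<Sum>s\<in>S. bary S ?q s * side S R s) * \<sigma>)"
      by (simp add: sum_negf sum_distrib_right mult.assoc)
    then have z: "(\<Sum>s\<in>S. - (bary S ?q s * (side S R s * \<sigma>))) = 0" using sum0 by simp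
    have nn: "\<And>s. s \<in> S \<Longrightarrow> 0 \<le> - (bary S ?q s * (side S R s * \<sigma>))"
      using mult_nonneg_nonpos[OF less_imp_le[OF qpos] le] by simp
    have "- (bary S ?q s0 * (side S R s0 * \<sigma>)) = 0"
      using sum_nonneg_eq_0_iff[OF S_fin nn] z s0(1) by simp
    then show False using qpos[OF s0(1)] s00 \<sigma> by auto
  qed
  obtain a where a: "a \<in> S" "side S R a > 0" using ex[of 1] by auto
  obtain b where b: "b \<in> S" "side S R b < 0" using ex[of "-1"] by auto
  obtain u where u: "u \<in> link K' S R" "side S R u > 0"
    using link_exists[OF hull_inc[OF a(1)]] a(2) by (auto simp: zero_less_mult_iff)
  obtain w where w: "w \<in> link K' S R" "side S R w < 0"
    using link_exists[OF hull_inc[OF b(1)]] b(2) by (auto simp: zero_less_mult_iff)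
  have "link K' S R = {u, w}"
  proof
    show "link K' S R \<subseteq> {u, w}"
    proof
      fix x assume x: "x \<in> link K' S R"
      from link_nonzero[OF x] consider "side S R x > 0" | "side S R x < 0" by linarith
      then show "x \<in> {u, w}"
      proof cases
        case 1 then show ?thesis using link_unique[OF x u(1)] u(2) by auto
      next
        case 2 then show ?thesis using link_unique[OF x w(1)] w(2) by (auto simp: zero_less_mult_iff)
      qed
    qed
  qed (use u w in auto)
  moreover have "u \<noteq> w" using u w by auto
  ultimately show ?thesis using u w by simp
qed

text \<open>If \<open>R\<close> lies in the facet opposite \<open>s0\<close>, then
  \<open>side S R\<close> is the coordinate at \<open>s0\<close> times its value at
  \<open>s0\<close>. All of \<open>S\<close> is on one side of \<open>R\<close>, so the link is a
  single vertex, with the sign of \<open>s0\<close>.\<close>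

lemma sum_link_facet:
  assumes s0: "s0 \<in> S" "R \<subseteq> convex hull (S - {s0})"
  shows "(\<Sum>u\<in>link K' S R. sgn (side S R u)) = sg s0 S * sgn (lookup (lam (S - {s0}) (sx R)) (S - {s0}))"
proof -
  let ?V = "S - {s0}"
  have Vi: "\<not> affine_dependent ?V" using affine_independent_subset[OF S_indep] by auto
  have Vfin: "finite ?V" using S_fin by simp
  have RV: "R \<subseteq> affine hull ?V" using s0(2) convex_hull_subset_affine_hull[of ?V] by auto
  have VS: "?V \<subseteq> affine hull S" using hull_inc[of _ S affine] by auto
  obtain xs where xs: "sx R = wl xs" "set xs = R" using sx_eq_wl[OF R_fin] by auto
  have mem: "lam ?V (sx R) \<in> CS (Pow ?V)"
    using lam_sx_mem[OF Vfin R_fin] CS_mono[of "{U. U \<subseteq> ?V \<and> card U = card R}" "Pow ?V"] by auto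
  \<comment> \<open>Coordinates in the facet are coordinates in \<open>S\<close>, so expanding
    \<open>R\<close> in the facet already gives its expansion in \<open>S\<close>.\<close>
  have "lam S (lam ?V (sx R)) = lam S (sx R)"
    unfolding xs(1) by (rule lam_lam_wl[OF Vi S_indep VS]) (use xs RV in auto)
  moreover have "lam S (lam ?V (sx R)) = lam ?V (sx R)"
  proof (rule CS_eq[OF linear_comp[OF linear_lam linear_lam] linear_lam])
    show "sx R \<in> CS {R}" by (simp add: sx_in_CS)
    fix T assume "T \<in> {R}"
    have "lam S (sx U) = sx U" if "U \<subseteq> ?V" for U
      using lam_vertices[OF S_indep, of "srt U"] that finite_subset[OF that Vfin] by (auto simp: wl_srt)
    then have "lam S c = c" if "c \<in> CS (Pow ?V)" for c
      by (intro CS_eq[OF linear_lam linear_ident _ that]) auto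
    then show "lam S (lam ?V (sx T)) = lam ?V (sx T)" using mem \<open>T \<in> {R}\<close> by simp
  qed
  ultimately have lam_eq: "lam S (sx R) = lam ?V (sx R)" by simp
  let ?r = "lookup (lam ?V (sx R)) ?V"
  have r: "?r \<noteq> 0" by (rule lam_nonzero[OF Vi R_indep RV]) (use card s0 S_fin in simp)
  have side_s0: "side S R s0 = sg s0 S * ?r"
    unfolding side_def pw_vertex[OF S_indep s0(1)] lam_eq
    using s0(1) by (simp add: lookup_wdg)
  have side_s: "side S R s = 0" if "s \<in> ?V" for s
  proof -
    have "S - {s} \<notin> Pow ?V" using that s0(1) by auto
    then have "lookup (wdg s (lam ?V (sx R))) S = 0" by (simp add: lookup_wdg CS_lookup[OF mem])
    then show ?thesis unfolding side_def lam_eq using pw_vertex[OF S_indep, of s] that by simp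
  qed
  have side_u: "side S R u = bary S u s0 * side S R s0" for u
  proof -
    have "side S R u = (\<Sum>s\<in>S. bary S u s * side S R s)" by (rule side_vertices[OF S_indep])
    also have "\<dots> = (\<Sum>s\<in>{s0}. bary S u s * side S R s)"
      by (rule sum.mono_neutral_right[OF S_fin]) (use s0 side_s in auto)
    finally show ?thesis by simp
  qed
  have s0n: "side S R s0 \<noteq> 0" using side_s0 r sg_cases[of s0 S] by auto
  have same: "side S R u * side S R s0 > 0" if u: "u \<in> link K' S R" for u
  proof -
    have "bary S u s0 \<ge> 0" using u s0(1) in_hull_iff_bary[OF S_indep, of u] by (auto simp: link_def)
    moreover have "bary S u s0 \<noteq> 0" using link_nonzero[OF u] side_u[of u] by auto
    ultimately have b: "bary S u s0 > 0" by simp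
    have eq: "side S R u * side S R s0 = bary S u s0 * (side S R s0 * side S R s0)"
      by (subst side_u[of u]) (rule mult.assoc)
    have "side S R s0 * side S R s0 > 0" using s0n not_real_square_gt_zero by metis
    then show ?thesis unfolding eq by (rule mult_pos_pos[OF b])
  qed
  obtain u where u: "u \<in> link K' S R" using link_exists[OF hull_inc[OF s0(1)] s0n] by auto
  have "link K' S R = {u}"
  proof
    show "link K' S R \<subseteq> {u}"
    proof
      fix x assume x: "x \<in> link K' S R"
      have "side S R x * side S R u > 0" using same[OF x] same[OF u] by (auto simp: zero_less_mult_iff)
      then show "x \<in> {u}" using link_unique[OF x u] by simp
    qed
  qed (use u in auto)
  moreover have "sgn (side S R u) = sgn (side S R s0)"
    using same[OF u] by (auto simp: zero_less_mult_iff)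
  moreover have "sgn (side S R s0) = sg s0 S * sgn ?r"
    unfolding side_s0 sgn_mult using sg_cases[of s0 S] by auto
  ultimately show ?thesis by simp
qed

text \<open>Two facets would put \<open>R\<close> into the span of fewer vertices than
  \<open>R\<close> has.\<close>

lemma facet_unique:
  assumes "s \<in> S" "R \<subseteq> convex hull (S - {s})" "t \<in> S" "R \<subseteq> convex hull (S - {t})"
  shows "s = t"
proof (rule ccontr)
  assume neq: "s \<noteq> t"
  have "x \<in> affine hull (S - {s, t})" if "x \<in> R" for x
  proof -
    have "bary S x s = 0" "bary S x t = 0"
      using that assms hull_subset_iff[OF S_indep, of "S - {s}" x] hull_subset_iff[OF S_indep, of "S - {t}" x] by auto
    then show ?thesis using aff_subset_iff[OF S_indep, of "S - {s, t}" x] that RS hull_aff by auto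
  qed
  then have "card R \<le> card (S - {s, t})" using independent_card_le[OF R_indep] S_fin by auto
  moreover have "card (S - {s, t}) = card S - 2" using neq assms S_fin by (simp add: card_Diff_subset)
  moreover have "card S \<ge> 2" using neq assms card_mono[OF S_fin, of "{s, t}"] by auto
  ultimately show False using card by simp
qed

text \<open>The two sides are the coefficients at \<open>R\<close> of
  \<open>bd (sd K' (sx S))\<close> and of \<open>sd K' (bd (sx S))\<close>.\<close>

lemma sum_link:
  "(\<Sum>u\<in>link K' S R. sgn (side S R u)) =
   (\<Sum>s\<in>S. if R \<subseteq> convex hull (S - {s}) then sg s S * sgn (lookup (lam (S - {s}) (sx R)) (S - {s})) else 0)"
proof (cases "\<exists>s\<in>S. R \<subseteq> convex hull (S - {s})")
  case True
  then obtain s0 where s0: "s0 \<in> S" "R \<subseteq> convex hull (S - {s0})" by auto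
  have "(\<Sum>s\<in>S. if R \<subseteq> convex hull (S - {s}) then sg s S * sgn (lookup (lam (S - {s}) (sx R)) (S - {s})) else 0)
     = (\<Sum>s\<in>S. if s = s0 then sg s S * sgn (lookup (lam (S - {s}) (sx R)) (S - {s})) else 0)"
    by (intro sum.cong refl if_cong) (use s0 facet_unique in auto)
  then show ?thesis using sum_link_facet[OF s0] s0(1) S_fin by simp
next
  case False then show ?thesis using sum_link_interior by simp
qed

end

lemma lookup_sd:
  assumes "finite K'"
  shows "lookup (sd K' (sx S)) R = (if R \<in> sdset K' S then sgn (lookup (lam S (sx R)) S) else 0)"
proof -
  have fin: "finite (sdset K' S)" using assms by (simp add: sdset_def)
  have "lookup (sd K' (sx S)) R = (\<Sum>T\<in>sdset K' S. if T = R then sgn (lookup (lam S (sx R)) S) else 0)"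
    by (simp add: sd_sx lookup_sum lookup_sx) (intro sum.cong, auto)
  then show ?thesis using fin by simp
qed

lemma lookup_bd_insert:
  assumes "finite R" "u \<notin> R"
  shows "lookup (bd (sx (insert u R))) R = sg u R"
proof -
  have "lookup (bd (sx (insert u R))) R = (\<Sum>v\<in>insert u R. if v = u then sg u R else 0)"
    unfolding bd_sx by (simp only: lookup_sum lookup_scaleR lookup_sx)
      (intro sum.cong refl, use assms in \<open>auto simp: sg_insert\<close>)
  then show ?thesis using assms(1) by simp
qed

text \<open>Compared coefficient by coefficient. Where \<open>R\<close> is a codimension one simplex
  of the subdivided \<open>S\<close> this is \<open>sum_link\<close>; elsewhere both coefficients
  are 0.\<close>

lemma sd_bd:
  assumes sub: "subdv K' K" and S: "S \<in> K"
  shows "bd (sd K' (sx S)) = sd K' (bd (sx S))"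
proof (rule poly_mapping_eqI)
  fix R
  have K': "geo_complex K'" "geo_complex K" using sub by (auto simp: subdv_def)
  have finK': "finite K'" using geo_complexD(1)[OF K'(1)] .
  have finS: "finite S" using geo_complexD(6)[OF K'(2) S] .
  have finsd: "finite (sdset K' S)" using finK' by (simp add: sdset_def)
  let ?f = "\<lambda>T. sgn (lookup (lam S (sx T)) S) * lookup (bd (sx T)) R"
  have lhs: "lookup (bd (sd K' (sx S))) R = (\<Sum>T\<in>sdset K' S. ?f T)"
    by (simp add: sd_sx lookup_sum)
  have rhs: "lookup (sd K' (bd (sx S))) R =
      (\<Sum>s\<in>S. if R \<in> sdset K' (S - {s}) then sg s S * sgn (lookup (lam (S - {s}) (sx R)) (S - {s})) else 0)"
    unfolding bd_sx
    by (simp add: linear_sum[OF linear_sd] linear_scale[OF linear_sd] lookup_sum lookup_sd[OF finK'] if_distrib cong: if_cong)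
  show "lookup (bd (sd K' (sx S))) R = lookup (sd K' (bd (sx S))) R"
  proof (cases "R \<in> K' \<and> R \<subseteq> convex hull S \<and> card S = Suc (card R)")
    case True
    then have R: "R \<in> K'" "R \<subseteq> convex hull S" "card S = Suc (card R)" by auto
    have finR: "finite R" using geo_complexD(6)[OF K'(1) R(1)] .
    have img: "(\<lambda>u. insert u R) ` link K' S R \<subseteq> sdset K' S"
      using R finR by (auto simp: link_def sdset_def)
    have inj: "inj_on (\<lambda>u. insert u R) (link K' S R)" by (rule inj_onI) (auto simp: link_def)
    have "(\<Sum>T\<in>sdset K' S. ?f T) = (\<Sum>T\<in>(\<lambda>u. insert u R) ` link K' S R. ?f T)"
    proof (rule sum.mono_neutral_right[OF finsd img], rule ballI)
      fix T assume T: "T \<in> sdset K' S - (\<lambda>u. insert u R) ` link K' S R"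
      have "lookup (bd (sx T)) R = 0"
      proof (rule ccontr)
        assume "lookup (bd (sx T)) R \<noteq> 0"
        then obtain u where "u \<notin> R" "T = insert u R" using lookup_bd_cases[of T R] by auto
        then show False using T by (auto simp: link_def sdset_def)
      qed
      then show "?f T = 0" by simp
    qed
    also have "\<dots> = (\<Sum>u\<in>link K' S R. ?f (insert u R))" by (simp add: sum.reindex[OF inj])
    also have "\<dots> = (\<Sum>u\<in>link K' S R. sgn (side S R u))"
    proof (intro sum.cong refl)
      fix u assume "u \<in> link K' S R"
      then have u: "u \<notin> R" by (simp add: link_def)
      have "side S R u = sg u R * lookup (lam S (sx (insert u R))) S"
        unfolding side_wdg[OF finR] using u by (simp add: wdg_sx)
      then show "?f (insert u R) = sgn (side S R u)"
        unfolding lookup_bd_insert[OF finR u] using sg_cases[of u R] by (auto simp: sgn_mult)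
    qed
    also have "\<dots> = (\<Sum>s\<in>S. if R \<subseteq> convex hull (S - {s}) then sg s S * sgn (lookup (lam (S - {s}) (sx R)) (S - {s})) else 0)"
      by (rule sum_link[OF sub S R])
    also have "\<dots> = lookup (sd K' (bd (sx S))) R"
      unfolding rhs using R finS by (intro sum.cong refl if_cong) (auto simp: sdset_def)
    finally show ?thesis unfolding lhs .
  next
    case False
    have f0: "?f T = 0" if T: "T \<in> sdset K' S" for T
    proof (rule ccontr)
      assume "?f T \<noteq> 0"
      then have "lookup (bd (sx T)) R \<noteq> 0" by auto
      then obtain u where u: "u \<notin> R" "T = insert u R" using lookup_bd_cases[of T R] by auto
      have "T \<in> K'" "T \<subseteq> convex hull S" "card T = card S" using T by (auto simp: sdset_def)
      moreover from this have "finite R" "R \<in> K'" using u geo_complexD(4,6)[OF K'(1)] by auto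
      ultimately show False using False u by auto
    qed
    have r0: "R \<notin> sdset K' (S - {s})" if s: "s \<in> S" for s
    proof
      assume R: "R \<in> sdset K' (S - {s})"
      have "convex hull (S - {s}) \<subseteq> convex hull S" by (rule hull_mono) auto
      moreover have "card S = Suc (card (S - {s}))" using card_Suc_Diff1[OF finS s] by simp
      ultimately show False using R False by (auto simp: sdset_def)
    qed
    have "(\<Sum>T\<in>sdset K' S. ?f T) = 0" by (rule sum.neutral) (use f0 in blast)
    then show ?thesis unfolding lhs rhs using r0 by simp
  qed
qed

lemma chain_map_sd: "subdv K' K \<Longrightarrow> chain_map K K' (sd K')"
  using sd_sx_mem[of K'] CS_mono[of "sdset K' _" K'] sd_bd
  by (intro chain_mapI) (auto simp: sdset_def subset_eq)

lemma graded_sd: "graded K (sd K')"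
  using sd_sx_mem[of K'] CS_mono[of "sdset K' _" "{T. card T = card _}"]
  by (auto simp: graded_def sdset_def subset_eq)

text \<open>The complex that subdivides the closed simplex \<open>S\<close>: the acyclic carrier for
  \<open>sd K'\<close> and for the maps compared with it.\<close>

definition inside :: "'a::euclidean_space set set \<Rightarrow> 'a set \<Rightarrow> 'a set set" where
  "inside K' S = {T \<in> K'. T \<subseteq> convex hull S}"

lemma sd_sx_inside: "sd K' (sx S) \<in> CS (inside K' S)"
  using sd_sx_mem[of K' S] CS_mono[of "sdset K' S" "inside K' S"] by (auto simp: sdset_def inside_def)

lemma inside_mono: "S \<subseteq> T \<Longrightarrow> inside K' S \<subseteq> inside K' T"
  using hull_mono[of S T convex] by (auto simp: inside_def)

lemma geo_inside: "geo_complex K' \<Longrightarrow> geo_complex (inside K' S)"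
  unfolding geo_complex_def inside_def by (auto 0 3)

lemma polyh_inside:
  assumes "subdv K' K" "S \<in> K" shows "polyh (inside K' S) = convex hull S"
proof
  show "polyh (inside K' S) \<subseteq> convex hull S"
    unfolding polyh_def inside_def using hull_minimal[of _ "convex hull S" convex] by auto
  show "convex hull S \<subseteq> polyh (inside K' S)"
    using subdv_cover[OF assms] by (auto simp: polyh_def inside_def)
qed

section \<open>Acyclicity of subdivided convex sets\<close>

text \<open>The carrier of \<open>S\<close> is the full simplex spanned by its two images together,
  which contiguity places in \<open>L\<close>.\<close>

lemma homotopic_contiguous:
  assumes K: "set_complex K" and L: "set_complex L" and ab: "\<And>S. S \<in> K \<Longrightarrow> a ` S \<union> b ` S \<in> L"
  shows "chain_homotopic K L (push a) (push b)"
proof (rule acyclic_carrier[OF K, of "\<lambda>S. Pow (a ` S \<union> b ` S)"])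
  fix S assume S: "S \<in> K"
  have fin: "finite S" using set_complexD(3)[OF K S] .
  show "Pow (a ` S \<union> b ` S) \<subseteq> L" using set_complexD(4)[OF L ab[OF S]] by auto
  show "push a (sx S) \<in> CS (Pow (a ` S \<union> b ` S))" "push b (sx S) \<in> CS (Pow (a ` S \<union> b ` S))"
    using push_sx_mem[OF fin] CS_mono[of "{a ` S}" "Pow (a ` S \<union> b ` S)"] CS_mono[of "{b ` S}" "Pow (a ` S \<union> b ` S)"]
    by auto
  show "set_complex (Pow (a ` S \<union> b ` S))" using fin by (intro set_complex_Pow) auto
  show "acyclic_complex (Pow (a ` S \<union> b ` S))" if "S \<noteq> {}" using fin that by (intro acyclic_Pow) auto
  show "Pow (a ` T \<union> b ` T) \<subseteq> Pow (a ` S \<union> b ` S)" if "T \<subseteq> S" for T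
    by (intro Pow_mono Un_mono image_mono that)
next
  fix c assume "c \<in> CS K"
  then have "c \<in> FC" using set_complex_FC[OF K] by simp
  then show "bd (push a c) = push a (bd c)" "bd (push b c) = push b (bd c)" by (simp_all add: push_bd)
qed simp_all

text \<open>Over the subdivision operator a simplicial approximation of the identity is a left inverse: the
  chain group of a simplex is one-dimensional in top degree and its boundary operator is injective there.\<close>

lemma push_sd_id:
  assumes sub: "subdv K' K" and \<theta>: "\<And>v. {v} \<in> K' \<Longrightarrow> \<theta> v \<in> car K v" and c: "c \<in> CS K"
  shows "push \<theta> (sd K' c) = c"
proof (rule CS_eq[OF linear_comp[OF linear_push linear_sd] linear_ident _ c])
  have K: "geo_complex K'" "geo_complex K" "polyh K' = polyh K" using sub by (auto simp: subdv_def)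
  fix S assume "S \<in> K"
  then show "push \<theta> (sd K' (sx S)) = sx S"
  proof (induction "card S" arbitrary: S)
    case 0
    then have "S = {}" using geo_complexD(6)[OF K(2)] by auto
    then show ?case by (simp add: sd_sx_empty[OF K(1)])
  next
    case (Suc n)
    have finS: "finite S" using geo_complexD(6)[OF K(2) Suc.prems] .
    let ?c = "push \<theta> (sd K' (sx S))"
    have "push \<theta> (sx T) \<in> CS {S}" if T: "T \<in> sdset K' S" for T
    proof -
      have T': "T \<in> K'" "T \<subseteq> convex hull S" "card T = card S" using T by (auto simp: sdset_def)
      have finT: "finite T" using geo_complexD(6)[OF K(1) T'(1)] .
      have "\<theta> v \<in> S" if v: "v \<in> T" for v
      proof -
        have vS: "v \<in> convex hull S" using T'(2) v by auto
        have "{v} \<in> K'" using geo_complexD(4)[OF K(1) T'(1), of "{v}"] v by auto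
        then show ?thesis
          using \<theta>[of v] car_subset[OF K(2) polyhI[OF Suc.prems vS] Suc.prems vS] by auto
      qed
      then have sub': "\<theta> ` T \<subseteq> S" by auto
      have "graded {T} (push \<theta>)" using finT by (intro graded_push) auto
      then have "push \<theta> (sx T) \<in> CS {U. card U = card S}" using T'(3) by (simp add: graded_def)
      then have k2: "keys (push \<theta> (sx T)) \<subseteq> {U. card U = card S}" by (simp only: CS_iff)
      have k1: "keys (push \<theta> (sx T)) \<subseteq> {\<theta> ` T}"
        using push_sx_mem[OF finT, of \<theta>] by (simp only: CS_iff)
      have "U = S" if U: "U \<in> keys (push \<theta> (sx T))" for U
      proof -
        have "U = \<theta> ` T" "card U = card S" using subsetD[OF k1 U] subsetD[OF k2 U] by simp_all
        then show ?thesis using card_subset_eq[OF finS sub'] by simp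
      qed
      then show ?thesis unfolding CS_iff by auto
    qed
    then have mem: "?c \<in> CS {S}" by (intro CS_image[OF linear_push _ subspace_CS sd_sx_mem]) auto
    define r where "r = lookup ?c S"
    have c: "?c = r *\<^sub>R sx S" unfolding r_def using chn_expand[of "{S}" ?c] mem by (simp add: CS_iff)
    have "bd ?c = push \<theta> (bd (sd K' (sx S)))"
    proof (rule push_bd)
      have "sd K' (sx S) \<in> CS K'" using chain_mapD(2)[OF chain_map_sd[OF sub] sx_in_CS[OF Suc.prems]] .
      then show "sd K' (sx S) \<in> FC" using set_complex_FC[OF geo_set_complex[OF K(1)]] by simp
    qed
    also have "\<dots> = push \<theta> (sd K' (bd (sx S)))" by (simp add: sd_bd[OF sub Suc.prems])
    also have "\<dots> = bd (sx S)"
    proof (rule CS_eq[OF linear_comp[OF linear_push linear_sd] linear_ident])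
      show "bd (sx S) \<in> CS ((\<lambda>v. S - {v}) ` S)" unfolding bd_sx by (intro CS_sum CS_scale sx_in_CS) auto
      fix T assume "T \<in> (\<lambda>v. S - {v}) ` S"
      then obtain v where v: "v \<in> S" "T = S - {v}" by auto
      have "T \<in> K" using geo_complexD(4)[OF K(2) Suc.prems, of T] v by auto
      moreover have "n = card T" using card_Suc_Diff1[OF finS v(1)] Suc.hyps(2) v(2) by simp
      ultimately show "push \<theta> (sd K' (sx T)) = sx T" using Suc.hyps(1) by simp
    qed
    finally have bdc: "r *\<^sub>R bd (sx S) = bd (sx S)" unfolding c by simp
    obtain v where v: "v \<in> S" using Suc.hyps(2) by fastforce
    have "lookup (bd (sx S)) (S - {v}) = sg v (S - {v})"
      using lookup_bd_insert[of "S - {v}" v] finS v by (simp add: insert_absorb)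
    moreover have "r * lookup (bd (sx S)) (S - {v}) = lookup (bd (sx S)) (S - {v})"
      using arg_cong[OF bdc, of "\<lambda>c. lookup c (S - {v})"] by simp
    ultimately have "r = 1" using sg_cases[of v "S - {v}"] by auto
    then show ?case using c by simp
  qed
qed

text \<open>Contract the convex set to a point in steps so small that approximations of successive maps are
  contiguous.  This connects the identity of the chain complex to a constant map.\<close>

theorem acyclic_convex:
  assumes P: "geo_complex P" and conv: "convex (polyh P)" and ne: "polyh P \<noteq> {}"
  shows "acyclic_complex P"
proof -
  obtain x0 where x0: "x0 \<in> polyh P" using ne by auto
  obtain \<epsilon> v where \<epsilon>: "\<epsilon> > 0" and v: "\<And>x y. x \<in> polyh P \<Longrightarrow> y \<in> polyh P \<Longrightarrow> dist x y < \<epsilon> \<Longrightarrow> v x \<in> car P y"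
    using star_Lebesgue[OF P] by metis
  \<comment> \<open>Two displacements must add up to less than \<open>\<epsilon>\<close>: the one
    inside a simplex of \<open>Q\<close> and the one from a time to the next. Each gets
    \<open>\<epsilon> / 3\<close>.\<close>
  obtain Q where Q: "subdv Q P" "mesh Q (\<epsilon> / 3)" using ex_fine_subdivision[OF P, of "\<epsilon> / 3"] \<epsilon> by auto
  have gQ: "geo_complex Q" "polyh Q = polyh P" using Q(1) by (auto simp: subdv_def)
  obtain D where D: "\<And>x. x \<in> polyh P \<Longrightarrow> dist x0 x \<le> D"
    using compact_imp_bounded[OF compact_polyh[OF P]] unfolding bounded_def
    by (metis bounded_any_center bounded_def)
  have D0: "D \<ge> 0" using D[OF x0] by simp
  \<comment> \<open>The number of time steps, so large that each of them moves every point by less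
    than \<open>\<epsilon> / 3\<close>.\<close>
  obtain m :: nat where m: "real m > 3 * (D + 1) / \<epsilon>" using reals_Archimedean2 by blast
  have m0: "m > 0" using m D0 \<epsilon> by (metis divide_nonneg_pos gr0I less_eq_real_def less_le_not_le mult_nonneg_nonneg of_nat_0 add_nonneg_nonneg zero_le_numeral zero_le_one)
  have mD: "D / real m < \<epsilon> / 3" using m m0 D0 \<epsilon> by (simp add: field_simps)
  define f where "f j x = (1 - real j / real m) *\<^sub>R x + (real j / real m) *\<^sub>R x0" for j :: nat and x
  define a where "a j x = v (f j x)" for j x
  define \<phi> where "\<phi> j c = push (a j) (sd Q c)" for j c
  have fP: "f j x \<in> polyh P" if "x \<in> polyh P" "j \<le> m" for j x
    unfolding f_def by (rule convexD[OF conv that(1) x0]) (use that(2) m0 in \<open>auto simp: divide_le_eq\<close>)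
  have close: "a j ` T \<union> a (Suc j) ` T \<in> P" if j: "Suc j \<le> m" and T: "T \<in> Q" for j T
  proof (cases "T = {}")
    case True then show ?thesis using geo_complexD(2)[OF P] by simp
  next
    case False
    then obtain x where x: "x \<in> T" by auto
    have TP: "y \<in> polyh P" if "y \<in> T" for y using polyhI[OF T hull_inc[OF that]] gQ(2) by simp
    let ?p = "f j x"
    have p: "?p \<in> polyh P" using fP[OF TP[OF x]] j by simp
    have d1: "dist (f j y) ?p < \<epsilon> / 3" if y: "y \<in> T" for y
    proof -
      have "f j y - ?p = (1 - real j / real m) *\<^sub>R (y - x)" by (simp add: f_def algebra_simps)
      then have "dist (f j y) ?p = \<bar>1 - real j / real m\<bar> * dist y x" by (simp add: dist_norm)
      also have "\<dots> \<le> 1 * dist y x" using j m0 by (intro mult_right_mono) (auto simp: abs_le_iff divide_le_eq)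
      also have "\<dots> < \<epsilon> / 3" using Q(2) T hull_inc[OF y] hull_inc[OF x] by (auto simp: mesh_def)
      finally show ?thesis .
    qed
    have d2: "dist (f (Suc j) y) (f j y) < \<epsilon> / 3" if y: "y \<in> T" for y
    proof -
      have "real (Suc j) / real m = real j / real m + 1 / real m" by (simp add: add_divide_distrib)
      then have "f (Suc j) y - f j y = (1 / real m) *\<^sub>R (x0 - y)" by (simp add: f_def algebra_simps)
      then have "dist (f (Suc j) y) (f j y) = dist x0 y / real m" by (simp add: dist_norm divide_inverse mult.commute)
      also have "\<dots> \<le> D / real m" using D[OF TP[OF y]] by (intro divide_right_mono) auto
      finally show ?thesis using mD by linarith
    qed
    have "a j y \<in> car P ?p \<and> a (Suc j) y \<in> car P ?p" if y: "y \<in> T" for y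
    proof
      show "a j y \<in> car P ?p" unfolding a_def
        using d1[OF y] \<epsilon> j by (intro v fP TP y p) auto
      have "dist (f (Suc j) y) ?p < \<epsilon>"
        using d1[OF y] d2[OF y] dist_triangle[of "f (Suc j) y" ?p "f j y"] \<epsilon> by linarith
      then show "a (Suc j) y \<in> car P ?p" unfolding a_def using j by (intro v fP TP y p)
    qed
    \<comment> \<open>One point \<open>?p\<close> has all values of both vertex maps in its carrier,
      which is contiguity on \<open>T\<close>.\<close>
    then have "a j ` T \<union> a (Suc j) ` T \<subseteq> car P ?p" by auto
    then show ?thesis using geo_complexD(4)[OF P car_in[OF P p]] by simp
  qed
  have step: "chain_homotopic P P (\<phi> j) (\<phi> (Suc j))" if "Suc j \<le> m" for j
    unfolding \<phi>_def
    by (rule homotopic_pre[OF chain_map_sd[OF Q(1)] homotopic_contiguous[OF geo_set_complex[OF gQ(1)] geo_set_complex[OF P] close[OF that]]])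
  have "chain_homotopic P P (\<phi> 0) (\<phi> j)" if "j \<le> m" for j
    using that
  proof (induction j)
    case 0 show ?case by (rule homotopic_eq) simp
  next
    case (Suc j) then show ?case using homotopic_trans step by (metis Suc_leD)
  qed
  then have hm: "chain_homotopic P P (\<phi> 0) (\<phi> m)" by simp
  \<comment> \<open>At time 0 the vertex map approximates the identity, and over \<open>sd Q\<close>
    such a map is a left inverse on the nose.\<close>
  have \<phi>0: "\<phi> 0 c = c" if "c \<in> CS P" for c
    unfolding \<phi>_def
  proof (rule push_sd_id[OF Q(1) _ that])
    fix w assume "{w} \<in> Q"
    then have "w \<in> polyh P" using polyhI[of "{w}" Q w] gQ(2) by simp
    then show "a 0 w \<in> car P w" unfolding a_def using \<epsilon> by (intro v) (auto simp: f_def)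
  qed
  define c where "c = v x0"
  have am: "a m = (\<lambda>_. c)" using m0 by (auto simp: a_def f_def c_def)
  have cP: "{c} \<in> P" using v[OF x0 x0] \<epsilon> geo_complexD(4)[OF P car_in[OF P x0], of "{c}"] by (simp add: c_def)
  have cPow: "Pow {c} \<subseteq> P" using geo_complexD(4)[OF P cP] by blast
  show ?thesis
    unfolding acyclic_complex_def
  proof (intro ballI impI)
    fix z assume z: "z \<in> CS P" "bd z = 0"
    obtain H where H: "linear H" "\<And>c. c \<in> CS P \<Longrightarrow> H c \<in> CS P \<and> bd (H c) + H (bd c) = \<phi> 0 c - \<phi> m c"
      using hm unfolding chain_homotopic_def by metis
    have Hz: "H z \<in> CS P" "bd (H z) = z - \<phi> m z"
      using H(2)[OF z(1)] z(2) linear_0[OF H(1)] \<phi>0[OF z(1)] by auto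
    have sdz: "sd Q z \<in> CS Q" "bd (sd Q z) = sd Q (bd z)" using chain_mapD(2,3)[OF chain_map_sd[OF Q(1)] z(1)] by auto
    have "push (\<lambda>_. c) (sx T) \<in> CS (Pow {c})" if "T \<in> Q" for T
      using push_sx_mem[OF geo_complexD(6)[OF gQ(1) that], of "\<lambda>_. c"] CS_mono[of "{(\<lambda>_. c) ` T}" "Pow {c}"] by auto
    \<comment> \<open>The cycle \<open>z\<close> differs by a boundary from its image under the
      constant map, which is a cycle on the single vertex \<open>c\<close> and can be filled
      there.\<close>
    then have w: "\<phi> m z \<in> CS (Pow {c})"
      unfolding \<phi>_def am by (intro CS_image[OF linear_push _ subspace_CS sdz(1)]) auto
    have "bd (\<phi> m z) = push (a m) (bd (sd Q z))"
      unfolding \<phi>_def by (rule push_bd[OF set_complex_FC[OF geo_set_complex[OF gQ(1)] sdz(1)]])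
    then have "bd (\<phi> m z) = 0" using sdz(2) z(2) by (simp add: linear_0[OF linear_sd])
    then obtain y where y: "y \<in> CS (Pow {c})" "bd y = \<phi> m z"
      using w acyclic_Pow[of "{c}"] unfolding acyclic_complex_def by blast
    have "y \<in> CS P" using y(1) CS_mono[OF cPow] by auto
    then show "\<exists>y\<in>CS P. bd y = z" using Hz y(2) by (intro bexI[of _ "H z + y"]) (auto intro: CS_add)
  qed
qed

lemma acyclic_inside:
  assumes "subdv K' K" "S \<in> K" "S \<noteq> {}" shows "acyclic_complex (inside K' S)"
proof (rule acyclic_convex)
  show "geo_complex (inside K' S)" using assms(1) geo_inside by (auto simp: subdv_def)
  show "convex (polyh (inside K' S))" "polyh (inside K' S) \<noteq> {}"
    using polyh_inside[OF assms(1,2)] assms(3) by simp_all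
qed

section \<open>Functoriality up to homotopy and the Lefschetz number of a polyhedron\<close>

lemma subdvD:
  assumes "subdv K' K" shows "geo_complex K'" "geo_complex K" "polyh K' = polyh K"
  using assms by (auto simp: subdv_def)

lemma car_vertex: "geo_complex K \<Longrightarrow> T \<in> K \<Longrightarrow> v \<in> T \<Longrightarrow> car K v = {v}"
  using geo_complexD(4)[of K T "{v}"] bary_vertex[of "{v}" v v] by (intro car_eqI) auto

lemma homotopic_carried_inside:
  assumes sub: "subdv K1 K"
    and \<phi>: "chain_map K K1 \<phi>" "\<And>S. S \<in> K \<Longrightarrow> \<phi> (sx S) \<in> CS (inside K1 S)"
    and \<psi>: "chain_map K K1 \<psi>" "\<And>S. S \<in> K \<Longrightarrow> \<psi> (sx S) \<in> CS (inside K1 S)"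
    and augment: "\<phi> (sx {}) = \<psi> (sx {})"
  shows "chain_homotopic K K1 \<phi> \<psi>"
proof (rule acyclic_carrier[where \<Phi> = "inside K1"])
  show "set_complex K" using geo_set_complex[OF subdvD(2)[OF sub]] .
  show "inside K1 S \<subseteq> K1" for S by (auto simp: inside_def)
  show "set_complex (inside K1 S)" for S using geo_set_complex[OF geo_inside[OF subdvD(1)[OF sub]]] .
  show "acyclic_complex (inside K1 S)" if "S \<in> K" "S \<noteq> {}" for S using acyclic_inside[OF sub that] .
  show "inside K1 T \<subseteq> inside K1 S" if "T \<subseteq> S" for S T using inside_mono[OF that] .
qed (use \<phi> \<psi> augment chain_mapD[OF \<phi>(1)] chain_mapD[OF \<psi>(1)] in auto)

lemma chain_map_push_appr:
  assumes "appr K L f a" "geo_complex K" "geo_complex L" shows "chain_map K L (push a)"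
  by (rule chain_map_push[OF geo_set_complex[OF assms(2)] appr_simplicial[OF assms]])

text \<open>The chain map \<open>push a \<circ> sd K'\<close> of a simplicial approximation \<open>a\<close> defined on the subdivision
  \<open>K'\<close>.\<close>

definition amap :: "'a::euclidean_space set set \<Rightarrow> ('a \<Rightarrow> 'b) \<Rightarrow> 'a chn \<Rightarrow> 'b chn" where
  "amap K' a c = push a (sd K' c)"

lemma chain_map_amap:
  assumes "subdv K' K" "appr K' L f a" "geo_complex L" shows "chain_map K L (amap K' a)"
  unfolding amap_def using chain_map_comp[OF chain_map_sd[OF assms(1)] chain_map_push_appr[OF assms(2) subdvD(1)[OF assms(1)] assms(3)]] .

lemma graded_amap:
  assumes "subdv K' K" shows "graded K (amap K' a)"
  unfolding amap_def
  by (rule graded_comp[OF graded_sd graded_push chain_map_sd[OF assms] linear_push])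
     (rule geo_complexD(6)[OF subdvD(1)[OF assms]])

lemma ex_approximation2:
  assumes K: "geo_complex K"
    and L: "geo_complex L" "continuous_on (polyh K) f" "f ` polyh K \<subseteq> polyh L"
    and M: "geo_complex M" "continuous_on (polyh K) g" "g ` polyh K \<subseteq> polyh M"
  shows "\<exists>K' a b. subdv K' K \<and> appr K' L f a \<and> appr K' M g b"
proof -
  obtain \<delta> where \<delta>: "\<delta> > 0" "\<And>K'. geo_complex K' \<Longrightarrow> polyh K' = polyh K \<Longrightarrow> mesh K' \<delta> \<Longrightarrow> \<exists>a. appr K' L f a"
    using ex_approximation[OF K L] by blast
  obtain \<eta> where \<eta>: "\<eta> > 0" "\<And>K'. geo_complex K' \<Longrightarrow> polyh K' = polyh K \<Longrightarrow> mesh K' \<eta> \<Longrightarrow> \<exists>b. appr K' M g b"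
    using ex_approximation[OF K M] by blast
  obtain K' where K': "subdv K' K" "mesh K' (min \<delta> \<eta>)"
    using ex_fine_subdivision[OF K, of "min \<delta> \<eta>"] \<delta>(1) \<eta>(1) by auto
  have "mesh K' \<delta>" "mesh K' \<eta>" using K'(2) by (auto simp: mesh_def)
  then show ?thesis using K'(1) \<delta>(2) \<eta>(2) subdvD(1,3)[OF K'(1)] by blast
qed

text \<open>Any choice of a vertex in each carrier works: a vertex of \<open>car K' x\<close> lies
  in the closed carrier of \<open>x\<close> in \<open>K\<close>, so its own carrier is contained in
  the latter.\<close>

lemma ex_appr_id:
  assumes sub: "subdv K' K" shows "\<exists>\<theta>. appr K' K (\<lambda>x. x) \<theta>"
proof -
  note K = subdvD[OF sub]
  have "\<forall>v\<in>polyh K. \<exists>w. w \<in> car K v" using car_nonempty[OF K(2)] by auto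
  then obtain \<theta> where \<theta>: "\<And>v. v \<in> polyh K \<Longrightarrow> \<theta> v \<in> car K v" by metis
  have "\<theta> w \<in> car K x" if x: "x \<in> polyh K" and w: "w \<in> car K' x" for x w
  proof -
    have wh: "w \<in> convex hull (car K x)" using subdv_car[OF sub x] w by auto
    have "w \<in> polyh K" using polyhI[OF car_in[OF K(2) x] wh] .
    then show ?thesis using \<theta> car_mono[OF K(2) x wh] by auto
  qed
  then show ?thesis unfolding appr_def using K(3) by auto
qed

text \<open>In the order opposite to \<open>push_sd_id\<close> the composite is only homotopic to
  the identity. A simplex \<open>T\<close> is carried by the subdivision of the smallest simplex of
  \<open>K\<close> around it, found as the carrier of its barycenter. The empty set, which has no
  barycenter, is carried by itself.\<close>

lemma homotopic_sd_push:
  assumes sub: "subdv K' K" and \<theta>: "appr K' K (\<lambda>x. x) \<theta>"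
  shows "chain_homotopic K' K' (\<lambda>c. sd K' (push \<theta> c)) (\<lambda>c. c)"
proof -
  note K = subdvD[OF sub]
  define \<Phi> where "\<Phi> T = (if T = {} then {{}} else inside K' (car K (bc T)))" for T
  have bcK: "bc T \<in> polyh K" if "T \<in> K'" "T \<noteq> {}" for T
    using bc_polyh[OF K(1) that] K(3) by simp
  have TC: "T \<subseteq> convex hull (car K (bc T))" if "T \<in> K'" "T \<noteq> {}" for T
    using subdv_car[OF sub bcK[OF that]] car_bc[OF K(1) that] by simp
  have cm: "chain_map K' K' (\<lambda>c. sd K' (push \<theta> c))"
    by (rule chain_map_comp[OF chain_map_push_appr[OF \<theta> K(1,2)] chain_map_sd[OF sub]])
  show ?thesis
  proof (rule acyclic_carrier[OF geo_set_complex[OF K(1)], of \<Phi>])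
    fix S assume S: "S \<in> K'"
    show "\<Phi> S \<subseteq> K'" using geo_complexD(2)[OF K(1)] by (auto simp: \<Phi>_def inside_def)
    show "set_complex (\<Phi> S)" if "S \<noteq> {}" using that geo_set_complex[OF geo_inside[OF K(1)]] by (simp add: \<Phi>_def)
    show "acyclic_complex (\<Phi> S)" if "S \<noteq> {}"
      using that acyclic_inside[OF sub car_in[OF K(2) bcK[OF S that]] car_nonempty[OF K(2) bcK[OF S that]]]
      by (simp add: \<Phi>_def)
    show "\<Phi> T \<subseteq> \<Phi> S" if T: "T \<subseteq> S" for T
    proof (cases "T = {}")
      case True
      then show ?thesis using geo_complexD(2)[OF K(1)] by (auto simp: \<Phi>_def inside_def)
    next
      case False
      have S0: "S \<noteq> {}" and TK: "T \<in> K'" using False T geo_complexD(4)[OF K(1) S] by auto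
      have "T \<subseteq> convex hull (car K (bc S))" using TC[OF S S0] T by auto
      then have "bc T \<in> convex hull (car K (bc S))"
        using bc_in_hull[OF geo_complexD(3)[OF K(1) TK] False] hull_minimal[of T "convex hull (car K (bc S))" convex] by auto
      then have "car K (bc T) \<subseteq> car K (bc S)" using car_mono[OF K(2) bcK[OF S S0]] by simp
      then show ?thesis using False S0 inside_mono by (simp add: \<Phi>_def)
    qed
    show "sx S \<in> CS (\<Phi> S)"
      using S TC[OF S] by (intro sx_in_CS) (auto simp: \<Phi>_def inside_def)
    show "sd K' (push \<theta> (sx S)) \<in> CS (\<Phi> S)"
    proof (cases "S = {}")
      case True then show ?thesis by (simp add: sd_sx_empty[OF K(1)] \<Phi>_def sx_in_CS)
    next
      case False
      have "\<theta> ` S \<subseteq> car K (bc S)"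
        using \<theta> bcK[OF S False] car_bc[OF K(1) S False] K(3) by (auto simp: appr_def)
      then have "CS (inside K' (\<theta> ` S)) \<subseteq> CS (\<Phi> S)"
        using False inside_mono by (intro CS_mono) (simp add: \<Phi>_def)
      moreover have "sd K' (push \<theta> (sx S)) \<in> CS (inside K' (\<theta> ` S))"
        by (rule CS_image[OF linear_sd _ subspace_CS push_sx_mem[OF geo_complexD(6)[OF K(1) S]]])
           (auto intro: sd_sx_inside)
      ultimately show ?thesis by auto
    qed
  next
    show "sd K' (push \<theta> (sx {})) = sx {}" by (simp add: sd_sx_empty[OF K(1)])
  qed (use chain_mapD[OF cm] linear_ident in auto)
qed

text \<open>\<open>K3\<close> need not subdivide \<open>K1\<close>; \<open>\<alpha>\<close> merely
  approximates the identity of their common polyhedron. Still, both maps keep every simplex of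
  \<open>K\<close> inside its own subdivision in \<open>K1\<close>.\<close>

lemma homotopic_amap_sd:
  assumes sub3: "subdv K3 K" and sub1: "subdv K1 K" and \<alpha>: "appr K3 K1 (\<lambda>x. x) \<alpha>"
  shows "chain_homotopic K K1 (amap K3 \<alpha>) (sd K1)"
proof (rule homotopic_carried_inside[OF sub1])
  note K = subdvD(2)[OF sub1] and K1 = subdvD(1,3)[OF sub1] and K3 = subdvD(1,3)[OF sub3]
  show "chain_map K K1 (amap K3 \<alpha>)" by (rule chain_map_amap[OF sub3 \<alpha> K1(1)])
  show "chain_map K K1 (sd K1)" by (rule chain_map_sd[OF sub1])
  show "sd K1 (sx S) \<in> CS (inside K1 S)" for S by (rule sd_sx_inside)
  show "amap K3 \<alpha> (sx {}) = sd K1 (sx {})"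
    by (simp add: amap_def sd_sx_empty[OF K3(1)] sd_sx_empty[OF K1(1)])
  fix S assume S: "S \<in> K"
  show "amap K3 \<alpha> (sx S) \<in> CS (inside K1 S)"
    unfolding amap_def
  proof (rule CS_image[OF linear_push _ subspace_CS sd_sx_inside])
    fix T assume "T \<in> inside K3 S"
    then have T: "T \<in> K3" "T \<subseteq> convex hull S" by (auto simp: inside_def)
    have "\<alpha> v \<in> convex hull S" if v: "v \<in> T" for v
    proof -
      have vS: "v \<in> convex hull S" using T(2) v by auto
      have vK: "v \<in> polyh K" using polyhI[OF S vS] .
      have "\<alpha> v \<in> car K1 v"
        using \<alpha> vK K3(2) car_vertex[OF K3(1) T(1) v] by (auto simp: appr_def)
      then have "\<alpha> v \<in> convex hull (car K v)" using subdv_car[OF sub1 vK] by auto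
      then show ?thesis using hull_mono[OF car_subset[OF K vK S vS], of convex] by auto
    qed
    then have "\<alpha> ` T \<in> inside K1 S" using appr_simplicial[OF \<alpha> K3(1) K1(1) T(1)] by (auto simp: inside_def)
    then show "push \<alpha> (sx T) \<in> CS (inside K1 S)"
      using push_sx_mem[OF geo_complexD(6)[OF K3(1) T(1)], of \<alpha>] CS_mono[of "{\<alpha> ` T}" "inside K1 S"] by auto
  qed
qed

lemma amap_push:
  assumes "subdv K' K" "c \<in> CS K" shows "push b (amap K' a c) = amap K' (\<lambda>x. b (a x)) c"
proof -
  have "sd K' c \<in> CS K'" using chain_mapD(2)[OF chain_map_sd[OF assms(1)] assms(2)] .
  then show ?thesis unfolding amap_def using push_push set_complex_FC[OF geo_set_complex[OF subdvD(1)[OF assms(1)]]] by auto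
qed

text \<open>Up to homotopy, the chain map does not depend on the subdivision nor on the approximation:
  compare both with approximations defined on a subdivision that is fine enough for \<open>K1\<close> and \<open>K2\<close>.\<close>

lemma homotopic_amap_unique:
  assumes sub1: "subdv K1 K" and sub2: "subdv K2 K" and L: "geo_complex L"
    and p: "appr K1 L f p" and q: "appr K2 L f q"
  shows "chain_homotopic K L (amap K1 p) (amap K2 q)"
proof -
  note K = subdvD(2)[OF sub1] and K1 = subdvD(1,3)[OF sub1] and K2 = subdvD(1,3)[OF sub2]
  obtain K3 \<alpha> \<beta> where K3: "subdv K3 K" and \<alpha>: "appr K3 K1 (\<lambda>x. x) \<alpha>" and \<beta>: "appr K3 K2 (\<lambda>x. x) \<beta>"
    using ex_approximation2[OF K K1(1) _ _ K2(1), of "\<lambda>x. x" "\<lambda>x. x"] K1(2) K2(2) continuous_on_id by auto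
  have 1: "chain_homotopic K L (amap K1 p) (\<lambda>c. push p (amap K3 \<alpha> c))"
    unfolding amap_def[of K1 p]
    by (rule homotopic_sym[OF homotopic_post[OF homotopic_amap_sd[OF K3 sub1 \<alpha>] chain_map_push_appr[OF p K1(1) L]]])
  have 2: "chain_homotopic K L (\<lambda>c. push q (amap K3 \<beta> c)) (amap K2 q)"
    unfolding amap_def[of K2 q]
    by (rule homotopic_post[OF homotopic_amap_sd[OF K3 sub2 \<beta>] chain_map_push_appr[OF q K2(1) L]])
  have 3: "chain_homotopic K L (\<lambda>c. push p (amap K3 \<alpha> c)) (amap K3 (\<lambda>x. p (\<alpha> x)))"
    by (rule homotopic_eq) (rule amap_push[OF K3])
  have 4: "chain_homotopic K L (amap K3 (\<lambda>x. q (\<beta> x))) (\<lambda>c. push q (amap K3 \<beta> c))"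
    by (rule homotopic_eq) (rule amap_push[OF K3, symmetric])
  have "chain_homotopic K3 L (push (\<lambda>x. p (\<alpha> x))) (push (\<lambda>x. q (\<beta> x)))"
  proof (rule homotopic_contiguous[OF geo_set_complex[OF subdvD(1)[OF K3]] geo_set_complex[OF L]])
    fix S assume "S \<in> K3"
    then show "(\<lambda>x. p (\<alpha> x)) ` S \<union> (\<lambda>x. q (\<beta> x)) ` S \<in> L"
      using appr_contiguous[OF appr_comp[OF \<alpha> p] appr_comp[OF \<beta> q] subdvD(1)[OF K3] L] by simp
  qed
  from homotopic_pre[OF chain_map_sd[OF K3] this]
  have 5: "chain_homotopic K L (amap K3 (\<lambda>x. p (\<alpha> x))) (amap K3 (\<lambda>x. q (\<beta> x)))" unfolding amap_def .
  show ?thesis using homotopic_trans[OF 1 homotopic_trans[OF 3 homotopic_trans[OF 5 homotopic_trans[OF 4 2]]]] .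
qed

text \<open>The obstacle is the operator \<open>sd L1\<close> between the two vertex maps. An
  approximation of \<open>f\<close> into \<open>L1\<close>, followed by \<open>\<theta>\<close>,
  replaces \<open>a\<close>; then \<open>sd L1\<close> meets \<open>push \<theta>\<close> and
  \<open>homotopic_sd_push\<close> removes both.\<close>

lemma homotopic_amap_comp:
  assumes K1: "subdv K1 K" "appr K1 L f a" and L1: "subdv L1 L" "appr L1 M g b" and M: "geo_complex M"
    and K2: "subdv K2 K" "appr K2 M (\<lambda>x. g (f x)) q"
    and f: "continuous_on (polyh K) f"
  shows "chain_homotopic K M (\<lambda>c. amap L1 b (amap K1 a c)) (amap K2 q)"
proof -
  note gK = subdvD(2)[OF K1(1)] and gK1 = subdvD(1,3)[OF K1(1)] and gL = subdvD(2)[OF L1(1)] and gL1 = subdvD(1,3)[OF L1(1)]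
  have fL: "f ` polyh K \<subseteq> polyh L1" using K1(2) gK1(2) gL1(2) by (auto simp: appr_def)
  obtain K3 a2 where K3: "subdv K3 K" and a2: "appr K3 L1 f a2"
    using ex_approximation2[OF gK gL1(1) f fL gL1(1) f fL] by auto
  obtain \<theta> where \<theta>: "appr L1 L (\<lambda>x. x) \<theta>" using ex_appr_id[OF L1(1)] by auto
  have "chain_homotopic K L (amap K1 a) (amap K3 (\<lambda>x. \<theta> (a2 x)))"
    by (rule homotopic_amap_unique[OF K1(1) K3 gL K1(2) appr_comp[OF a2 \<theta>]])
  moreover have "chain_homotopic K L (amap K3 (\<lambda>x. \<theta> (a2 x))) (\<lambda>c. push \<theta> (amap K3 a2 c))"
    by (rule homotopic_eq) (rule amap_push[OF K3, symmetric])
  ultimately have "chain_homotopic K L (amap K1 a) (\<lambda>c. push \<theta> (amap K3 a2 c))" by (rule homotopic_trans)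
  from homotopic_post[OF this chain_map_amap[OF L1 M]]
  have 1: "chain_homotopic K M (\<lambda>c. amap L1 b (amap K1 a c)) (\<lambda>c. push b (sd L1 (push \<theta> (amap K3 a2 c))))"
    by (simp add: amap_def)
  have "chain_homotopic K L1 (\<lambda>c. sd L1 (push \<theta> (amap K3 a2 c))) (\<lambda>c. amap K3 a2 c)"
    by (rule homotopic_pre[OF chain_map_amap[OF K3 a2 gL1(1)] homotopic_sd_push[OF L1(1) \<theta>]])
  from homotopic_post[OF this chain_map_push_appr[OF L1(2) gL1(1) M]]
  have 2: "chain_homotopic K M (\<lambda>c. push b (sd L1 (push \<theta> (amap K3 a2 c)))) (\<lambda>c. push b (amap K3 a2 c))" .
  have 3: "chain_homotopic K M (\<lambda>c. push b (amap K3 a2 c)) (amap K3 (\<lambda>x. b (a2 x)))"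
    by (rule homotopic_eq) (rule amap_push[OF K3])
  have 4: "chain_homotopic K M (amap K3 (\<lambda>x. b (a2 x))) (amap K2 q)"
    by (rule homotopic_amap_unique[OF K3 K2(1) M appr_comp[OF a2 L1(2)] K2(2)])
  show ?thesis using homotopic_trans[OF 1 homotopic_trans[OF 2 homotopic_trans[OF 3 4]]] .
qed

lemma appr_cong: "appr K L f a \<Longrightarrow> (\<And>x. x \<in> polyh K \<Longrightarrow> f x = g x) \<Longrightarrow> appr K L g a"
  by (simp add: appr_def)

theorem supertrace_topological_invariance:
  assumes K1: "subdv K1 K" "appr K1 K f a" and M1: "subdv M1 M" "appr M1 M g b"
    and h: "continuous_on (polyh K) h" "h ` polyh K \<subseteq> polyh M"
    and k: "continuous_on (polyh M) k" "k ` polyh M \<subseteq> polyh K"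
    and f: "\<And>x. x \<in> polyh K \<Longrightarrow> f x = k (g (h x))"
    and g: "\<And>y. y \<in> polyh M \<Longrightarrow> g y = g (h (k y))"
    and gc: "continuous_on (polyh M) g"
  shows "supertrace K (amap K1 a) = supertrace M (amap M1 b)"
proof -
  note gK = subdvD(2)[OF K1(1)] and gK1 = subdvD(1,3)[OF K1(1)]
    and gM = subdvD(2)[OF M1(1)] and gM1 = subdvD(1,3)[OF M1(1)]
  have gM': "g ` polyh M \<subseteq> polyh M" using M1(2) gM1(2) by (auto simp: appr_def)
  have ghc: "continuous_on (polyh K) (\<lambda>x. g (h x))"
    using continuous_on_compose2[OF gc h] by simp
  have gh: "(\<lambda>x. g (h x)) ` polyh K \<subseteq> polyh M" using h(2) gM' by auto
  obtain K2 q where K2: "subdv K2 K" and q: "appr K2 M (\<lambda>x. g (h x)) q"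
    using ex_approximation2[OF gK gM ghc gh gM ghc gh] by auto
  obtain M2 w where M2: "subdv M2 M" and w: "appr M2 K k w"
    using ex_approximation2[OF gM gK k gK k] by auto
  have f': "appr K1 K (\<lambda>x. k (g (h x))) a" using appr_cong[OF K1(2)] f gK1(2) by simp
  have g': "appr M1 M (\<lambda>y. g (h (k y))) b" using appr_cong[OF M1(2)] g gM1(2) by simp
  have "supertrace K (amap K1 a) = supertrace K (\<lambda>c. amap M2 w (amap K2 q c))"
    by (rule supertrace_hom[OF geo_set_complex[OF gK], symmetric]) (rule homotopic_amap_comp[OF K2 q M2 w gK K1(1) f' ghc])
  also have "\<dots> = supertrace M (\<lambda>c. amap K2 q (amap M2 w c))"
    by (rule supertrace_comm[OF geo_complexD(1)[OF gK] geo_complexD(1)[OF gM] chain_map_amap[OF K2 q gM] chain_map_amap[OF M2 w gK] graded_amap[OF K2]])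
  also have "\<dots> = supertrace M (amap M1 b)"
    by (rule supertrace_hom[OF geo_set_complex[OF gM]]) (rule homotopic_amap_comp[OF M2 w K2 q gM M1(1) g' k(1)])
  finally show ?thesis .
qed

section \<open>Unions of open simplices\<close>

text \<open>Points with the same carrier are points of the same open simplex, so these are the
  unions of open simplices.\<close>

definition open_union :: "'a::euclidean_space set set \<Rightarrow> 'a set \<Rightarrow> bool" where
  "open_union K A \<longleftrightarrow> A \<subseteq> polyh K \<and> (\<forall>x\<in>A. \<forall>y\<in>polyh K. car K x = car K y \<longrightarrow> y \<in> A)"

text \<open>The barycenter tests whether an open simplex lies in \<open>A\<close>. As the sign
  counts vertices, this is minus the combinatorial Lefschetz number.\<close>

definition lef :: "'a::euclidean_space set set \<Rightarrow> 'a set set \<Rightarrow> ('a \<Rightarrow> 'a) \<Rightarrow> 'a set \<Rightarrow> real" where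
  "lef K K' a A = (\<Sum>V | V \<in> K \<and> V \<noteq> {} \<and> bc V \<in> A. (- 1) ^ card V * lookup (amap K' a (sx V)) V)"

lemma lef_disjoint:
  assumes "geo_complex K" "A \<inter> B = {}" shows "lef K K' a (A \<union> B) = lef K K' a A + lef K K' a B"
proof -
  have "{V. V \<in> K \<and> V \<noteq> {} \<and> bc V \<in> A \<union> B} = {V. V \<in> K \<and> V \<noteq> {} \<and> bc V \<in> A} \<union> {V. V \<in> K \<and> V \<noteq> {} \<and> bc V \<in> B}"
    by auto
  moreover have "finite {V. V \<in> K \<and> V \<noteq> {} \<and> bc V \<in> C}" for C using geo_complexD(1)[OF assms(1)] by simp
  ultimately show ?thesis unfolding lef_def using assms(2) by (subst sum.union_disjoint[symmetric]) auto
qed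

text \<open>From a point of the closed carrier of \<open>x\<close>, any move towards
  \<open>x\<close> makes all coordinates positive and so enters the open simplex.\<close>

lemma car_segment:
  assumes K: "geo_complex K" and x: "x \<in> polyh K" and y: "y \<in> convex hull (car K x)" and t: "0 < t" "t \<le> 1"
  shows "(1 - t) *\<^sub>R y + t *\<^sub>R x \<in> polyh K" "car K ((1 - t) *\<^sub>R y + t *\<^sub>R x) = car K x"
proof -
  let ?V = "car K x" and ?z = "(1 - t) *\<^sub>R y + t *\<^sub>R x"
  have V: "?V \<in> K" "\<not> affine_dependent ?V" using car_in[OF K x] geo_complexD(3)[OF K] by auto
  have xV: "x \<in> convex hull ?V" using in_hull_car[OF K x] .
  have aff: "x \<in> affine hull ?V" "y \<in> affine hull ?V" using xV y convex_hull_subset_affine_hull by auto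
  have z: "?z \<in> convex hull ?V" using y xV t by (intro convexD[OF convex_convex_hull]) auto
  then show "?z \<in> polyh K" by (rule polyhI[OF V(1)])
  show "car K ?z = ?V"
  proof (rule car_eqI[OF K V(1) z])
    fix v assume v: "v \<in> ?V"
    have "bary ?V y v \<ge> 0" using y in_hull_iff_bary[OF V(2)] v by auto
    then have "(1 - t) * bary ?V y v \<ge> 0" using t by simp
    moreover have "t * bary ?V x v > 0" using bary_car_pos[OF K x v] t by simp
    ultimately show "bary ?V ?z v \<noteq> 0" using bary_affine2[OF V(2) aff(2,1) v, of t] by linarith
  qed
qed

lemma hull_car_subset_closure:
  assumes K: "geo_complex K" and A: "open_union K A" and x: "x \<in> A"
  shows "convex hull (car K x) \<subseteq> closure A"
proof
  fix y assume y: "y \<in> convex hull (car K x)"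
  have xK: "x \<in> polyh K" using A x by (auto simp: open_union_def)
  let ?z = "\<lambda>n :: nat. (1 - 1 / real (Suc n)) *\<^sub>R y + (1 / real (Suc n)) *\<^sub>R x"
  have "?z n \<in> A" for n
    using A x car_segment[OF K xK y, of "1 / real (Suc n)"] unfolding open_union_def by auto
  moreover have "?z \<longlonglongrightarrow> (1 - 0) *\<^sub>R y + 0 *\<^sub>R x"
    by (intro tendsto_intros LIMSEQ_Suc[OF lim_1_over_n])
  ultimately show "y \<in> closure A" unfolding closure_sequential by (intro exI[of _ ?z]) auto
qed

lemma open_union_bc:
  assumes K: "geo_complex K" and A: "open_union K A" and x: "x \<in> A"
  shows "bc (car K x) \<in> A"
proof -
  have xK: "x \<in> polyh K" using A x by (auto simp: open_union_def)
  note V = car_in[OF K xK] car_nonempty[OF K xK]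
  have "car K x = car K (bc (car K x))" using car_bc[OF K V] by simp
  then show ?thesis using A x bc_polyh[OF K V] unfolding open_union_def by blast
qed

lemma closure_open_union:
  assumes K: "geo_complex K" and A: "open_union K A"
  shows "closure A = (\<Union>V\<in>{V \<in> K. V \<noteq> {} \<and> bc V \<in> A}. convex hull V)"
proof
  let ?C = "\<Union>V\<in>{V \<in> K. V \<noteq> {} \<and> bc V \<in> A}. convex hull V"
  show "closure A \<subseteq> ?C"
  proof (rule closure_minimal)
    show "closed ?C"
      using geo_complexD(1,6)[OF K] by (intro closed_UN ballI compact_imp_closed finite_imp_compact_convex_hull) auto
    show "A \<subseteq> ?C"
    proof
      fix x assume x: "x \<in> A"
      then have xK: "x \<in> polyh K" using A by (auto simp: open_union_def)
      then show "x \<in> ?C"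
        using open_union_bc[OF K A x] car_in[OF K xK] car_nonempty[OF K xK] in_hull_car[OF K xK] by blast
    qed
  qed
  show "?C \<subseteq> closure A"
    using hull_car_subset_closure[OF K A] car_bc[OF K] by fastforce
qed

lemma open_union_closure:
  assumes K: "geo_complex K" and A: "open_union K A" shows "open_union K (closure A)"
  unfolding open_union_def
proof (intro conjI ballI impI)
  show "closure A \<subseteq> polyh K" unfolding closure_open_union[OF K A] by (auto simp: polyh_def)
  fix x y assume "x \<in> closure A" and y: "y \<in> polyh K" and eq: "car K x = car K y"
  then obtain V where V: "V \<in> K" "V \<noteq> {}" "bc V \<in> A" "x \<in> convex hull V"
    unfolding closure_open_union[OF K A] by auto
  have "car K x \<subseteq> V" using car_subset[OF K polyhI[OF V(1,4)] V(1,4)] .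
  then have "y \<in> convex hull V" using in_hull_car[OF K y] hull_mono[of "car K y" V convex] eq by auto
  then show "y \<in> closure A" unfolding closure_open_union[OF K A] using V by auto
qed

lemma open_union_diff: "open_union K C \<Longrightarrow> open_union K A \<Longrightarrow> open_union K (C - A)"
  unfolding open_union_def by (metis DiffD1 DiffD2 DiffI Diff_subset subset_iff)

section \<open>Restriction to a closed union of simplices\<close>

definition restr :: "'a::euclidean_space set set \<Rightarrow> 'a set \<Rightarrow> 'a set set" where
  "restr K A = {V \<in> K. convex hull V \<subseteq> A}"

lemma geo_restr: "geo_complex K \<Longrightarrow> geo_complex (restr K A)"
proof -
  assume K: "geo_complex K"
  have "convex hull W \<subseteq> A" if "W \<subseteq> V" "convex hull V \<subseteq> A" for W V
    using hull_mono[OF that(1), of convex] that(2) by auto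
  then show ?thesis using K unfolding geo_complex_def restr_def by (auto 0 3)
qed

lemma car_restr:
  assumes K: "geo_complex K" and x: "x \<in> polyh (restr K A)" shows "car (restr K A) x = car K x"
proof -
  let ?V = "car (restr K A) x"
  note J = geo_restr[OF K, of A]
  have V: "?V \<in> K" using car_in[OF J x] by (simp add: restr_def)
  have "bary ?V x v \<noteq> 0" if "v \<in> ?V" for v using bary_car_pos[OF J x that] by simp
  from car_eqI[OF K V in_hull_car[OF J x] this] show ?thesis by simp
qed

lemma polyh_restr:
  assumes K: "geo_complex K" and A: "open_union K A" "closed A" shows "polyh (restr K A) = A"
proof
  show "polyh (restr K A) \<subseteq> A" by (auto simp: polyh_def restr_def)
  show "A \<subseteq> polyh (restr K A)"
  proof
    fix x assume x: "x \<in> A"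
    then have xK: "x \<in> polyh K" using A by (auto simp: open_union_def)
    have "convex hull (car K x) \<subseteq> A" using hull_car_subset_closure[OF K A(1) x] A(2) by simp
    then have "car K x \<in> restr K A" using car_in[OF K xK] by (simp add: restr_def)
    then show "x \<in> polyh (restr K A)" using polyhI in_hull_car[OF K xK] by blast
  qed
qed

lemma subdv_restr:
  assumes sub: "subdv K' K" and A: "open_union K A" "closed A"
  shows "subdv (restr K' A) (restr K A)"
proof -
  note K = subdvD[OF sub]
  have hullA: "convex hull (car K x) \<subseteq> A" if "x \<in> A" for x
    using hull_car_subset_closure[OF K(2) A(1) that] A(2) by simp
  have hullA': "convex hull (car K' x) \<subseteq> convex hull (car K x)" if "x \<in> polyh K" for x
    using subdv_car[OF sub that] by (simp add: subset_hull)
  show ?thesis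
    unfolding subdv_def
  proof (intro conjI ballI)
    show "geo_complex (restr K' A)" "geo_complex (restr K A)" using geo_restr K by auto
    show "polyh (restr K' A) = polyh (restr K A)"
      unfolding polyh_restr[OF K(2) A]
    proof
      show "polyh (restr K' A) \<subseteq> A" by (auto simp: polyh_def restr_def)
      show "A \<subseteq> polyh (restr K' A)"
      proof
        fix x assume x: "x \<in> A"
        then have xK: "x \<in> polyh K" "x \<in> polyh K'" using A K(3) by (auto simp: open_union_def)
        have "car K' x \<in> restr K' A"
          using car_in[OF K(1) xK(2)] hullA[OF x] hullA'[OF xK(1)] by (auto simp: restr_def)
        then show "x \<in> polyh (restr K' A)" using polyhI in_hull_car[OF K(1) xK(2)] by blast
      qed
    qed
    fix T assume "T \<in> restr K' A"
    then have T: "T \<in> K'" "convex hull T \<subseteq> A" by (auto simp: restr_def)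
    show "\<exists>S\<in>restr K A. T \<subseteq> convex hull S"
    proof (cases "T = {}")
      case True then show ?thesis using geo_complexD(2)[OF geo_restr[OF K(2)]] by auto
    next
      case False
      have x: "bc T \<in> A" using T(2) bc_in_hull[OF geo_complexD(3)[OF K(1) T(1)] False] by auto
      have xK: "bc T \<in> polyh K" using bc_polyh[OF K(1) T(1) False] K(3) by simp
      have "T \<subseteq> convex hull (car K (bc T))" using subdv_car[OF sub xK] car_bc[OF K(1) T(1) False] by simp
      moreover have "car K (bc T) \<in> restr K A" using hullA[OF x] car_in[OF K(2) xK] by (simp add: restr_def)
      ultimately show ?thesis by blast
    qed
  qed
qed

lemma appr_restr:
  assumes sub: "subdv K' K" and A: "open_union K A" "closed A" and a: "appr K' K f a" and f: "f ` A \<subseteq> A"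
  shows "appr (restr K' A) (restr K A) f a"
proof -
  note K = subdvD[OF sub]
  have P: "polyh (restr K A) = A" "polyh (restr K' A) = A"
    using polyh_restr[OF K(2) A] subdvD(3)[OF subdv_restr[OF sub A]] by auto
  show ?thesis
    unfolding appr_def
  proof (intro ballI conjI)
    fix x assume x: "x \<in> polyh (restr K' A)"
    then have fx: "f x \<in> polyh (restr K A)" using P f by auto
    then show "f x \<in> polyh (restr K A)" .
    have "x \<in> polyh K'" using x P A K(3) by (auto simp: open_union_def)
    then have "a ` car K' x \<subseteq> car K (f x)" using a by (auto simp: appr_def)
    then show "a ` car (restr K' A) x \<subseteq> car (restr K A) (f x)"
      using car_restr[OF K(1) x] car_restr[OF K(2) fx] by simp
  qed
qed

text \<open>The 1 is the entry of the empty simplex, which the supertrace of the augmented complex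
  includes and \<open>lef\<close> omits. The other entries agree because the subdivision of a
  simplex in \<open>A\<close> stays in \<open>A\<close>.\<close>

lemma lef_closed_supertrace:
  assumes sub: "subdv K' K" and A: "open_union K A" "closed A"
  shows "lef K K' a A = supertrace (restr K A) (amap (restr K' A) a) - 1"
proof -
  note K = subdvD[OF sub]
  let ?t = "\<lambda>V. (- 1) ^ card V * lookup (amap K' a (sx V)) V"
  have eq: "amap (restr K' A) a (sx V) = amap K' a (sx V)" if V: "V \<in> restr K A" for V
  proof -
    have "convex hull T \<subseteq> A" if T: "T \<subseteq> convex hull V" for T
      using V hull_minimal[OF T, of convex] by (auto simp: restr_def)
    then have "sdset (restr K' A) V = sdset K' V" by (auto simp: sdset_def restr_def)
    then show ?thesis by (simp add: amap_def sd_sx)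
  qed
  have "{V. V \<in> K \<and> V \<noteq> {} \<and> bc V \<in> A} = restr K A - {{}}"
  proof -
    have "convex hull V \<subseteq> A" if "V \<in> K" "V \<noteq> {}" "bc V \<in> A" for V
      using hull_car_subset_closure[OF K(2) A(1) that(3)] A(2) car_bc[OF K(2) that(1,2)] by simp
    moreover have "bc V \<in> A" if "V \<in> K" "V \<noteq> {}" "convex hull V \<subseteq> A" for V
      using bc_in_hull[OF geo_complexD(3)[OF K(2) that(1)] that(2)] that(3) by auto
    ultimately show ?thesis by (auto simp: restr_def)
  qed
  then have "lef K K' a A = (\<Sum>V\<in>restr K A - {{}}. ?t V)" by (simp add: lef_def)
  also have "\<dots> = (\<Sum>V\<in>restr K A. ?t V) - ?t {}"
    using geo_complexD(1,2)[OF geo_restr[OF K(2), of A]] by (simp add: sum_diff1)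
  also have "(\<Sum>V\<in>restr K A. ?t V) = supertrace (restr K A) (amap (restr K' A) a)"
    unfolding supertrace_def by (intro sum.cong refl) (simp add: eq)
  also have "?t {} = 1" by (simp add: amap_def sd_sx_empty[OF K(1)] lookup_sx)
  finally show ?thesis .
qed

text \<open>For closed \<open>A\<close>, the number is an ordinary Lefschetz number.  For openness of \<open>f\<close>, the closure of
  \<open>A\<close> is as invariant as \<open>A\<close>, so the general case follows by passing to \<open>closure A - A\<close>.\<close>

theorem lef_invariance:
  assumes K1: "subdv K1 K" "appr K1 K f a" and M1: "subdv M1 M" "appr M1 M g b"
    and hk: "homeomorphism (polyh K) (polyh M) h k"
    and f: "\<And>x. x \<in> polyh K \<Longrightarrow> f x = k (g (h x))"
    and fc: "continuous_on (polyh K) f" and gc: "continuous_on (polyh M) g"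
    and fo: "\<And>U. openin (top_of_set (polyh K)) U \<Longrightarrow> openin (top_of_set (polyh K)) (f ` U)"
    and A: "open_union K A" and B: "open_union M (h ` A)"
    and fA: "\<And>x. x \<in> polyh K \<Longrightarrow> f x \<in> A \<longleftrightarrow> x \<in> A"
  shows "lef K K1 a A = lef M M1 b (h ` A)"
  using A B fA
proof (induction "card {V \<in> K. convex hull V \<subseteq> closure A}" arbitrary: A rule: less_induct)
  case less
  note A = less.prems(1) and B = less.prems(2) and fA = less.prems(3)
  note gK = subdvD(2)[OF K1(1)] and gM = subdvD(2)[OF M1(1)]
  have hc: "continuous_on (polyh K) h" "h ` polyh K = polyh M" and kc: "continuous_on (polyh M) k" "k ` polyh M = polyh K"
    and kh: "\<And>x. x \<in> polyh K \<Longrightarrow> k (h x) = x" and hk': "\<And>y. y \<in> polyh M \<Longrightarrow> h (k y) = y"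
    using hk by (auto simp: homeomorphism_def)
  have inj: "inj_on h (polyh K)" using kh by (rule inj_on_inverseI)
  have fK: "f x \<in> polyh K" if "x \<in> polyh K" for x
    using K1(2) that subdvD(3)[OF K1(1)] by (auto simp: appr_def)
  have gM': "g y \<in> polyh M" if "y \<in> polyh M" for y
    using M1(2) that subdvD(3)[OF M1(1)] by (auto simp: appr_def)
  define C where "C = closure A"
  have AK: "A \<subseteq> polyh K" and AC: "A \<subseteq> C" using A closure_subset by (auto simp: open_union_def C_def)
  have C: "open_union K C" "closed C" using open_union_closure[OF gK A] by (auto simp: C_def)
  have CK: "C \<subseteq> polyh K" using C(1) by (auto simp: open_union_def)
  have fC: "f x \<in> C \<longleftrightarrow> x \<in> C" if x: "x \<in> polyh K" for x
  proof
    assume "x \<in> C"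
    moreover have "f ` closure A \<subseteq> C"
    proof (rule image_closure_subset)
      show "continuous_on (closure A) f" using continuous_on_subset[OF fc CK] by (simp add: C_def)
      show "closed C" by (rule C(2))
      show "f ` A \<subseteq> C" using fA AK AC by auto
    qed
    ultimately show "f x \<in> C" by (auto simp: C_def)
  next
    assume fx: "f x \<in> C"
    show "x \<in> C"
    proof (rule ccontr)
      assume xC: "x \<notin> C"
      \<comment> \<open>The image of the complement of \<open>C\<close> is a neighborhood of
        \<open>f x\<close>, which is in the closure of \<open>A\<close>; so a point outside
        \<open>C\<close> would be sent into \<open>A\<close>.\<close>
      have "openin (top_of_set (polyh K)) (polyh K - C)"
        unfolding Diff_eq by (rule openin_open_Int) (rule open_Compl[OF C(2)])
      then have "openin (top_of_set (polyh K)) (f ` (polyh K - C))" by (rule fo)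
      then obtain W where W: "open W" "f ` (polyh K - C) = polyh K \<inter> W" by (auto simp: openin_open)
      have "f x \<in> W" using W(2) x xC by auto
      then have "W \<inter> A \<noteq> {}" using fx W(1) unfolding C_def by (metis IntI empty_iff open_Int_closure_eq_empty)
      then obtain z where z: "z \<in> W" "z \<in> A" by auto
      then have "z \<in> f ` (polyh K - C)" using W(2) AK by auto
      then obtain w where w: "w \<in> polyh K" "w \<notin> C" "z = f w" by auto
      then show False using fA[OF w(1)] z(2) AC by auto
    qed
  qed
  have hC: "h ` C = closure (h ` A)"
  proof
    show "h ` C \<subseteq> closure (h ` A)" unfolding C_def
    proof (rule image_closure_subset)
      show "continuous_on (closure A) h" using continuous_on_subset[OF hc(1) CK] by (simp add: C_def)
      show "h ` A \<subseteq> closure (h ` A)" by (rule closure_subset)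
    qed simp
    have "compact C" using C(2) CK compact_polyh[OF gK] by (metis closed_Int_compact inf.absorb1)
    then have "compact (h ` C)" using continuous_on_subset[OF hc(1) CK] by (rule compact_continuous_image[rotated])
    then show "closure (h ` A) \<subseteq> h ` C" using AC by (intro closure_minimal compact_imp_closed) auto
  qed
  have D: "open_union M (h ` C)" "closed (h ` C)" unfolding hC using open_union_closure[OF gM B] by auto
  have closed_case: "lef K K1 a C = lef M M1 b (h ` C)"
  proof -
    have fCC: "f ` C \<subseteq> C" using fC CK by auto
    have kg: "k (g y) \<in> C" if y: "y \<in> h ` C" for y
    proof -
      obtain x where x: "x \<in> C" "y = h x" using y by auto
      then have "k (g y) = f x" using f[of x] CK by auto
      then show ?thesis using fCC x by auto
    qed
    have gD: "g ` (h ` C) \<subseteq> h ` C"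
    proof clarify
      fix x assume x: "x \<in> C"
      have "h x \<in> polyh M" using hc(2) CK x by blast
      then have "g (h x) = h (k (g (h x)))" using hk'[OF gM'] by simp
      then show "g (h x) \<in> h ` C" using kg[of "h x"] x by auto
    qed
    have DM: "h ` C \<subseteq> polyh M" using hc(2) CK by auto
    note P = polyh_restr[OF gK C] polyh_restr[OF gM D]
    have "supertrace (restr K C) (amap (restr K1 C) a) = supertrace (restr M (h ` C)) (amap (restr M1 (h ` C)) b)"
    proof (rule supertrace_topological_invariance[OF subdv_restr[OF K1(1) C] appr_restr[OF K1(1) C K1(2) fCC]
          subdv_restr[OF M1(1) D] appr_restr[OF M1(1) D M1(2) gD], unfolded P])
      show "continuous_on C h" "continuous_on (h ` C) k" "continuous_on (h ` C) g"
        using continuous_on_subset[OF hc(1) CK] continuous_on_subset[OF kc(1) DM] continuous_on_subset[OF gc DM] by auto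
      show "h ` C \<subseteq> h ` C" by simp
      show "k ` h ` C \<subseteq> C" using kh CK by auto
      show "f x = k (g (h x))" if "x \<in> C" for x using f CK that by auto
      show "g y = g (h (k y))" if "y \<in> h ` C" for y using hk' DM that by auto
    qed
    then show ?thesis using lef_closed_supertrace[OF K1(1) C] lef_closed_supertrace[OF M1(1) D] by simp
  qed
  have diff_case: "lef K K1 a (C - A) = lef M M1 b (h ` (C - A))"
  proof (cases "A = {}")
    \<comment> \<open>The measure cannot decrease here, since \<open>{}\<close> is counted for every
      set; but \<open>C - A\<close> is empty as well.\<close>
    case True
    then show ?thesis by (simp add: C_def lef_def)
  next
    case False
    show ?thesis
    proof (rule less.hyps)
      show E: "open_union K (C - A)" by (rule open_union_diff[OF C(1) A])
      have "h ` (C - A) = h ` C - h ` A" by (rule inj_on_image_set_diff[OF inj]) (use CK AK in auto)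
      then show "open_union M (h ` (C - A))" using open_union_diff[OF D(1) B] by simp
      show "f x \<in> C - A \<longleftrightarrow> x \<in> C - A" if "x \<in> polyh K" for x using fC[OF that] fA[OF that] by auto
      have sub: "closure (C - A) \<subseteq> C" using C(2) by (intro closure_minimal) auto
      obtain x where "x \<in> A" using False by auto
      \<comment> \<open>A largest simplex \<open>V\<close> of \<open>A\<close> is no longer counted:
        if \<open>V\<close> is in the closure of \<open>C - A\<close>, it is a face of some
        \<open>W\<close> of \<open>C - A\<close>, which is a face of some \<open>U\<close> of
        \<open>A\<close>, and maximality forces \<open>V = W = U\<close>.\<close>
      define Q where "Q = {V \<in> K. V \<noteq> {} \<and> bc V \<in> A}"
      have "car K x \<in> Q"
        using open_union_bc[OF gK A] car_in[OF gK] car_nonempty[OF gK] AK \<open>x \<in> A\<close> by (auto simp: Q_def)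
      moreover have finQ: "finite Q" using geo_complexD(1)[OF gK] by (simp add: Q_def)
      ultimately have "Max (card ` Q) \<in> card ` Q" by (intro Max_in) auto
      then obtain V where V: "V \<in> Q" "card V = Max (card ` Q)" by auto
      have max: "card W \<le> card V" if "W \<in> Q" for W using that finQ V(2) by simp
      have VK: "V \<in> K" "V \<noteq> {}" "bc V \<in> A" using V by (auto simp: Q_def)
      have "convex hull V \<subseteq> C" unfolding C_def closure_open_union[OF gK A] using VK by auto
      moreover have "\<not> convex hull V \<subseteq> closure (C - A)"
      proof
        assume "convex hull V \<subseteq> closure (C - A)"
        then have "bc V \<in> closure (C - A)" using bc_in_hull[OF geo_complexD(3)[OF gK VK(1)] VK(2)] by auto
        then obtain W where W: "W \<in> K" "W \<noteq> {}" "bc W \<in> C - A" "bc V \<in> convex hull W"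
          unfolding closure_open_union[OF gK E] by auto
        have VW: "V \<subseteq> W"
          using car_subset[OF gK bc_polyh[OF gK VK(1,2)] W(1,4)] car_bc[OF gK VK(1,2)] by simp
        have "bc W \<in> C" using W(3) by simp
        then obtain U where U: "U \<in> K" "U \<noteq> {}" "bc U \<in> A" "bc W \<in> convex hull U"
          unfolding C_def closure_open_union[OF gK A] by auto
        have WU: "W \<subseteq> U"
          using car_subset[OF gK bc_polyh[OF gK W(1,2)] U(1,4)] car_bc[OF gK W(1,2)] by simp
        have "card U \<le> card V" using max[of U] U by (simp add: Q_def)
        then have "V = U" using VW WU card_seteq[of U V] geo_complexD(6)[OF gK U(1)] by auto
        then show False using VW WU W(3) VK(3) by auto
      qed
      ultimately have "{V \<in> K. convex hull V \<subseteq> closure (C - A)} \<subset> {V \<in> K. convex hull V \<subseteq> closure A}"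
        using sub VK(1) unfolding C_def by blast
      then show "card {V \<in> K. convex hull V \<subseteq> closure (C - A)} < card {V \<in> K. convex hull V \<subseteq> closure A}"
        using geo_complexD(1)[OF gK] by (intro psubset_card_mono) auto
    qed
  qed
  have "lef K K1 a C = lef K K1 a A + lef K K1 a (C - A)"
    using lef_disjoint[OF gK, of A "C - A"] AC by (simp add: Un_absorb1 Diff_disjoint)
  moreover have "lef M M1 b (h ` C) = lef M M1 b (h ` A) + lef M M1 b (h ` (C - A))"
  proof -
    have "h ` (C - A) = h ` C - h ` A" by (rule inj_on_image_set_diff[OF inj]) (use CK AK in auto)
    then show ?thesis
      using lef_disjoint[OF gM, of "h ` A" "h ` (C - A)"] AC image_mono[OF AC, of h]
      by (simp add: Un_absorb1 Diff_disjoint)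
  qed
  ultimately show ?case using closed_case diff_case by simp
qed

section \<open>The combinatorial Lefschetz number\<close>

lemma sorted_vless_take:
  assumes "sorted_wrt vless us" "k < length us"
  shows "{u \<in> set us. vless u (us ! k)} = set (take k us)"
proof
  show "{u \<in> set us. vless u (us ! k)} \<subseteq> set (take k us)"
  proof clarify
    fix u assume u: "u \<in> set us" "vless u (us ! k)"
    then obtain j where j: "j < length us" "u = us ! j" by (auto simp: in_set_conv_nth)
    have "j < k"
    proof (rule ccontr)
      assume "\<not> j < k"
      then have "j = k \<or> vless (us ! k) (us ! j)"
        using assms j(1) sorted_wrt_nth_less[OF assms(1), of k j] by (cases "j = k") auto
      then show False using u(2) j(2) vless_antisym[of "us ! j" "us ! k"] by auto
    qed
    then show "u \<in> set (take k us)" using j by (auto simp: in_set_conv_nth intro!: exI[of _ j])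
  qed
  show "set (take k us) \<subseteq> {u \<in> set us. vless u (us ! k)}"
    using assms sorted_wrt_nth_less[OF assms(1)] by (auto simp: in_set_conv_nth) (metis less_trans)
qed

lemma sg_nth:
  assumes "finite U" "k < card U" shows "sg (srt U ! k) U = (- 1) ^ k"
proof -
  have "{u \<in> U. vless u (srt U ! k)} = set (take k (srt U))"
    using sorted_vless_take[OF sorted_srt[OF assms(1)], of k] assms by (simp add: length_srt)
  moreover have "card (set (take k (srt U))) = k"
    using distinct_srt[OF assms(1)] assms by (simp add: distinct_card length_srt)
  ultimately show ?thesis by (simp add: sg_def)
qed

lemma srt_delete:
  assumes "finite U" "k < card U"
  shows "srt (U - {srt U ! k}) = take k (srt U) @ drop (Suc k) (srt U)"
proof (rule srt_eqI)
  let ?us = "srt U"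
  have k: "k < length ?us" using assms by (simp add: length_srt)
  have us: "?us = take k ?us @ ?us ! k # drop (Suc k) ?us" using id_take_nth_drop[OF k] .
  have s: "sorted_wrt vless (take k ?us @ ?us ! k # drop (Suc k) ?us)" using sorted_srt[OF assms(1)] us by simp
  then show "sorted_wrt vless (take k ?us @ drop (Suc k) ?us)" by (auto simp: sorted_wrt_append)
  have "distinct (take k ?us @ ?us ! k # drop (Suc k) ?us)" using distinct_srt[OF assms(1)] us by simp
  moreover have "U = set (take k ?us @ ?us ! k # drop (Suc k) ?us)" using us set_srt[OF assms(1)] by simp
  ultimately show "set (take k ?us @ drop (Suc k) ?us) = U - {?us ! k}" by auto
qed

text \<open>Peeling off the first point is Laplace expansion along the first row: the vertex at
  position \<open>k\<close> of \<open>srt U\<close> has sign \<open>(- 1) ^ k\<close>, which is the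
  sign of the cofactor.\<close>

lemma foldr_pw_det:
  assumes V: "finite V"
  shows "U \<subseteq> V \<Longrightarrow> card U = length ws \<Longrightarrow> lookup (foldr (pw V) ws (sx {})) U =
    Determinant.det (Matrix.mat (length ws) (length ws) (\<lambda>(i, k). bary V (ws ! i) (srt U ! k)))"
proof (induction ws arbitrary: U)
  case Nil
  then have "U = {}" using finite_subset[OF _ V] by auto
  then show ?case by (simp add: lookup_sx)
next
  case (Cons w ws)
  have finU: "finite U" using Cons.prems V finite_subset by auto
  let ?n = "length ws" and ?us = "srt U" and ?c = "foldr (pw V) ws (sx {})"
  let ?A = "Matrix.mat (Suc ?n) (Suc ?n) (\<lambda>(i, k). bary V ((w # ws) ! i) (?us ! k))"
  have len: "length ?us = Suc ?n" using Cons.prems finU by (simp add: length_srt)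
  have "lookup (foldr (pw V) (w # ws) (sx {})) U =
      (\<Sum>s\<in>V. if s \<in> U then bary V w s * (sg s U * lookup ?c (U - {s})) else 0)"
    by (simp add: pw_def lookup_sum lookup_wdg if_distrib cong: if_cong)
  also have "\<dots> = (\<Sum>s\<in>U. bary V w s * (sg s U * lookup ?c (U - {s})))"
    using V Cons.prems(1) by (simp add: sum.inter_restrict[symmetric] Int_absorb1)
  also have "\<dots> = (\<Sum>k<Suc ?n. bary V w (?us ! k) * (sg (?us ! k) U * lookup ?c (U - {?us ! k})))"
  proof (rule sum.reindex_bij_betw[symmetric])
    show "bij_betw (\<lambda>k. ?us ! k) {..<Suc ?n} U"
      using bij_betw_nth[OF distinct_srt[OF finU], of "{..<Suc ?n}" U] len finU by simp
  qed
  also have "\<dots> = (\<Sum>k<Suc ?n. ?A $$ (0, k) * cofactor ?A 0 k)"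
  proof (intro sum.cong refl)
    fix k assume "k \<in> {..<Suc ?n}"
    then have k: "k < Suc ?n" by simp
    have kU: "k < card U" using k Cons.prems by simp
    let ?U = "U - {?us ! k}"
    have uk: "?us ! k \<in> U" using nth_mem[of k ?us] len k finU by simp
    have cU: "card ?U = ?n" using card_Diff_singleton[OF uk] Cons.prems(2) by simp
    have nth: "srt ?U ! j = (if j < k then ?us ! j else ?us ! Suc j)" if "j < ?n" for j
      unfolding srt_delete[OF finU kU] using that k len by (auto simp: nth_append)
    have "mat_delete ?A 0 k = Matrix.mat ?n ?n (\<lambda>(i, j). bary V (ws ! i) (srt ?U ! j))"
      by (rule eq_matI) (use k in \<open>auto simp: mat_delete_def nth\<close>)
    then have "cofactor ?A 0 k = (- 1) ^ k * lookup ?c ?U"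
      using Cons.IH[OF _ cU] Cons.prems(1) by (simp add: cofactor_def subset_iff)
    then show "bary V w (?us ! k) * (sg (?us ! k) U * lookup ?c ?U) = ?A $$ (0, k) * cofactor ?A 0 k"
      using k sg_nth[OF finU kU] by simp
  qed
  also have "\<dots> = Determinant.det ?A"
    using laplace_expansion_row[of ?A "Suc ?n" 0] by simp
  finally show ?case by simp
qed

text \<open>The Gram-type matrix of \<^const>\<open>relative_orientation\<close>, bordered by a column of ones, so that it
  becomes affine in the points \<open>ws\<close>.\<close>

definition bordered :: "'a::euclidean_space list \<Rightarrow> 'a list \<Rightarrow> real mat" where
  "bordered vs ws = Matrix.mat (length vs) (length vs)
     (\<lambda>(i, j). if j = 0 then 1 else (ws ! i) \<bullet> (vs ! j - vs ! 0))"

text \<open>Subtract the first row from the others and expand along the column of ones.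
  \<open>L\<close> is the unipotent matrix that undoes the row operation.\<close>

lemma det_bordered:
  assumes "length vs = Suc p"
  shows "Determinant.det (bordered vs ws) = Determinant.det (Matrix.mat p p
           (\<lambda>(i, j). (ws ! Suc i - ws ! 0) \<bullet> (vs ! Suc j - vs ! 0)))"
proof -
  let ?n = "Suc p"
  let ?N = "bordered vs ws"
  define L where "L = Matrix.mat ?n ?n (\<lambda>(i, k). if k = 0 \<or> i = k then 1 else (0::real))"
  define N' where "N' = Matrix.mat ?n ?n (\<lambda>(i, j). if i = 0 then ?N $$ (0, j) else ?N $$ (i, j) - ?N $$ (0, j))"
  have carr: "L \<in> carrier_mat ?n ?n" "N' \<in> carrier_mat ?n ?n" by (auto simp: L_def N'_def)
  have "?N = L * N'"
  proof (rule eq_matI)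
    fix i j assume "i < dim_row (L * N')" "j < dim_col (L * N')"
    then have ij: "i < ?n" "j < ?n" by (auto simp: L_def N'_def)
    have "(L * N') $$ (i, j) = (\<Sum>k<?n. L $$ (i, k) * N' $$ (k, j))"
      using ij carr by (simp add: times_mat_def Matrix.scalar_prod_def atLeast0LessThan)
    also have "\<dots> = L $$ (i, 0) * N' $$ (0, j) + (\<Sum>k<p. L $$ (i, Suc k) * N' $$ (Suc k, j))"
      by (rule sum.lessThan_Suc_shift)
    also have "(\<Sum>k<p. L $$ (i, Suc k) * N' $$ (Suc k, j)) = (\<Sum>k<p. if i = Suc k then N' $$ (i, j) else 0)"
      by (intro sum.cong refl) (use ij in \<open>auto simp: L_def\<close>)
    also have "\<dots> = (if i = 0 then 0 else N' $$ (i, j))"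
      using ij by (cases i) auto
    finally show "?N $$ (i, j) = (L * N') $$ (i, j)" using ij by (auto simp: L_def N'_def)
  qed (use assms in \<open>auto simp: L_def N'_def bordered_def\<close>)
  then have "Determinant.det ?N = Determinant.det L * Determinant.det N'" using det_mult[OF carr] by simp
  moreover have "Determinant.det L = 1"
  proof -
    have "Determinant.det L = prod_list (diag_mat L)"
      by (rule det_lower_triangular[OF _ carr(1)]) (auto simp: L_def)
    also have "diag_mat L = map (\<lambda>i. 1) [0..<?n]" unfolding diag_mat_def L_def by (intro map_cong) auto
    also have "prod_list (map (\<lambda>i. 1) [0..<?n]) = (1::real)" by (induction p) auto
    finally show ?thesis .
  qed
  moreover have "Determinant.det N' = cofactor N' 0 0"
  proof -
    have "Determinant.det N' = (\<Sum>i<?n. N' $$ (i, 0) * cofactor N' i 0)"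
      by (rule laplace_expansion_column[OF carr(2)]) simp
    also have "\<dots> = (\<Sum>i<?n. if i = 0 then cofactor N' 0 0 else 0)"
      by (intro sum.cong refl) (use assms in \<open>auto simp: N'_def bordered_def\<close>)
    also have "\<dots> = cofactor N' 0 0" by simp
    finally show ?thesis .
  qed
  moreover have "mat_delete N' 0 0 = Matrix.mat p p (\<lambda>(i, j). (ws ! Suc i - ws ! 0) \<bullet> (vs ! Suc j - vs ! 0))"
    by (rule eq_matI) (use assms in \<open>auto simp: mat_delete_def N'_def bordered_def inner_diff_left\<close>)
  ultimately show ?thesis by (simp add: cofactor_def)
qed

text \<open>The rows are affine in the points \<open>ws\<close>, so writing these in barycentric
  coordinates factors the matrix; the coordinate factor has the wedge coefficient as its
  determinant.\<close>

lemma det_bordered_bary: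
  assumes V: "\<not> affine_dependent V" and n: "length vs = card V" "length ws = card V" and ws: "set ws \<subseteq> affine hull V"
  shows "Determinant.det (bordered vs ws) = lookup (lam V (wl ws)) V * Determinant.det (bordered vs (srt V))"
proof -
  have fin: "finite V" using V by (rule aff_independent_finite)
  let ?n = "card V" and ?zs = "srt V"
  define B where "B = Matrix.mat ?n ?n (\<lambda>(i, k). bary V (ws ! i) (?zs ! k))"
  have carr: "B \<in> carrier_mat ?n ?n" "bordered vs ?zs \<in> carrier_mat ?n ?n"
    using n by (auto simp: B_def bordered_def)
  have "bordered vs ws = B * bordered vs ?zs"
  proof (rule eq_matI)
    fix i j assume "i < dim_row (B * bordered vs ?zs)" "j < dim_col (B * bordered vs ?zs)"
    then have ij: "i < ?n" "j < ?n" using n by (auto simp: B_def bordered_def)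
    let ?w = "ws ! i"
    have w: "?w \<in> affine hull V" using ws ij n(2) by (auto simp: set_conv_nth)
    have bij: "bij_betw (\<lambda>k. ?zs ! k) {..<?n} V"
      using bij_betw_nth[OF distinct_srt[OF fin], of "{..<?n}" V] fin by (simp add: length_srt)
    have "(B * bordered vs ?zs) $$ (i, j) = (\<Sum>k<?n. bary V ?w (?zs ! k) * bordered vs ?zs $$ (k, j))"
      using ij n carr by (simp add: times_mat_def Matrix.scalar_prod_def atLeast0LessThan B_def)
    also have "\<dots> = (\<Sum>k<?n. bary V ?w (?zs ! k) * (if j = 0 then 1 else ?zs ! k \<bullet> (vs ! j - vs ! 0)))"
      by (intro sum.cong refl) (use ij n in \<open>auto simp: bordered_def\<close>)
    also have "\<dots> = (\<Sum>v\<in>V. bary V ?w v * (if j = 0 then 1 else v \<bullet> (vs ! j - vs ! 0)))"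
      by (rule sum.reindex_bij_betw[OF bij])
    also have "\<dots> = (if j = 0 then 1 else ?w \<bullet> (vs ! j - vs ! 0))"
    proof (cases "j = 0")
      case True then show ?thesis using sum_bary[OF fin w] by simp
    next
      case False
      have "(\<Sum>v\<in>V. bary V ?w v * (v \<bullet> (vs ! j - vs ! 0))) = (\<Sum>v\<in>V. bary V ?w v *\<^sub>R v) \<bullet> (vs ! j - vs ! 0)"
        by (simp add: inner_sum_left)
      then show ?thesis using False bary_combination[OF fin w] by simp
    qed
    finally show "bordered vs ws $$ (i, j) = (B * bordered vs ?zs) $$ (i, j)"
      using ij n by (simp add: bordered_def)
  qed (use n in \<open>auto simp: B_def bordered_def\<close>)
  then have "Determinant.det (bordered vs ws) = Determinant.det B * Determinant.det (bordered vs ?zs)"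
    using det_mult[OF carr] by simp
  then show ?thesis
    using foldr_pw_det[OF fin, of V ws] n(2) by (simp add: lam_wl_foldr B_def)
qed

text \<open>A kernel vector gives a combination \<open>y\<close> of the edges
  \<open>vs ! j - vs ! 0\<close> that has the same inner product with all vertices. So
  \<open>y\<close> is orthogonal to the edges, hence to itself, and \<open>y = 0\<close> is an
  affine relation among the vertices.\<close>

lemma det_bordered_nonzero:
  assumes V: "\<not> affine_dependent V" and vs: "distinct vs" "set vs = V" "V \<noteq> {}"
  shows "Determinant.det (bordered vs (srt V)) \<noteq> 0"
proof
  assume 0: "Determinant.det (bordered vs (srt V)) = 0"
  have fin: "finite V" using V by (rule aff_independent_finite)
  let ?n = "card V"
  have len: "length vs = ?n" using distinct_card[OF vs(1)] vs(2) by simp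
  have n0: "?n > 0" using vs(3) fin by (simp add: card_gt_0_iff)
  obtain p where p: "?n = Suc p" using n0 gr0_implies_Suc by blast
  have carr: "bordered vs (srt V) \<in> carrier_mat ?n ?n" using len by (simp add: bordered_def)
  obtain x where x: "x \<in> carrier_vec ?n" "x \<noteq> 0\<^sub>v ?n" "bordered vs (srt V) *\<^sub>v x = 0\<^sub>v ?n"
    using 0 unfolding det_0_iff_vec_prod_zero_field[OF carr] by auto
  define X where "X = vec_index x"
  define y where "y = (\<Sum>j<p. (X (Suc j)) *\<^sub>R (vs ! Suc j - vs ! 0))"
  have zy: "z \<bullet> y = - (X 0)" if z: "z \<in> V" for z
  proof -
    obtain i where i: "i < ?n" "z = srt V ! i"
      using z fin by (metis in_set_conv_nth length_srt set_srt)
    have "0 = vec_index (bordered vs (srt V) *\<^sub>v x) i" using x(3) i(1) by simp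
    also have "\<dots> = (\<Sum>j<?n. bordered vs (srt V) $$ (i, j) * X j)"
      using i(1) x(1) carr by (simp add: X_def Matrix.scalar_prod_def atLeast0LessThan)
    also have "\<dots> = (\<Sum>j<Suc p. (if j = 0 then 1 else z \<bullet> (vs ! j - vs ! 0)) * X j)"
      unfolding p[symmetric] by (intro sum.cong refl) (use i len in \<open>auto simp: bordered_def\<close>)
    also have "\<dots> = X 0 + z \<bullet> y"
      unfolding sum.lessThan_Suc_shift by (simp add: y_def inner_sum_right mult.commute)
    finally show ?thesis by simp
  qed
  have vsV: "vs ! j \<in> V" if "j < Suc p" for j using that len p vs(2) by auto
  have "(vs ! Suc j - vs ! 0) \<bullet> y = 0" if "j < p" for j
    using zy[OF vsV, of "Suc j"] zy[OF vsV, of 0] that by (simp add: inner_diff_left)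
  then have "y \<bullet> y = 0"
    by (subst (1) y_def) (simp add: inner_sum_left)
  then have y0: "y = 0" by simp
  then have x0: "X 0 = 0" using zy[OF vsV, of 0] by simp
  \<comment> \<open>The coefficients of the vertices in \<open>y\<close>; \<open>THE\<close>
    recovers the position of \<open>v\<close> in \<open>vs\<close>.\<close>
  define U where "U v = (if v = vs ! 0 then - (\<Sum>j<p. X (Suc j)) else X (THE i. i < Suc p \<and> vs ! i = v))" for v
  have U0: "U (vs ! 0) = - (\<Sum>j<p. X (Suc j))" by (simp add: U_def)
  have US: "U (vs ! Suc j) = X (Suc j)" if j: "j < p" for j
  proof -
    have "(THE i. i < Suc p \<and> vs ! i = vs ! Suc j) = Suc j"
      using j nth_eq_iff_index_eq[OF vs(1)] len p by (intro the_equality) auto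
    moreover have "vs ! Suc j \<noteq> vs ! 0" using j nth_eq_iff_index_eq[OF vs(1), of "Suc j" 0] len p by auto
    ultimately show ?thesis by (simp add: U_def)
  qed
  have bij: "bij_betw (\<lambda>k. vs ! k) {..<Suc p} V"
  proof (rule bij_betw_nth[OF vs(1)])
    show "{..<Suc p} = {..<length vs}" using len p by simp
  qed (simp add: vs(2))
  have "sum U V = (\<Sum>k<Suc p. U (vs ! k))" by (rule sum.reindex_bij_betw[OF bij, symmetric])
  also have "\<dots> = U (vs ! 0) + (\<Sum>j<p. U (vs ! Suc j))" by (rule sum.lessThan_Suc_shift)
  also have "(\<Sum>j<p. U (vs ! Suc j)) = (\<Sum>j<p. X (Suc j))" by (intro sum.cong refl US) simp
  finally have sU: "sum U V = 0" using U0 by simp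
  have "(\<Sum>v\<in>V. U v *\<^sub>R v) = (\<Sum>k<Suc p. U (vs ! k) *\<^sub>R vs ! k)"
    by (rule sum.reindex_bij_betw[OF bij, symmetric])
  also have "\<dots> = U (vs ! 0) *\<^sub>R vs ! 0 + (\<Sum>j<p. U (vs ! Suc j) *\<^sub>R vs ! Suc j)" by (rule sum.lessThan_Suc_shift)
  also have "(\<Sum>j<p. U (vs ! Suc j) *\<^sub>R vs ! Suc j) = (\<Sum>j<p. X (Suc j) *\<^sub>R vs ! Suc j)"
    by (intro sum.cong refl) (simp add: US)
  also have "U (vs ! 0) *\<^sub>R vs ! 0 + \<dots> = y"
    unfolding U0 y_def by (simp add: scaleR_diff_right sum_subtractf scaleR_sum_left)
  finally have sUv: "(\<Sum>v\<in>V. U v *\<^sub>R v) = 0" using y0 by simp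
  have Uz: "U v = 0" if "v \<in> V" for v
  proof (rule ccontr)
    assume "U v \<noteq> 0"
    then have "affine_dependent V"
      unfolding affine_dependent_explicit_finite[OF fin] using sU sUv that by blast
    with V show False ..
  qed
  have "X j = 0" if "j < ?n" for j
  proof (cases j)
    case 0 then show ?thesis using x0 by simp
  next
    case (Suc i)
    then have "i < p" using that p by simp
    then show ?thesis using US[of i] Uz[OF vsV, of "Suc i"] Suc by simp
  qed
  then have "x = 0\<^sub>v ?n" using x(1) by (intro eq_vecI) (auto simp: X_def)
  with x(2) show False ..
qed

text \<open>The first factor is independent of \<open>ws\<close>. In a diagonal matrix entry it
  occurs once for the subdivision and once for the image simplex, and its square is 1.\<close>

lemma relative_orientation_eq:
  assumes V: "\<not> affine_dependent V" and vs: "distinct vs" "set vs = V" "V \<noteq> {}"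
    and ws: "length ws = card V" "set ws \<subseteq> affine hull V"
  shows "of_rat (relative_orientation vs ws) =
    sgn (Determinant.det (bordered vs (srt V))) * sgn (lookup (lam V (wl ws)) V)"
proof -
  have fin: "finite V" using V by (rule aff_independent_finite)
  have len: "length vs = card V" using distinct_card[OF vs(1)] vs(2) by simp
  have "card V > 0" using vs(3) fin by (simp add: card_gt_0_iff)
  then obtain p where p: "length vs = Suc p" using len gr0_implies_Suc by metis
  let ?d = "Determinant.det (Matrix.mat p p (\<lambda>(i, j). (ws ! Suc i - ws ! 0) \<bullet> (vs ! Suc j - vs ! 0)))"
  have "of_rat (relative_orientation vs ws) = sgn ?d"
    using p by (simp add: relative_orientation_def Let_def sgn_real_def)
  also have "?d = lookup (lam V (wl ws)) V * Determinant.det (bordered vs (srt V))"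
    using det_bordered[OF p, of ws] det_bordered_bary[OF V len ws] by simp
  finally show ?thesis by (simp add: sgn_mult mult.commute)
qed

lemma rel_interior_hull_iff:
  assumes K: "geo_complex K" and V: "V \<in> K" "V \<noteq> {}"
  shows "x \<in> rel_interior (convex hull V) \<longleftrightarrow> x \<in> convex hull V \<and> car K x = V"
proof -
  have Vi: "\<not> affine_dependent V" and fin: "finite V" using geo_complexD(3,6)[OF K V(1)] by auto
  show ?thesis
  proof
    assume "x \<in> rel_interior (convex hull V)"
    then obtain u where u: "\<And>v. v \<in> V \<Longrightarrow> 0 < u v" "sum u V = 1" "(\<Sum>v\<in>V. u v *\<^sub>R v) = x"
      unfolding rel_interior_convex_hull_explicit[OF Vi] by auto
    have x: "x \<in> convex hull V" using u fin by (auto simp: convex_hull_finite less_imp_le intro!: exI[of _ u])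
    moreover have "car K x = V"
    proof (rule car_eqI[OF K V(1) x])
      fix v assume "v \<in> V"
      then show "bary V x v \<noteq> 0" using bary_unique[OF Vi u(2,3), of v] u(1)[of v] by simp
    qed
    ultimately show "x \<in> convex hull V \<and> car K x = V" by simp
  next
    assume x: "x \<in> convex hull V \<and> car K x = V"
    then have xK: "x \<in> polyh K" using polyhI[OF V(1)] by simp
    have xa: "x \<in> affine hull V" using x convex_hull_subset_affine_hull by auto
    have "0 < bary V x v" if "v \<in> V" for v using bary_car_pos[OF K xK, of v] x that by simp
    then show "x \<in> rel_interior (convex hull V)"
      unfolding rel_interior_convex_hull_explicit[OF Vi] using bary[OF fin xa] by blast
  qed
qed

section \<open>From the matrices of the statement to chain maps\<close>

lemma vertex_order:
  assumes "simplicial_complex X" "S \<in> X"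
  shows "distinct (vertex_order S)" "set (vertex_order S) = simplex_vertices S"
proof -
  have "finite (simplex_vertices S)"
    using complex_vertices(1)[OF assms] by (rule aff_independent_finite)
  then have "\<exists>vs. distinct vs \<and> set vs = simplex_vertices S"
    using finite_distinct_list by blast
  from someI_ex[OF this] show "distinct (vertex_order S)" "set (vertex_order S) = simplex_vertices S"
    unfolding vertex_order_def by auto
qed

lemma p_simplices_iff:
  assumes X: "simplicial_complex X"
  shows "S \<in> p_simplices p X \<longleftrightarrow> S \<in> X \<and> card (simplex_vertices S) = Suc p"
proof -
  have "int p simplex S \<longleftrightarrow> card (simplex_vertices S) = Suc p" if S: "S \<in> X"
  proof
    assume "int p simplex S"
    then obtain C where "\<not> affine_dependent C" "int (card C) = int p + 1" "S = convex hull C"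
      unfolding simplex_def by auto
    then show "card (simplex_vertices S) = Suc p" using simplex_vertices_hull[of C] by simp
  next
    assume "card (simplex_vertices S) = Suc p"
    then show "int p simplex S"
      unfolding simplex_def using complex_vertices[OF X S] by (intro exI[of _ "simplex_vertices S"]) auto
  qed
  then show ?thesis unfolding p_simplices_def by auto
qed

lemma subdv_vsets:
  assumes X: "simplicial_complex X" and sub: "subdivision_of X' X"
  shows "subdv (vsets X') (vsets X)"
proof -
  have X': "simplicial_complex X'" and U: "\<Union>X' = \<Union>X" and refine: "\<And>T. T \<in> X' \<Longrightarrow> \<exists>S\<in>X. T \<subseteq> S"
    using sub by (auto simp: subdivision_of_def)
  have "\<exists>S\<in>vsets X. T \<subseteq> convex hull S" if T: "T \<in> vsets X'" for T
  proof (cases "T = {}")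
    case True then show ?thesis by (auto simp: vsets_def)
  next
    case False
    then obtain R where R: "R \<in> X'" "T = simplex_vertices R" using T by (auto simp: vsets_def)
    obtain S where S: "S \<in> X" "R \<subseteq> S" using refine[OF R(1)] by auto
    have "T \<subseteq> R" using hull_subset[of T convex] complex_vertices(2)[OF X' R(1)] R(2) by simp
    then show ?thesis
      using S complex_vertices(2)[OF X S(1)] by (intro bexI[of _ "simplex_vertices S"]) (auto simp: vsets_def)
  qed
  then show ?thesis
    unfolding subdv_def using geo_vsets[OF X] geo_vsets[OF X'] polyh_vsets[OF X] polyh_vsets[OF X'] U by simp
qed

text \<open>That the hull of the images is a simplex does not by itself make every image one of its
  vertices. But \<open>{g v}\<close> is a simplex of \<open>X\<close>, so it meets the hull in a
  face.\<close>

lemma simplicial_map_vsets: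
  assumes X: "simplicial_complex X" and X': "simplicial_complex X'" and g: "simplicial_map X' X g" and R: "R \<in> X'"
  shows "g ` simplex_vertices R \<in> vsets X"
proof -
  let ?V = "g ` simplex_vertices R" and ?H = "convex hull (g ` simplex_vertices R)"
  have H: "?H \<in> X" using g R by (auto simp: simplicial_map_def)
  have "simplex_vertices ?H = ?V"
  proof
    show "simplex_vertices ?H \<subseteq> ?V"
      unfolding simplex_vertices_def using extreme_point_of_convex_hull by blast
    show "?V \<subseteq> simplex_vertices ?H"
    proof clarify
      fix v assume v: "v \<in> simplex_vertices R"
      have "{v} \<in> X'" "simplex_vertices {v} = {v}"
        using vsets_face[OF X' R, of "{v}"] v by auto
      then have "convex hull (g ` {v}) \<in> X" using g unfolding simplicial_map_def by metis
      then have "{g v} \<in> X" by simp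
      then have "(?H \<inter> {g v}) face_of ?H" using X H unfolding simplicial_complex_def by blast
      moreover have "g v \<in> ?H" using v by (simp add: hull_inc)
      ultimately have "{g v} face_of ?H" by (simp add: Int_absorb1)
      then show "g v \<in> simplex_vertices ?H" by (simp add: simplex_vertices_def face_of_singleton)
    qed
  qed
  then show ?thesis using H by (auto simp: vsets_def intro!: image_eqI[of _ _ ?H])
qed

text \<open>A point has positive coordinates on its carrier, so \<open>g x\<close> has a positive
  coordinate at the image of each vertex of it. Since \<open>g x\<close> lies in the carrier of
  \<open>f x\<close>, these images are vertices of that carrier.\<close>

lemma appr_vsets:
  assumes X: "simplicial_complex X" and sub: "subdivision_of X' X"
    and a: "simplicial_approximation X' X f g" and f: "f ` \<Union>X \<subseteq> \<Union>X"
  shows "appr (vsets X') (vsets X) f g"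
proof -
  have X': "simplicial_complex X'" and U: "\<Union>X' = \<Union>X"
    using sub by (auto simp: subdivision_of_def)
  let ?K = "vsets X" and ?K' = "vsets X'"
  have K: "geo_complex ?K" "polyh ?K = \<Union>X" and K': "geo_complex ?K'" "polyh ?K' = \<Union>X"
    using geo_vsets[OF X] geo_vsets[OF X'] polyh_vsets[OF X] polyh_vsets[OF X'] U by simp_all
  have gmap: "simplicial_map X' X g"
    and carrier: "\<And>x S. x \<in> \<Union>X' \<Longrightarrow> S \<in> X \<Longrightarrow> f x \<in> rel_interior S \<Longrightarrow> g x \<in> S"
    using a by (auto simp: simplicial_approximation_def)
  show ?thesis
    unfolding appr_def
  proof (intro ballI conjI)
    fix x assume x: "x \<in> polyh ?K'"
    then have "x \<in> \<Union>X" using K'(2) by (simp only:)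
    then have "f x \<in> \<Union>X" and xU: "x \<in> \<Union>X'" using subsetD[OF f imageI] U by (simp_all only:)
    then have fx: "f x \<in> polyh ?K" using K(2) by (simp only:)
    then show "f x \<in> polyh ?K" .
    let ?T = "car ?K' x" and ?W = "car ?K (f x)"
    have T: "?T \<in> ?K'" "?T \<noteq> {}" "x \<in> convex hull ?T"
      using car_in[OF K'(1) x] car_nonempty[OF K'(1) x] in_hull_car[OF K'(1) x] by auto
    have Ti: "\<not> affine_dependent ?T" "finite ?T" using geo_complexD(3,6)[OF K'(1) T(1)] by auto
    have xT: "x \<in> affine hull ?T" using T(3) convex_hull_subset_affine_hull by auto
    obtain R where R: "R \<in> X'" "?T = simplex_vertices R" using T by (auto simp: vsets_def)
    have W: "?W \<in> ?K" "?W \<noteq> {}" "f x \<in> convex hull ?W"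
      using car_in[OF K(1) fx] car_nonempty[OF K(1) fx] in_hull_car[OF K(1) fx] by auto
    obtain S where S: "S \<in> X" "?W = simplex_vertices S" using W by (auto simp: vsets_def)
    have hullW: "convex hull ?W = S" using complex_vertices(2)[OF X S(1)] S(2) by simp
    have "f x \<in> rel_interior S" using rel_interior_hull_iff[OF K(1) W(1,2), of "f x"] W(3) hullW by simp
    then have gxW: "g x \<in> convex hull ?W" using carrier[OF xU S(1)] hullW by simp
    let ?V = "g ` ?T"
    have V: "?V \<in> ?K" using simplicial_map_vsets[OF X X' gmap R(1)] R(2) by simp
    have Vi: "\<not> affine_dependent ?V" using geo_complexD(3)[OF K(1) V] .
    define \<beta> where "\<beta> = bary ?T x"
    have \<beta>: "\<And>v. v \<in> ?T \<Longrightarrow> \<beta> v > 0" "sum \<beta> ?T = 1" "(\<Sum>v\<in>?T. \<beta> v *\<^sub>R v) = x"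
      unfolding \<beta>_def using bary_car_pos[OF K'(1) x] bary[OF Ti(2) xT] by auto
    have "g (\<Sum>v\<in>?T. \<beta> v *\<^sub>R v) = (\<Sum>v\<in>?T. \<beta> v *\<^sub>R g v)"
      using gmap R(1) \<beta>(1,2) unfolding simplicial_map_def R(2) by (simp add: less_imp_le)
    then have gx: "g x = (\<Sum>v\<in>?T. \<beta> v *\<^sub>R g v)" using \<beta>(3) by simp
    have "g x \<in> convex hull ?V" unfolding gx
      by (rule convex_sum[OF Ti(2) convex_convex_hull \<beta>(2)]) (use \<beta>(1) in \<open>auto simp: less_imp_le hull_inc\<close>)
    then have gxVW: "g x \<in> convex hull (?V \<inter> ?W)" using geo_complexD(5)[OF K(1) V W(1)] gxW by simp
    show "?V \<subseteq> ?W"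
    proof (rule ccontr)
      assume "\<not> ?V \<subseteq> ?W"
      then obtain w where w: "w \<in> ?T" "g w \<notin> ?W" by auto
      then have "bary ?V (g x) (g w) = 0"
        using hull_subset_iff[OF Vi, of "?V \<inter> ?W" "g x"] gxVW by auto
      moreover have "bary ?V (g x) (g w) = (\<Sum>v\<in>?T. \<beta> v * bary ?V (g v) (g w))"
        unfolding gx by (rule bary_affine[OF Vi Ti(2) \<beta>(2)]) (use w in \<open>auto simp: hull_inc\<close>)
      moreover have "(\<Sum>v\<in>?T. \<beta> v * bary ?V (g v) (g w)) > 0"
      proof (rule sum_pos2[OF Ti(2) w(1)])
        show "0 < \<beta> w * bary ?V (g w) (g w)" using \<beta>(1)[OF w(1)] bary_vertex[OF Vi, of "g w" "g w"] w(1) by simp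
        show "0 \<le> \<beta> v * bary ?V (g v) (g w)" if "v \<in> ?T" for v
          using \<beta>(1)[OF that] bary_vertex[OF Vi, of "g w" "g v"] w(1) that by simp
      qed
      ultimately show False by simp
    qed
  qed
qed

text \<open>Every arbitrary orientation occurs twice and cancels: the one of \<open>S\<close> as
  \<open>G\<close>, in the subdivision and in the image; the one of each \<open>T\<close> as
  \<open>\<epsilon>\<close>, in the subdivision and under \<open>push\<close>.\<close>

lemma chain_matrix_diag:
  assumes X: "simplicial_complex X" and sub: "subdivision_of X' X" and a: "appr (vsets X') (vsets X) f g"
    and S: "S \<in> p_simplices p X"
  shows "of_rat (chain_matrix p X X' g S S) =
    lookup (amap (vsets X') g (sx (simplex_vertices S))) (simplex_vertices S)"
proof -
  have X': "simplicial_complex X'" using sub by (auto simp: subdivision_of_def)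
  let ?V = "simplex_vertices S" and ?K = "vsets X" and ?K' = "vsets X'"
  have SX: "S \<in> X" and cardV: "card ?V = Suc p" using S p_simplices_iff[OF X] by auto
  note V = complex_vertices[OF X SX] and vo = vertex_order[OF X SX]
  have V0: "?V \<noteq> {}" using cardV by auto
  define G where "G = sgn (Determinant.det (bordered (vertex_order S) (srt ?V)))"
  have G: "G * G = 1" using det_bordered_nonzero[OF V(1) vo V0] by (auto simp: G_def sgn_real_def)
  have fin: "finite (p_simplices p X)" "finite (p_simplices p X')"
    using X X' by (auto simp: p_simplices_def simplicial_complex_def)
  let ?I = "{T \<in> p_simplices p X'. T \<subseteq> S}"
  let ?r = "\<lambda>T. of_rat (relative_orientation (vertex_order S) (vertex_order T)) *
      of_rat (oriented_simplex (map g (vertex_order T)) S) :: real"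
  have "chain_matrix p X X' g S S = (\<Sum>T\<in>p_simplices p X'.
      if T \<subseteq> S then relative_orientation (vertex_order S) (vertex_order T) * oriented_simplex (map g (vertex_order T)) S else 0)"
    unfolding chain_matrix_def induced_chain_map_def
  proof (intro sum.cong refl)
    fix T assume T: "T \<in> p_simplices p X'"
    have "subdivision_operator p X X' (basis_chain S) T = (\<Sum>S'\<in>p_simplices p X.
        if S' = S then (if T \<subseteq> S then relative_orientation (vertex_order S) (vertex_order T) else 0) else 0)"
      unfolding subdivision_operator_def by (intro sum.cong refl) (auto simp: basis_chain_def T)
    then have "subdivision_operator p X X' (basis_chain S) T =
        (if T \<subseteq> S then relative_orientation (vertex_order S) (vertex_order T) else 0)"
      using S fin by simp
    then show "subdivision_operator p X X' (basis_chain S) T * oriented_simplex (map g (vertex_order T)) S =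
      (if T \<subseteq> S then relative_orientation (vertex_order S) (vertex_order T) * oriented_simplex (map g (vertex_order T)) S else 0)"
      by simp
  qed
  also have "\<dots> = (\<Sum>T\<in>?I. relative_orientation (vertex_order S) (vertex_order T) * oriented_simplex (map g (vertex_order T)) S)"
    by (rule sum.inter_filter[OF fin(2), symmetric])
  finally have lhs: "of_rat (chain_matrix p X X' g S S) = (\<Sum>T\<in>?I. ?r T)"
    by (simp add: of_rat_sum of_rat_mult)
  have bij: "bij_betw simplex_vertices ?I (sdset ?K' ?V)"
  proof (rule bij_betw_imageI)
    show "inj_on simplex_vertices ?I"
      using complex_vertices(2)[OF X'] p_simplices_iff[OF X'] by (intro inj_on_inverseI[of _ "\<lambda>V. convex hull V"]) auto
    show "simplex_vertices ` ?I = sdset ?K' ?V"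
    proof
      show "simplex_vertices ` ?I \<subseteq> sdset ?K' ?V"
      proof clarify
        fix T assume T: "T \<in> p_simplices p X'" "T \<subseteq> S"
        then have "T \<in> X'" "card (simplex_vertices T) = Suc p" using p_simplices_iff[OF X'] by auto
        moreover have "simplex_vertices T \<subseteq> convex hull ?V"
          using hull_subset[of "simplex_vertices T" convex] complex_vertices(2)[OF X' \<open>T \<in> X'\<close>] V(2) T(2) by auto
        ultimately show "simplex_vertices T \<in> sdset ?K' ?V" using cardV by (auto simp: sdset_def vsets_def)
      qed
      show "sdset ?K' ?V \<subseteq> simplex_vertices ` ?I"
      proof
        fix W assume "W \<in> sdset ?K' ?V"
        then have W: "W \<in> ?K'" "W \<subseteq> convex hull ?V" "card W = Suc p" using cardV by (auto simp: sdset_def)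
        then have "W \<noteq> {}" by auto
        then obtain T where T: "T \<in> X'" "W = simplex_vertices T" using W(1) by (auto simp: vsets_def)
        have "convex hull W \<subseteq> convex hull ?V" using W(2) by (simp add: subset_hull)
        then have "T \<subseteq> S" using complex_vertices(2)[OF X' T(1)] T(2) V(2) by simp
        then show "W \<in> simplex_vertices ` ?I" using T W(3) p_simplices_iff[OF X'] by auto
      qed
    qed
  qed
  have "lookup (amap ?K' g (sx ?V)) ?V = (\<Sum>W\<in>sdset ?K' ?V. sgn (lookup (lam ?V (sx W)) ?V) * lookup (push g (sx W)) ?V)"
    by (simp add: amap_def sd_sx lookup_sum)
  also have "\<dots> = (\<Sum>T\<in>?I. sgn (lookup (lam ?V (sx (simplex_vertices T))) ?V) * lookup (push g (sx (simplex_vertices T))) ?V)"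
    by (rule sum.reindex_bij_betw[OF bij, symmetric])
  also have "\<dots> = (\<Sum>T\<in>?I. ?r T)"
  proof (intro sum.cong refl)
    fix T assume T: "T \<in> ?I"
    then have TX: "T \<in> X'" and TS: "T \<subseteq> S" and cardT: "card (simplex_vertices T) = Suc p"
      using p_simplices_iff[OF X'] by auto
    let ?W = "simplex_vertices T" and ?ws = "vertex_order T"
    note W = complex_vertices[OF X' TX] and ws = vertex_order[OF X' TX]
    have lws: "length ?ws = card ?V" using distinct_card[OF ws(1)] ws(2) cardT cardV by simp
    have "?W \<subseteq> convex hull ?V" using hull_subset[of ?W convex] W(2) V(2) TS by auto
    then have wsV: "set ?ws \<subseteq> affine hull ?V" using ws(2) convex_hull_subset_affine_hull[of ?V] by auto
    obtain \<epsilon> where \<epsilon>: "\<epsilon> = 1 \<or> \<epsilon> = - 1" "wl ?ws = \<epsilon> *\<^sub>R sx ?W" using wl_distinct[OF ws(1)] ws(2) by auto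
    have r1: "of_rat (relative_orientation (vertex_order S) ?ws) = G * (\<epsilon> * sgn (lookup (lam ?V (sx ?W)) ?V))"
      unfolding relative_orientation_eq[OF V(1) vo V0 lws wsV] G_def \<epsilon>(2) using \<epsilon>(1) by auto
    have push: "wl (map g ?ws) = \<epsilon> *\<^sub>R push g (sx ?W)"
      using push_wl[of g ?ws] \<epsilon>(2) by simp
    show "sgn (lookup (lam ?V (sx ?W)) ?V) * lookup (push g (sx ?W)) ?V = ?r T"
    proof (cases "distinct (map g ?ws) \<and> S = convex hull (set (map g ?ws))")
      case True
      have "g ` ?W \<in> ?K"
        using appr_simplicial[OF a geo_vsets[OF X'] geo_vsets[OF X]] TX by (auto simp: vsets_def)
      then have "\<not> affine_dependent (g ` ?W)" using geo_complexD(3)[OF geo_vsets[OF X]] by simp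
      then have gW: "set (map g ?ws) = ?V" using True ws(2) simplex_vertices_hull[of "g ` ?W"] by simp
      obtain \<delta> where \<delta>: "\<delta> = 1 \<or> \<delta> = - 1" "wl (map g ?ws) = \<delta> *\<^sub>R sx ?V"
        using wl_distinct[of "map g ?ws"] True gW by auto
      have "lam ?V (wl (map g ?ws)) = wl (map g ?ws)" by (rule lam_vertices[OF V(1)]) (simp only: gW subset_refl)
      then have "lookup (lam ?V (wl (map g ?ws))) ?V = \<delta>"
        by (simp only: \<delta>(2)) (simp add: lookup_sx)
      then have r2: "of_rat (relative_orientation (vertex_order S) (map g ?ws)) = G * \<delta>"
        unfolding G_def using relative_orientation_eq[OF V(1) vo V0, of "map g ?ws"] lws gW \<delta>(1) hull_subset[of ?V affine] by auto
      have "\<epsilon> * lookup (push g (sx ?W)) ?V = \<delta>"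
        using arg_cong[OF push, of "\<lambda>c. lookup c ?V"] \<delta>(2) by (simp add: lookup_sx)
      then have lp: "lookup (push g (sx ?W)) ?V = \<epsilon> * \<delta>" using \<epsilon>(1) by auto
      have "?r T = (G * (\<epsilon> * sgn (lookup (lam ?V (sx ?W)) ?V))) * (G * \<delta>)"
        unfolding r1 oriented_simplex_def using True r2 by simp
      also have "\<dots> = (G * G) * (sgn (lookup (lam ?V (sx ?W)) ?V) * (\<epsilon> * \<delta>))" by (simp add: mult_ac)
      finally show ?thesis using G lp by simp
    next
      \<comment> \<open>The image is degenerate or a simplex other than \<open>S\<close>, so both
        coefficients are 0.\<close>
      case False
      have "lookup (wl (map g ?ws)) ?V = 0"
      proof (cases "distinct (map g ?ws)")
        case True
        then have "set (map g ?ws) \<noteq> ?V" using False V(2) by auto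
        then show ?thesis using CS_lookup[OF wl_mem[of "map g ?ws"], of ?V] by auto
      next
        case False then show ?thesis using wl_not_distinct[OF False] by simp
      qed
      then have "lookup (push g (sx ?W)) ?V = 0" unfolding push using \<epsilon>(1) by auto
      moreover have "oriented_simplex (map g ?ws) S = 0"
        unfolding oriented_simplex_def using False by auto
      ultimately show ?thesis by simp
    qed
  qed
  finally show ?thesis using lhs by simp
qed

text \<open>Grouping the simplices by dimension \<open>card V - 1\<close> turns signs by dimension
  into minus the signs by cardinality. Affine independence bounds the dimension by
  \<open>DIM('a)\<close>, so the sum over \<open>p\<close> reaches all of them.\<close>

lemma combinatorial_Lefschetz_eq:
  fixes X :: "'a::euclidean_space set set"
  assumes X: "simplicial_complex X" and sub: "subdivision_of X' X" and a: "appr (vsets X') (vsets X) f g"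
    and A: "open_union (vsets X) A"
  shows "of_rat (combinatorial_Lefschetz X X' g A) = - lef (vsets X) (vsets X') g A"
proof -
  let ?K = "vsets X"
  note K = geo_vsets[OF X]
  define h where "h V = lookup (amap (vsets X') g (sx V)) V" for V
  define Q where "Q = {V. V \<in> ?K \<and> V \<noteq> {} \<and> bc V \<in> A}"
  have finQ: "finite Q" using geo_complexD(1)[OF K] by (simp add: Q_def)
  let ?P = "\<lambda>p. {S. S \<in> p_simplices p X \<and> rel_interior S \<subseteq> A}"
  have relint: "rel_interior S \<subseteq> A \<longleftrightarrow> bc (simplex_vertices S) \<in> A" if S: "S \<in> X" and ne: "simplex_vertices S \<noteq> {}" for S
  proof -
    let ?V = "simplex_vertices S"
    have V: "?V \<in> ?K" using S by (auto simp: vsets_def)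
    have ri: "x \<in> rel_interior S \<longleftrightarrow> x \<in> convex hull ?V \<and> car ?K x = ?V" for x
      using rel_interior_hull_iff[OF K V ne] complex_vertices(2)[OF X S] by simp
    show ?thesis
    proof
      assume "rel_interior S \<subseteq> A"
      moreover have "bc ?V \<in> rel_interior S"
        unfolding ri using bc_in_hull[OF complex_vertices(1)[OF X S] ne] car_bc[OF K V ne] by simp
      ultimately show "bc ?V \<in> A" by auto
    next
      assume bcA: "bc ?V \<in> A"
      show "rel_interior S \<subseteq> A"
      proof
        fix x assume "x \<in> rel_interior S"
        then have "x \<in> polyh ?K" "car ?K (bc ?V) = car ?K x"
          unfolding ri using polyhI[OF V] car_bc[OF K V ne] by auto
        then show "x \<in> A" using A bcA unfolding open_union_def by blast
      qed
    qed
  qed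
  have inner: "(\<Sum>S\<in>?P p. of_rat (chain_matrix p X X' g S S)) = (\<Sum>V\<in>{V \<in> Q. card V - 1 = p}. h V)" for p
  proof -
    have "bij_betw simplex_vertices (?P p) {V \<in> Q. card V - 1 = p}"
    proof (rule bij_betw_imageI)
      show "inj_on simplex_vertices (?P p)"
        using complex_vertices(2)[OF X] p_simplices_iff[OF X] by (intro inj_on_inverseI[of _ "\<lambda>V. convex hull V"]) auto
      show "simplex_vertices ` ?P p = {V \<in> Q. card V - 1 = p}"
      proof
        show "simplex_vertices ` ?P p \<subseteq> {V \<in> Q. card V - 1 = p}"
        proof (rule image_subsetI)
          fix S assume "S \<in> ?P p"
          then have S: "S \<in> p_simplices p X" "rel_interior S \<subseteq> A" by auto
          then have SX: "S \<in> X" "card (simplex_vertices S) = Suc p" using p_simplices_iff[OF X] by auto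
          then have ne: "simplex_vertices S \<noteq> {}" by auto
          then show "simplex_vertices S \<in> {V \<in> Q. card V - 1 = p}"
            using relint[OF SX(1) ne] S(2) SX by (auto simp: Q_def vsets_def)
        qed
        show "{V \<in> Q. card V - 1 = p} \<subseteq> simplex_vertices ` ?P p"
        proof clarify
          fix V assume V: "V \<in> Q" "p = card V - 1"
          then have ne: "V \<noteq> {}" and VK: "V \<in> ?K" and bcA: "bc V \<in> A" by (auto simp: Q_def)
          then obtain S where S: "S \<in> X" "V = simplex_vertices S" by (auto simp: vsets_def)
          have "card V > 0" using ne geo_complexD(6)[OF K VK] by (simp add: card_gt_0_iff)
          then have "S \<in> p_simplices (card V - 1) X" using S by (simp add: p_simplices_iff[OF X])
          then show "V \<in> simplex_vertices ` {S. S \<in> p_simplices (card V - 1) X \<and> rel_interior S \<subseteq> A}"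
            using S relint[OF S(1)] ne bcA by auto
        qed
      qed
    qed
    from sum.reindex_bij_betw[OF this, of h]
    show ?thesis
      using chain_matrix_diag[OF X sub a] by (simp add: h_def)
  qed
  have "(of_rat (combinatorial_Lefschetz X X' g A) :: real) =
      (\<Sum>p\<le>DIM('a). (- 1) ^ p * (\<Sum>S\<in>?P p. of_rat (chain_matrix p X X' g S S)))"
    unfolding combinatorial_Lefschetz_def by (simp add: of_rat_sum of_rat_mult of_rat_power)
  also have "\<dots> = (\<Sum>p\<le>DIM('a). \<Sum>V\<in>{V \<in> Q. card V - 1 = p}. - ((- 1) ^ card V * h V))"
    unfolding inner sum_distrib_left
  proof (intro sum.cong refl)
    fix p V assume V: "V \<in> {V \<in> Q. card V - 1 = p}"
    then have "card V > 0" using geo_complexD(6)[OF K] by (auto simp: Q_def card_gt_0_iff)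
    then have "card V = Suc p" using V by auto
    then show "(- 1) ^ p * h V = - ((- 1) ^ card V * h V)" by simp
  qed
  also have "\<dots> = (\<Sum>V\<in>Q. - ((- 1) ^ card V * h V))"
  proof (rule sum.group[OF finQ, of "{..DIM('a)}" "\<lambda>V. card V - 1"])
    show "(\<lambda>V. card V - 1) ` Q \<subseteq> {..DIM('a)}"
    proof (rule image_subsetI)
      fix V assume "V \<in> Q"
      then have "int (card V) = aff_dim V + 1"
        using aff_dim_affine_independent[OF geo_complexD(3)[OF K]] by (auto simp: Q_def)
      then show "card V - 1 \<in> {..DIM('a)}" using aff_dim_le_DIM[of V] by auto
    qed
  qed simp
  also have "\<dots> = - lef (vsets X) (vsets X') g A"
    by (simp add: lef_def Q_def h_def sum_negf)
  finally show ?thesis .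
qed

lemma open_union_triangulation:
  assumes X: "simplicial_complex X" and F: "F \<subseteq> X" "A = (\<Union>S\<in>F. rel_interior S)"
  shows "open_union (vsets X) A"
  unfolding open_union_def
proof (intro conjI ballI impI)
  note K = geo_vsets[OF X]
  show "A \<subseteq> polyh (vsets X)" using F rel_interior_subset polyh_vsets[OF X] by blast
  fix x y assume "x \<in> A" and y: "y \<in> polyh (vsets X)" and eq: "car (vsets X) x = car (vsets X) y"
  then obtain S where S: "S \<in> F" "x \<in> rel_interior S" using F by auto
  have SX: "S \<in> X" using S F by auto
  let ?V = "simplex_vertices S"
  have hull: "convex hull ?V = S" using complex_vertices(2)[OF X SX] .
  have V: "?V \<in> vsets X" "?V \<noteq> {}" using SX S(2) hull rel_interior_subset[of S] by (auto simp: vsets_def)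
  have "car (vsets X) y = ?V" using rel_interior_hull_iff[OF K V, of x] S(2) hull eq by simp
  then have "y \<in> rel_interior S"
    using rel_interior_hull_iff[OF K V, of y] in_hull_car[OF K y] hull by simp
  then show "y \<in> A" using S F by auto
qed

lemma definable_triangulationD:
  assumes "definable_triangulation \<S> Z D l X A f"
  shows "simplicial_complex X" "open_union (vsets X) A"
    and "\<exists>\<tau> \<tau>'. homeomorphism (\<Union>X) (\<Union>Z) \<tau> \<tau>' \<and> A = {x \<in> \<Union>X. \<tau> x \<in> D} \<and> (\<forall>x\<in>\<Union>X. f x = \<tau>' (l (\<tau> x)))"
proof -
  show X: "simplicial_complex X" using assms by (simp add: definable_triangulation_def)
  have "\<exists>F\<subseteq>X. A = (\<Union>S\<in>F. rel_interior S)"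
    using assms unfolding definable_triangulation_def by (elim conjE exE) (intro exI conjI)
  then show "open_union (vsets X) A" using open_union_triangulation[OF X] by metis
  show "\<exists>\<tau> \<tau>'. homeomorphism (\<Union>X) (\<Union>Z) \<tau> \<tau>' \<and> A = {x \<in> \<Union>X. \<tau> x \<in> D} \<and> (\<forall>x\<in>\<Union>X. f x = \<tau>' (l (\<tau> x)))"
    using assms unfolding definable_triangulation_def by (elim conjE exE) (intro exI conjI)
qed

theorem theorem3p8:
  fixes \<S> :: "nat \<Rightarrow> real list set set"
    and Z :: "'c::euclidean_space set set" and D :: "'c set" and l :: "'c \<Rightarrow> 'c"
    and X X' :: "'a::euclidean_space set set" and A :: "'a set" and f f_simp :: "'a \<Rightarrow> 'a"
    and Y Y' :: "'b::euclidean_space set set" and B :: "'b set" and g g_simp :: "'b \<Rightarrow> 'b"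
  assumes "o_minimal_structure \<S>"
    and "simplicial_complex Z"
    and "D \<subseteq> \<Union>Z" and "definable \<S> D"
    and "continuous_map (top_of_set (\<Union>Z)) (top_of_set (\<Union>Z)) l"
    and "open_map (top_of_set (\<Union>Z)) (top_of_set (\<Union>Z)) l"
    and "l ` D \<subseteq> D" and "l ` (\<Union>Z - D) \<subseteq> \<Union>Z - D"
    and "definable_triangulation \<S> Z D l X A f"
    and "definable_triangulation \<S> Z D l Y B g"
    and "subdivision_of X' X" and "simplicial_approximation X' X f f_simp"
    and "subdivision_of Y' Y" and "simplicial_approximation Y' Y g g_simp"
  shows "combinatorial_Lefschetz X X' f_simp A = combinatorial_Lefschetz Y Y' g_simp B"
proof -
  note TX = definable_triangulationD[OF assms(9)] and TY = definable_triangulationD[OF assms(10)]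
  note X = TX(1) and oA = TX(2) and Y = TY(1) and oB = TY(2)
  obtain \<tau> \<tau>' where \<tau>: "homeomorphism (\<Union>X) (\<Union>Z) \<tau> \<tau>'"
    and A: "A = {x \<in> \<Union>X. \<tau> x \<in> D}" and f: "\<And>x. x \<in> \<Union>X \<Longrightarrow> f x = \<tau>' (l (\<tau> x))"
    using TX(3) by metis
  obtain \<sigma> \<sigma>' where \<sigma>: "homeomorphism (\<Union>Y) (\<Union>Z) \<sigma> \<sigma>'"
    and B: "B = {y \<in> \<Union>Y. \<sigma> y \<in> D}" and g: "\<And>y. y \<in> \<Union>Y \<Longrightarrow> g y = \<sigma>' (l (\<sigma> y))"
    using TY(3) by metis
  have lc: "continuous_on (\<Union>Z) l" "l ` \<Union>Z \<subseteq> \<Union>Z"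
    using assms(5) by (auto simp: continuous_map_subtopology_eu)
  have lo: "openin (top_of_set (\<Union>Z)) (l ` U)" if "openin (top_of_set (\<Union>Z)) U" for U
    using assms(6) that by (auto simp: open_map_def)
  have \<tau>1: "\<tau>' (\<tau> x) = x" "\<tau> x \<in> \<Union>Z" if "x \<in> \<Union>X" for x
    using homeomorphism_apply1[OF \<tau> that] imageI[OF that, of \<tau>] homeomorphism_image1[OF \<tau>] by (simp_all only:)
  have \<tau>2: "\<tau> (\<tau>' z) = z" "\<tau>' z \<in> \<Union>X" if "z \<in> \<Union>Z" for z
    using homeomorphism_apply2[OF \<tau> that] imageI[OF that, of \<tau>'] homeomorphism_image2[OF \<tau>] by (simp_all only:)
  have \<sigma>1: "\<sigma>' (\<sigma> x) = x" "\<sigma> x \<in> \<Union>Z" if "x \<in> \<Union>Y" for x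
    using homeomorphism_apply1[OF \<sigma> that] imageI[OF that, of \<sigma>] homeomorphism_image1[OF \<sigma>] by (simp_all only:)
  have \<sigma>2: "\<sigma> (\<sigma>' z) = z" "\<sigma>' z \<in> \<Union>Y" if "z \<in> \<Union>Z" for z
    using homeomorphism_apply2[OF \<sigma> that] imageI[OF that, of \<sigma>'] homeomorphism_image2[OF \<sigma>] by (simp_all only:)
  have lZ: "l z \<in> \<Union>Z" if "z \<in> \<Union>Z" for z using lc(2) that by auto
  have fX: "f ` \<Union>X \<subseteq> \<Union>X" using f \<tau>1 \<tau>2 lZ by (metis image_subsetI)
  have gY: "g ` \<Union>Y \<subseteq> \<Union>Y" using g \<sigma>1 \<sigma>2 lZ by (metis image_subsetI)
  \<comment> \<open>Stated for a separate type \<open>'d\<close>, as it serves both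
    triangulations.\<close>
  have conj_cont: "continuous_on P \<phi>"
    if "homeomorphism P (\<Union>Z) \<rho> \<rho>'" "\<And>x. x \<in> P \<Longrightarrow> \<phi> x = \<rho>' (l (\<rho> x))"
    for P :: "'d::euclidean_space set" and \<phi> \<rho> \<rho>'
  proof -
    have \<rho>: "continuous_on P \<rho>" "\<rho> ` P = \<Union>Z" "continuous_on (\<Union>Z) \<rho>'"
      using that(1) by (auto simp: homeomorphism_def)
    have "continuous_on P (\<lambda>x. l (\<rho> x))" by (rule continuous_on_compose2[OF lc(1) \<rho>(1)]) (use \<rho>(2) in auto)
    then have "continuous_on P (\<lambda>x. \<rho>' (l (\<rho> x)))"
    proof (rule continuous_on_compose2[OF \<rho>(3)], intro image_subsetI lZ)
      show "\<rho> x \<in> \<Union>Z" if "x \<in> P" for x using imageI[OF that, of \<rho>] \<rho>(2) by (simp only:)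
    qed
    then show ?thesis using that(2) by (simp cong: continuous_on_cong)
  qed
  \<comment> \<open>The passage between the triangulations through \<open>Z\<close>: in
    \<open>k \<circ> g \<circ> h\<close> the maps \<open>\<sigma>\<close> and
    \<open>\<sigma>'\<close> cancel, which leaves \<open>f\<close>.\<close>
  define h where "h = \<sigma>' \<circ> \<tau>"
  define k where "k = \<tau>' \<circ> \<sigma>"
  have hk: "homeomorphism (\<Union>X) (\<Union>Y) h k"
    unfolding h_def k_def by (rule homeomorphism_compose[OF \<tau> homeomorphism_symD[OF \<sigma>]])
  have hA: "h ` A = B"
  proof
    show "h ` A \<subseteq> B"
    proof (rule image_subsetI)
      fix x assume "x \<in> A"
      then have x: "x \<in> \<Union>X" "\<tau> x \<in> D" by (auto simp: A)
      show "h x \<in> B" using \<sigma>2[OF \<tau>1(2)[OF x(1)]] x(2) by (simp add: B h_def del: Union_iff)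
    qed
    show "B \<subseteq> h ` A"
    proof
      fix y assume y: "y \<in> B"
      then have yY: "y \<in> \<Union>Y" "\<sigma> y \<in> D" by (auto simp: B)
      have "y = h (\<tau>' (\<sigma> y))" using \<sigma>1[OF yY(1)] \<tau>2 by (simp add: h_def del: Union_iff)
      moreover have "\<tau>' (\<sigma> y) \<in> A" using \<sigma>1[OF yY(1)] \<tau>2 yY(2) by (simp add: A del: Union_iff)
      ultimately show "y \<in> h ` A" by blast
    qed
  qed
  note PX = polyh_vsets[OF X] and PY = polyh_vsets[OF Y]
  have aX: "appr (vsets X') (vsets X) f f_simp" by (rule appr_vsets[OF X assms(11,12) fX])
  have aY: "appr (vsets Y') (vsets Y) g g_simp" by (rule appr_vsets[OF Y assms(13,14) gY])
  have "lef (vsets X) (vsets X') f_simp A = lef (vsets Y) (vsets Y') g_simp (h ` A)"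
  proof (rule lef_invariance[OF subdv_vsets[OF X assms(11)] aX subdv_vsets[OF Y assms(13)] aY, unfolded PX PY])
    show "homeomorphism (\<Union>X) (\<Union>Y) h k" by (rule hk)
    show "f x = k (g (h x))" if "x \<in> \<Union>X" for x
      using that \<tau>1 \<tau>2 \<sigma>1 \<sigma>2 lZ by (simp add: f g h_def k_def del: Union_iff)
    show "continuous_on (\<Union>X) f" by (rule conj_cont[OF \<tau> f])
    show "continuous_on (\<Union>Y) g" by (rule conj_cont[OF \<sigma> g])
    show "openin (top_of_set (\<Union>X)) (f ` U)" if U: "openin (top_of_set (\<Union>X)) U" for U
    proof -
      have UX: "U \<subseteq> \<Union>X" using U by (rule openin_imp_subset)
      have "openin (top_of_set (\<Union>X)) (\<tau>' ` l ` \<tau> ` U)"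
        by (intro homeomorphism_imp_open_map[OF homeomorphism_symD[OF \<tau>]] lo homeomorphism_imp_open_map[OF \<tau>] U)
      moreover have "\<tau>' ` l ` \<tau> ` U = f ` U"
        unfolding image_image by (rule image_cong[OF refl]) (rule f[OF subsetD[OF UX], symmetric])
      ultimately show ?thesis by simp
    qed
    show "open_union (vsets X) A" by (rule oA)
    show "open_union (vsets Y) (h ` A)" using oB hA by simp
    \<comment> \<open>Invariance of \<open>D\<close> under \<open>l\<close> gives one direction,
      invariance of its complement the other.\<close>
    show "f x \<in> A \<longleftrightarrow> x \<in> A" if x: "x \<in> \<Union>X" for x
    proof -
      have "f x \<in> A \<longleftrightarrow> l (\<tau> x) \<in> D" using x \<tau>2[OF lZ[OF \<tau>1(2)[OF x]]] by (simp add: A f del: Union_iff)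
      also have "\<dots> \<longleftrightarrow> \<tau> x \<in> D" using assms(7,8) \<tau>1(2)[OF x] by auto
      also have "\<dots> \<longleftrightarrow> x \<in> A" using x by (simp add: A)
      finally show ?thesis .
    qed
  qed
  then have "(of_rat (combinatorial_Lefschetz X X' f_simp A) :: real) = of_rat (combinatorial_Lefschetz Y Y' g_simp B)"
    unfolding combinatorial_Lefschetz_eq[OF X assms(11) aX oA] combinatorial_Lefschetz_eq[OF Y assms(13) aY oB] hA
    by simp
  then show ?thesis by (simp only: of_rat_eq_iff)
qed

end
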